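(* The deficiency indices $n_+$ and $n_-$ of $T_{\rm min}$ are less than or equal to $n$.
   Context: Let $(a,b)$ be a real (possibly unbounded) interval and $n\in\mathbb N$. Distributions of order $0$ on $(a,b)$ are distributional derivatives of functions of locally bounded variation; they are identified with (complex) measures on compact subsets of $(a,b)$. Let $J$ be a constant, invertible, skew-Hermitian $n\times n$-matrix, and let $q,w$ be $n\times n$-matrices of distributions of order $0$ on $(a,b)$ with $q$ Hermitian and $w$ non-negative. A function $u$ of locally bounded variation is balanced if $u=(u^++u^-)/2$, where $u^\pm$ are the right- and left-hand limits; $\operatorname{BV}^\#_{\rm loc}((a,b))$ is the space of balanced functions of locally bounded variation. $\mathcal L^2(w)$ is the space of ($\mathbb C^n$-valued) functions with $\int f^*wf<\infty$, with semi-inner product $\langle f,g\rangle=\int f^*wg$; $L^2(w)$ is its Hilbert space quotient modulo $\{u:\|u\|^2=\int u^*wu=0\}$, and $[u]$ denotes the class of $u$. Put $$\mathcal T_{\rm max}=\{(u,f)\in\mathcal L^2(w)\times\mathcal L^2(w): u\in\operatorname{BV}^\#_{\rm loc}((a,b))^n,\ Ju'+qu=wf\},$$ $$\mathcal T_{\rm min}=\{(u,f)\in\mathcal T_{\rm max}:\operatorname{supp}u\text{ is compact in }(a,b)\},$$ $T_{\rm max}=\{([u],[f])\in L^2(w)\times L^2(w):(u,f)\in\mathcal T_{\rm max}\}$ and $T_{\rm min}=\{([u],[f])\in T_{\rm max}:(u,f)\in\mathcal T_{\rm min}\}$; it is known that $T_{\rm min}$ is symmetric and $T_{\rm min}^*=T_{\rm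 max}$. Put $D_\lambda=\{([u],\lambda[u])\in T_{\rm max}\}$. The deficiency indices of $T_{\rm min}$ are $n_\pm=\dim D_{\pm i}$. *)

theory Defs
  imports "HOL-Analysis.Analysis" "Jordan_Normal_Form.Missing_VectorSpace"
begin

section \<open>Matrices\<close>

definition adjoint_matrix :: "complex^'n^'n \<Rightarrow> complex^'n^'n"
  where "adjoint_matrix A = (\<chi> i j. cnj (A $ j $ i))"

definition hermitian :: "complex^'n^'n \<Rightarrow> bool"
  where "hermitian A \<longleftrightarrow> adjoint_matrix A = A"

definition skew_hermitian :: "complex^'n^'n \<Rightarrow> bool"
  where "skew_hermitian A \<longleftrightarrow> adjoint_matrix A = - A"

definition quad_form :: "complex^'n^'n \<Rightarrow> complex^'n \<Rightarrow> complex"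
  where "quad_form A x = (\<Sum>i\<in>UNIV. cnj (x $ i) * (A *v x) $ i)"

definition nonneg_matrix :: "complex^'n^'n \<Rightarrow> bool"
  where "nonneg_matrix A \<longleftrightarrow> (\<forall>x. Im (quad_form A x) = 0 \<and> 0 \<le> Re (quad_form A x))"

section \<open>Functions of locally bounded variation\<close>

text \<open>
  The interval \<open>(a,b)\<close> is \<^term>\<open>einterval a b\<close> with extended real end points. Functions on
  \<open>(a,b)\<close> are total functions on \<open>real\<close> whose values outside \<open>(a,b)\<close> are never used.
\<close>

definition bounded_variation_on :: "real set \<Rightarrow> (real \<Rightarrow> 'v::real_normed_vector) \<Rightarrow> bool"
  where "bounded_variation_on S f \<longleftrightarrow>
    (\<exists>B. \<forall>(m::nat) t. (\<forall>i\<le>m. t i \<in> S) \<and> (\<forall>i<m. t i \<le> t (Suc i)) \<longrightarrow>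
       (\<Sum>i<m. norm (f (t (Suc i)) - f (t i))) \<le> B)"

definition locally_bv :: "ereal \<Rightarrow> ereal \<Rightarrow> (real \<Rightarrow> 'v::real_normed_vector) \<Rightarrow> bool"
  where "locally_bv a b f \<longleftrightarrow> (\<forall>c d. {c..d} \<subseteq> einterval a b \<longrightarrow> bounded_variation_on {c..d} f)"

definition balanced :: "ereal \<Rightarrow> ereal \<Rightarrow> (real \<Rightarrow> 'v::real_normed_vector) \<Rightarrow> bool"
  where "balanced a b f \<longleftrightarrow>
    (\<forall>x\<in>einterval a b. \<exists>l r. (f \<longlongrightarrow> l) (at_left x) \<and> (f \<longlongrightarrow> r) (at_right x) \<and>
       f x = (1/2) *\<^sub>R (l + r))"

definition balanced_bv :: "ereal \<Rightarrow> ereal \<Rightarrow> (real \<Rightarrow> 'v::real_normed_vector) set"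
  where "balanced_bv a b = {f. locally_bv a b f \<and> balanced a b f}"

section \<open>Distributions\<close>

text \<open>
  A distribution on \<open>(a,b)\<close> with complex, complex vector or complex matrix values is given by its
  values on the real-valued test functions; by complex linearity these determine its values on the
  complex-valued ones. Only the values at test functions matter. A matrix-valued distribution
  stands for the matrix of its components \<open>\<lambda>\<phi>. T \<phi> $ i $ j\<close>. With real test functions \<open>\<phi>\<close>, the
  distribution \<open>T\<close> equals its conjugate transpose iff every \<open>T \<phi>\<close> is a Hermitian matrix.
\<close>

type_synonym 'v dist = "(real \<Rightarrow> real) \<Rightarrow> 'v"

definition test_functions :: "ereal \<Rightarrow> ereal \<Rightarrow> (real \<Rightarrow> real) set"
  where "test_functions a b =
    {\<phi>. (\<forall>k x. (deriv ^^ k) \<phi> field_differentiable at x) \<and>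
        (\<exists>K. compact K \<and> K \<subseteq> einterval a b \<and> (\<forall>x. x \<notin> K \<longrightarrow> \<phi> x = 0))}"

definition dist_deriv ::
  "ereal \<Rightarrow> ereal \<Rightarrow> (real \<Rightarrow> 'v::{banach,second_countable_topology}) \<Rightarrow> 'v dist"
  where "dist_deriv a b u \<phi> = - (LINT x:einterval a b|lborel. deriv \<phi> x *\<^sub>R u x)"

definition order_zero ::
  "ereal \<Rightarrow> ereal \<Rightarrow> ('v::{banach,second_countable_topology}) dist \<Rightarrow> bool"
  where "order_zero a b T \<longleftrightarrow>
    (\<exists>U. locally_bv a b U \<and> (\<forall>\<phi>\<in>test_functions a b. T \<phi> = dist_deriv a b U \<phi>))"

definition hermitian_dist :: "ereal \<Rightarrow> ereal \<Rightarrow> (complex^'n^'n) dist \<Rightarrow> bool"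
  where "hermitian_dist a b T \<longleftrightarrow> (\<forall>\<phi>\<in>test_functions a b. hermitian (T \<phi>))"

definition nonneg_dist :: "ereal \<Rightarrow> ereal \<Rightarrow> (complex^'n^'n) dist \<Rightarrow> bool"
  where "nonneg_dist a b T \<longleftrightarrow>
    (\<forall>\<phi>\<in>test_functions a b. (\<forall>x. 0 \<le> \<phi> x) \<longrightarrow> nonneg_matrix (T \<phi>))"

text \<open>
  The local complex measure of a distribution \<open>T\<close> of order zero is written as \<open>H \<mu>\<close>, with \<open>\<mu>\<close> a
  positive measure on \<open>(a,b)\<close> that is finite on compact sets and \<open>H\<close> a locally integrable density.
  Every \<open>T\<close> of order zero has such a representation (take for \<open>\<mu>\<close> the total variation measure),
  and the measure \<open>H \<mu>\<close>, though not the pair \<open>(\<mu>, H)\<close>, is determined by \<open>T\<close>. Nothing below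
  depends on which pair is chosen. If \<open>T\<close> is a non-negative matrix, then \<open>H\<close> is non-negative
  almost everywhere with respect to \<open>\<mu>\<close>.
\<close>

definition represents ::
  "ereal \<Rightarrow> ereal \<Rightarrow> ('v::{banach,second_countable_topology}) dist \<Rightarrow> real measure \<Rightarrow> (real \<Rightarrow> 'v) \<Rightarrow> bool"
  where "represents a b T \<mu> H \<longleftrightarrow>
    sets \<mu> = sets (restrict_space borel (einterval a b)) \<and>
    H \<in> borel_measurable \<mu> \<and>
    (\<forall>K. compact K \<and> K \<subseteq> einterval a b \<longrightarrow> emeasure \<mu> K < \<infinity> \<and> set_integrable \<mu> K H) \<and>
    (\<forall>\<phi>\<in>test_functions a b. T \<phi> = (LINT x|\<mu>. \<phi> x *\<^sub>R H x))"

definition rep ::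
  "ereal \<Rightarrow> ereal \<Rightarrow> ('v::{banach,second_countable_topology}) dist \<Rightarrow> real measure \<times> (real \<Rightarrow> 'v)"
  where "rep a b T = (SOME (\<mu>, H). represents a b T \<mu> H)"

abbreviation rep_measure where "rep_measure a b T \<equiv> fst (rep a b T)"
abbreviation rep_density where "rep_density a b T \<equiv> snd (rep a b T)"

text \<open>
  The product of a matrix \<open>T\<close> of distributions of order zero and a vector-valued function \<open>g\<close>. It
  is applied to locally bounded Borel functions \<open>g\<close>, and to \<open>g\<close> in \<open>\<L>\<^sup>2(T)\<close> if \<open>T\<close> is non-negative.
  In the latter case \<open>H g\<close> is locally integrable by the Cauchy-Schwarz inequality.
\<close>

definition dist_times :: "ereal \<Rightarrow> ereal \<Rightarrow> (complex^'n^'n) dist \<Rightarrow> (real \<Rightarrow> complex^'n) \<Rightarrow> (complex^'n) dist"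
  where "dist_times a b T g \<phi> =
    (LINT x|rep_measure a b T. \<phi> x *\<^sub>R (rep_density a b T x *v g x))"

section \<open>The Hilbert space\<close>

definition norm_sq :: "ereal \<Rightarrow> ereal \<Rightarrow> (complex^'n^'n) dist \<Rightarrow> (real \<Rightarrow> complex^'n) \<Rightarrow> ennreal"
  where "norm_sq a b w f =
    (\<integral>\<^sup>+x. ennreal (Re (quad_form (rep_density a b w x) (f x))) \<partial>rep_measure a b w)"

definition pre_L2 :: "ereal \<Rightarrow> ereal \<Rightarrow> (complex^'n^'n) dist \<Rightarrow> (real \<Rightarrow> complex^'n) set"
  where "pre_L2 a b w =
    {f. f \<in> borel_measurable (restrict_space borel (einterval a b)) \<and> norm_sq a b w f < \<infinity>}"

definition cls :: "ereal \<Rightarrow> ereal \<Rightarrow> (complex^'n^'n) dist \<Rightarrow> (real \<Rightarrow> complex^'n) \<Rightarrow> (real \<Rightarrow> complex^'n) set"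
  where "cls a b w u = {v \<in> pre_L2 a b w. norm_sq a b w (\<lambda>x. v x - u x) = 0}"

definition complex_field :: "complex ring"
  where "complex_field = \<lparr>carrier = UNIV, mult = (*), one = 1, zero = 0, add = (+)\<rparr>"

text \<open>
  The ring multiplication and unit belong to the record type of modules but have no meaning here.
\<close>

definition L2 :: "ereal \<Rightarrow> ereal \<Rightarrow> (complex^'n^'n) dist \<Rightarrow> (complex, (real \<Rightarrow> complex^'n) set) module"
  where "L2 a b w =
    \<lparr>carrier = cls a b w ` pre_L2 a b w,
     mult = undefined,
     one = undefined,
     zero = cls a b w (\<lambda>x. 0),
     add = (\<lambda>X Y. \<Union>f\<in>X. \<Union>g\<in>Y. cls a b w (\<lambda>x. f x + g x)),
     smult = (\<lambda>c X. \<Union>f\<in>X. cls a b w (\<lambda>x. c *s f x))\<rparr>"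

section \<open>The relations and the deficiency indices\<close>

definition pre_T_max :: "ereal \<Rightarrow> ereal \<Rightarrow> complex^'n^'n \<Rightarrow> (complex^'n^'n) dist \<Rightarrow> (complex^'n^'n) dist \<Rightarrow>
    ((real \<Rightarrow> complex^'n) \<times> (real \<Rightarrow> complex^'n)) set"
  where "pre_T_max a b J q w =
    {(u, f). u \<in> pre_L2 a b w \<and> f \<in> pre_L2 a b w \<and> u \<in> balanced_bv a b \<and>
       (\<forall>\<phi>\<in>test_functions a b.
          J *v dist_deriv a b u \<phi> + dist_times a b q u \<phi> = dist_times a b w f \<phi>)}"

definition pre_T_min :: "ereal \<Rightarrow> ereal \<Rightarrow> complex^'n^'n \<Rightarrow> (complex^'n^'n) dist \<Rightarrow> (complex^'n^'n) dist \<Rightarrow>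
    ((real \<Rightarrow> complex^'n) \<times> (real \<Rightarrow> complex^'n)) set"
  where "pre_T_min a b J q w =
    {(u, f) \<in> pre_T_max a b J q w.
       \<exists>K. compact K \<and> K \<subseteq> einterval a b \<and> (\<forall>x\<in>einterval a b - K. u x = 0)}"

definition T_max :: "ereal \<Rightarrow> ereal \<Rightarrow> complex^'n^'n \<Rightarrow> (complex^'n^'n) dist \<Rightarrow> (complex^'n^'n) dist \<Rightarrow>
    ((real \<Rightarrow> complex^'n) set \<times> (real \<Rightarrow> complex^'n) set) set"
  where "T_max a b J q w = (\<lambda>(u, f). (cls a b w u, cls a b w f)) ` pre_T_max a b J q w"

definition T_min :: "ereal \<Rightarrow> ereal \<Rightarrow> complex^'n^'n \<Rightarrow> (complex^'n^'n) dist \<Rightarrow> (complex^'n^'n) dist \<Rightarrow>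
    ((real \<Rightarrow> complex^'n) set \<times> (real \<Rightarrow> complex^'n) set) set"
  where "T_min a b J q w = (\<lambda>(u, f). (cls a b w u, cls a b w f)) ` pre_T_min a b J q w"

definition D_space :: "ereal \<Rightarrow> ereal \<Rightarrow> complex^'n^'n \<Rightarrow> (complex^'n^'n) dist \<Rightarrow> (complex^'n^'n) dist \<Rightarrow>
    complex \<Rightarrow> ((real \<Rightarrow> complex^'n) set \<times> (real \<Rightarrow> complex^'n) set) set"
  where "D_space a b J q w z =
    {(X, Y) \<in> T_max a b J q w. Y = z \<odot>\<^bsub>L2 a b w\<^esub> X}"

text \<open>
  The dimension in \<open>VectorSpace\<close> is a natural number and only meaningful for finite-dimensional
  spaces, so infinite dimension is made explicit.
\<close>

definition dimension :: "(complex, 'c, 'd) module_scheme \<Rightarrow> enat"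
  where "dimension V =
    (if vectorspace.fin_dim complex_field V then enat (vectorspace.dim complex_field V) else \<infinity>)"

text \<open>
  The deficiency indices \<open>n\<^sub>+\<close>, \<open>n\<^sub>-\<close> of \<^const>\<open>T_min\<close> are the values at \<open>z = \<i>\<close> and \<open>z = - \<i>\<close>. The
  adjoint of \<^const>\<open>T_min\<close> is \<^const>\<open>T_max\<close>, which is why \<^const>\<open>D_space\<close> refers to the latter.
\<close>

definition deficiency_index :: "ereal \<Rightarrow> ereal \<Rightarrow> complex^'n^'n \<Rightarrow> (complex^'n^'n) dist \<Rightarrow>
    (complex^'n^'n) dist \<Rightarrow> complex \<Rightarrow> enat"
  where "deficiency_index a b J q w z =
    dimension ((direct_sum (L2 a b w) (L2 a b w))\<lparr>carrier := D_space a b J q w z\<rparr>)"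

end

theory Submission
  imports Defs "HOL-Real_Asymp.Real_Asymp"
begin

text \<open>
  The bound rests on the Lagrange identity. If \<open>u\<close> solves \<open>J u' + q u = z w u\<close> then, \<open>J\<close> being
  skew-Hermitian, \<open>q\<close> Hermitian and \<open>w\<close> non-negative,
  \<open>u\<^sup>* J u\<close> changes from the right limit at \<open>c\<close> to the right limit at \<open>d\<close> by
  \<open>2 \<i> Im z\<close> times the integral of \<open>u\<^sup>* w u\<close> over \<open>(c, d]\<close>. So, for non-real \<open>z\<close>, a solution with
  equal right limits at \<open>c\<close> and \<open>d\<close> vanishes on \<open>(c, d]\<close> as far as \<open>w\<close> can see it
  (\<open>solution_null_if_equal_limits\<close>). Equality of the limits is only \<open>n\<close> linear conditions. Among
  the combinations of \<open>n + 1\<close> solutions there is thus one with coefficient vector of norm \<open>1\<close>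
  which is null on \<open>(c, d]\<close>; as the intervals exhaust \<open>(a, b)\<close>, compactness of the sphere yields
  coefficients for which the combination is null on all of \<open>(a, b)\<close> (\<open>solutions_dependent\<close>). Any
  \<open>n + 1\<close> elements of a deficiency space are therefore linearly dependent. Initial value problems
  never enter; they need not be uniquely solvable here, since the measures may have atoms.

  Most of the work goes into making sense of the Lagrange identity for distributional
  coefficients. A function of locally bounded variation is decomposed into monotone functions,
  whose Stieltjes measures provide a measure and a density for its distributional derivative
  (\<open>bv_representation\<close>). This also shows that distributions of order zero have representing
  measures at all, so that the chosen ones may be used (\<open>order_zero_represents_rep\<close>). Smooth bump
  functions approximate indicators of intervals, and a density with non-negative integrals
  against all non-negative test functions is non-negative almost everywhere
  (\<open>AE_nonneg_if_test_nonneg\<close>). This turns the equation, the symmetry of \<open>q\<close> and the positivity of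
  \<open>w\<close> into almost everywhere statements on densities. Finally, as \<open>u\<close> is balanced, the measure of
  \<open>u\<^sup>* J u\<close> obeys the ordinary product rule without extra terms from the jumps
  (\<open>product_rule_half_kernel\<close> and \<open>balanced_value\<close>).
\<close>

section \<open>Smooth bump functions\<close>

fun times_differentiable :: "nat \<Rightarrow> (real \<Rightarrow> real) \<Rightarrow> bool" where
  "times_differentiable 0 f = True"
| "times_differentiable (Suc k) f =
    ((\<forall>x. f field_differentiable at x) \<and> times_differentiable k (deriv f))"

lemma times_differentiable_imp_deriv:
  assumes "times_differentiable (Suc k) f"
  shows "(deriv ^^ k) f field_differentiable at x"
  using assms
proof (induction k arbitrary: f)
  case (Suc k)
  then show ?case by (simp del: funpow.simps add: funpow_Suc_right)
qed auto

lemma times_differentiable_SucD: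
  "times_differentiable (Suc k) f \<Longrightarrow> times_differentiable k f"
  by (induction k arbitrary: f) auto

lemma times_differentiable_const: "times_differentiable k (\<lambda>x. c)"
  by (induction k arbitrary: c) (auto simp: deriv_const[abs_def])

lemma times_differentiable_add:
  "times_differentiable k f \<Longrightarrow> times_differentiable k g \<Longrightarrow> times_differentiable k (\<lambda>x. f x + g x)"
proof (induction k arbitrary: f g)
  case (Suc k)
  have "deriv (\<lambda>x. f x + g x) = (\<lambda>x. deriv f x + deriv g x)"
    using Suc.prems by (auto simp: deriv_add)
  then show ?case
    using Suc by (auto intro: field_differentiable_add)
qed auto

lemma times_differentiable_mult:
  "times_differentiable k f \<Longrightarrow> times_differentiable k g \<Longrightarrow> times_differentiable k (\<lambda>x. f x * g x)"
proof (induction k arbitrary: f g)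
  case (Suc k)
  have "deriv (\<lambda>x. f x * g x) = (\<lambda>x. f x * deriv g x + deriv f x * g x)"
    using Suc.prems by (auto simp: deriv_mult)
  moreover have "times_differentiable k f" "times_differentiable k g"
    using Suc.prems times_differentiable_SucD by blast+
  ultimately show ?case
    using Suc by (auto intro!: field_differentiable_mult times_differentiable_add)
qed auto

lemma times_differentiable_affine:
  "times_differentiable k f \<Longrightarrow> times_differentiable k (\<lambda>x. f (m * x + c))"
proof (induction k arbitrary: f)
  case (Suc k)
  have D: "((\<lambda>x. f (m * x + c)) has_field_derivative deriv f (m * x + c) * m) (at x)" for x
    by (rule DERIV_chain2[where g = "\<lambda>x. m * x + c"])
      (use Suc.prems in \<open>auto intro!: derivative_eq_intros simp: DERIV_deriv_iff_field_differentiable\<close>)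
  then have "deriv (\<lambda>x. f (m * x + c)) = (\<lambda>x. deriv f (m * x + c) * m)"
    by (auto intro!: DERIV_imp_deriv)
  then show ?case
    using Suc D times_differentiable_const
    by (auto intro!: times_differentiable_mult simp: field_differentiable_def)
qed auto

text \<open>The exponent \<open>m\<close> is there because differentiation produces powers of \<open>1 / x\<close>.\<close>
definition flat_exp :: "nat \<Rightarrow> real \<Rightarrow> real"
  where "flat_exp m x = (if 0 < x then exp (- 1 / x) / x ^ m else 0)"

lemma flat_exp_has_derivative:
  "(flat_exp m has_field_derivative flat_exp (m + 2) x - real m * flat_exp (m + 1) x) (at x)"
proof -
  consider "0 < x" | "x < 0" | "x = 0" by linarith
  then show ?thesis
  proof cases
    case 1
    have "((\<lambda>x. exp (- 1 / x) / x ^ m) has_field_derivative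
            flat_exp (m + 2) x - real m * flat_exp (m + 1) x) (at x)"
    proof (cases m)
      case (Suc k)
      have "((\<lambda>x. exp (- 1 / x) / x ^ Suc k) has_field_derivative
          (exp (- 1 / x) * (1 / x\<^sup>2) * x ^ Suc k - exp (- 1 / x) * ((1 + real k) * x ^ k)) / (x ^ Suc k * x ^ Suc k)) (at x)"
        using 1 by (intro DERIV_divide DERIV_pow[of "Suc k", simplified] )
          (auto intro!: derivative_eq_intros simp: power2_eq_square simp del: power_Suc)
      also have "(exp (- 1 / x) * (1 / x\<^sup>2) * x ^ Suc k - exp (- 1 / x) * ((1 + real k) * x ^ k)) / (x ^ Suc k * x ^ Suc k)
          = flat_exp (m + 2) x - real m * flat_exp (m + 1) x"
        using 1 by (simp add: flat_exp_def Suc divide_simps power2_eq_square) (simp add: algebra_simps)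
      finally show ?thesis by (simp add: Suc)
    qed (use 1 in \<open>auto intro!: derivative_eq_intros simp: flat_exp_def power2_eq_square\<close>)
    then show ?thesis
      by (rule has_field_derivative_transform_within_open[where S = "{0<..}"])
        (use 1 in \<open>auto simp: flat_exp_def\<close>)
  next
    case 2
    have "((\<lambda>x. 0) has_field_derivative
            flat_exp (m + 2) x - real m * flat_exp (m + 1) x) (at x)"
      using 2 by (auto simp: flat_exp_def)
    then show ?thesis
      by (rule has_field_derivative_transform_within_open[where S = "{..<0}"])
        (use 2 in \<open>auto simp: flat_exp_def\<close>)
  next
    case 3
    have "((\<lambda>y::real. inverse y ^ Suc m / exp (inverse y)) \<longlongrightarrow> 0) (at_right 0)"
      by (rule filterlim_compose[OF tendsto_power_div_exp_0 filterlim_inverse_at_top_right])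
    then have "((\<lambda>y. flat_exp m y / y) \<longlongrightarrow> 0) (at_right 0)"
      by (rule Lim_transform_eventually)
        (auto simp: flat_exp_def eventually_at_filter exp_minus field_simps)
    moreover have "((\<lambda>y. flat_exp m y / y) \<longlongrightarrow> 0) (at_left 0)"
      by (rule Lim_transform_eventually[OF tendsto_const])
        (auto simp: flat_exp_def eventually_at_filter)
    ultimately have "((\<lambda>y. flat_exp m y / y) \<longlongrightarrow> 0) (at 0)"
      by (simp add: filterlim_split_at)
    then show ?thesis
      using 3 by (simp add: has_field_derivative_iff flat_exp_def)
  qed
qed

text \<open>The functions \<^const>\<open>flat_exp\<close> form a family that is closed, up to linear
combinations, under differentiation; hence they are smooth.\<close>

lemma times_differentiable_flat_exp: "times_differentiable k (flat_exp m)"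
proof (induction k arbitrary: m)
  case (Suc k)
  have "deriv (flat_exp m) = (\<lambda>x. flat_exp (m + 2) x + (- real m) * flat_exp (m + 1) x)"
    by (rule ext, rule DERIV_imp_deriv) (use flat_exp_has_derivative[of m] in simp)
  moreover have "flat_exp m field_differentiable at x" for x
    using flat_exp_has_derivative[of m x] by (auto simp: field_differentiable_def)
  ultimately show ?case
    using times_differentiable_add[OF Suc times_differentiable_mult[OF times_differentiable_const Suc]]
    by (simp only: times_differentiable.simps) blast
qed auto

text \<open>The functions \<open>exp (- 1 / (m (x - c))) exp (- 1 / (m (d - x)))\<close> on \<open>(c, d)\<close> have a fixed support
  and increase to \<open>1\<close> inside as \<open>m\<close> grows, so no cut-off functions with a plateau are required.\<close>
lemma bump_functions:
  fixes c d :: real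
  assumes "{c..d} \<subseteq> einterval a b"
  obtains \<phi> where "\<And>m. \<phi> m \<in> test_functions a b" "\<And>m x. 0 \<le> \<phi> m x" "\<And>m x. \<phi> m x \<le> 1"
    "\<And>m x. x \<notin> {c<..<d} \<Longrightarrow> \<phi> m x = 0"
    "\<And>x. (\<lambda>m. \<phi> m x) \<longlonglongrightarrow> indicator {c<..<d} x"
proof -
  define \<phi> where "\<phi> = (\<lambda>(m::nat) x. flat_exp 0 (real (Suc m) * (x - c)) * flat_exp 0 (real (Suc m) * (d - x)))"
  have \<phi>_eq: "\<phi> m = (\<lambda>x. flat_exp 0 (real (Suc m) * x + (- real (Suc m) * c)) *
       flat_exp 0 ((- real (Suc m)) * x + real (Suc m) * d))" for m
    unfolding \<phi>_def by (simp add: algebra_simps)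
  have "times_differentiable k (\<phi> m)" for k m
    unfolding \<phi>_eq by (intro times_differentiable_mult times_differentiable_affine times_differentiable_flat_exp)
  then have 1: "(deriv ^^ k) (\<phi> m) field_differentiable at x" for k m x
    using times_differentiable_imp_deriv by blast
  have 2: "\<phi> m x = 0" if "x \<notin> {c<..<d}" for m x
    using that by (auto simp: \<phi>_def flat_exp_def zero_less_mult_iff)
  have "\<phi> m \<in> test_functions a b" for m
    unfolding test_functions_def using 1 2 assms by (auto intro!: exI[of _ "{c..d}"])
  moreover have "0 \<le> flat_exp 0 x" "flat_exp 0 x \<le> 1" for x
    by (auto simp: flat_exp_def)
  then have "0 \<le> \<phi> m x" "\<phi> m x \<le> 1" for m x
    by (auto simp: \<phi>_def intro!: mult_le_one)
  moreover have "(\<lambda>m. \<phi> m x) \<longlonglongrightarrow> indicator {c<..<d} x" for x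
  proof (cases "x \<in> {c<..<d}")
    case True
    have *: "(\<lambda>m. flat_exp 0 (real (Suc m) * t)) \<longlonglongrightarrow> 1" if "t > 0" for t
    proof -
      have "(\<lambda>m. exp (- 1 / (real (Suc m) * t))) \<longlonglongrightarrow> 1"
        using that by real_asymp
      then show ?thesis
        by (rule Lim_transform_eventually) (use that in \<open>auto simp: flat_exp_def\<close>)
    qed
    show ?thesis
      unfolding \<phi>_def using tendsto_mult[OF *[of "x - c"] *[of "d - x"]] True by auto
  qed (use 2 in auto)
  ultimately show ?thesis
    using 2 that by blast
qed

lemma test_function_continuous:
  assumes "\<phi> \<in> test_functions a b"
  shows "continuous_on S \<phi>" "continuous_on S (deriv \<phi>)" "(\<phi> has_field_derivative deriv \<phi> x) (at x)"
proof -
  have "(deriv ^^ 0) \<phi> field_differentiable at x" "(deriv ^^ 1) \<phi> field_differentiable at x" for x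
    using assms unfolding test_functions_def by blast+
  then show "continuous_on S \<phi>" "continuous_on S (deriv \<phi>)" "(\<phi> has_field_derivative deriv \<phi> x) (at x)"
    by (auto intro!: continuous_at_imp_continuous_on field_differentiable_imp_continuous_at
        simp: DERIV_deriv_iff_field_differentiable)
qed

lemma compact_subset_einterval:
  assumes "a < b" "compact K" "K \<subseteq> einterval a b"
  obtains c d where "c < d" "K \<subseteq> {c<..<d}" "{c..d} \<subseteq> einterval a b"
proof (cases "K = {}")
  case True
  from lt_ex obtain x where x: "x \<in> einterval a b"
    using \<open>a < b\<close> ereal_dense2 unfolding einterval_def by blast
  then obtain e where "e > 0" "cball x e \<subseteq> einterval a b"
    using open_contains_cball open_einterval by blast
  then show ?thesis using that[of "x - e" "x + e"] True by (auto simp: cball_eq_atLeastAtMost)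
next
  case False
  obtain l where l: "l \<in> K" "\<And>x. x \<in> K \<Longrightarrow> l \<le> x" using compact_attains_inf[OF assms(2) False] by blast
  obtain r where r: "r \<in> K" "\<And>x. x \<in> K \<Longrightarrow> x \<le> r" using compact_attains_sup[OF assms(2) False] by blast
  obtain c where c: "a < ereal c" "c < l"
    using l(1) assms(3) ereal_dense2[of a "ereal l"] by (auto simp: einterval_def)
  obtain d where d: "r < d" "ereal d < b"
    using r(1) assms(3) ereal_dense2[of "ereal r" b] by (auto simp: einterval_def)
  have "{c..d} \<subseteq> einterval a b"
    using c d by (auto simp: einterval_def) (meson ereal_less_eq(3) less_le_trans le_less_trans)+
  moreover have "K \<subseteq> {c<..<d}" using l r c d by force
  moreover have "c < d" using l(2)[OF r(1)] c d by linarith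
  ultimately show ?thesis using that by blast
qed

lemma test_function_support:
  assumes "a < b" "\<phi> \<in> test_functions a b"
  obtains c d where "c < d" "{c..d} \<subseteq> einterval a b"
    "\<And>x. x \<notin> {c<..<d} \<Longrightarrow> \<phi> x = 0" "\<And>x. x \<notin> {c<..<d} \<Longrightarrow> deriv \<phi> x = 0"
proof -
  obtain K where K: "compact K" "K \<subseteq> einterval a b" "\<And>x. x \<notin> K \<Longrightarrow> \<phi> x = 0"
    using assms unfolding test_functions_def by auto
  obtain c d where cd: "c < d" "K \<subseteq> {c<..<d}" "{c..d} \<subseteq> einterval a b"
    using compact_subset_einterval[OF assms(1) K(1,2)] by blast
  have "deriv \<phi> x = 0" if "x \<notin> K" for x
  proof (rule DERIV_imp_deriv)
    have "((\<lambda>x. 0) has_field_derivative 0) (at x)" by simp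
    then show "(\<phi> has_field_derivative 0) (at x)"
      by (rule has_field_derivative_transform_within_open[where S = "- K"])
        (use K that compact_imp_closed in auto)
  qed
  then show ?thesis using that cd K by blast
qed

section \<open>Stieltjes measures on an open interval\<close>

lemma mem_einterval_between:
  assumes "x \<in> einterval a b" "z \<in> einterval a b" "x \<le> y" "y \<le> z"
  shows "y \<in> einterval a b"
  using assms unfolding einterval_def
  by (auto intro: less_le_trans[of a "ereal x"] le_less_trans[of _ "ereal z"])

text \<open>The parametrization transports Stieltjes measures from the real line to the interval. This
  takes care of monotone functions that are unbounded near an end point and hence have no
  monotone extension to the line.\<close>
lemma einterval_eq_range_strict_mono:
  assumes "a < b"
  obtains h :: "real \<Rightarrow> real"
  where "continuous_on UNIV h" "strict_mono h" "range h = einterval a b"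
proof (cases a)
  case (real a')
  show ?thesis
  proof (cases b)
    case (real b')
    with \<open>a = ereal a'\<close> assms have "a' < b'" by simp
    let ?h = "\<lambda>x::real. b' - (b' - a') / (1 + exp x)"
    have pos: "1 + exp x > 0" for x :: real using exp_gt_zero[of x] by linarith
    have "continuous_on UNIV ?h"
      using pos by (intro continuous_intros) (auto simp: less_imp_neq[THEN not_sym])
    moreover have "strict_mono ?h"
      using \<open>a' < b'\<close> pos by (auto intro!: strict_monoI divide_strict_left_mono mult_pos_pos)
    moreover have "range ?h = einterval a b"
    proof (intro subset_antisym subsetI)
      fix y assume "y \<in> einterval a b"
      then have y: "a' < y" "y < b'" using real \<open>a = ereal a'\<close> by (auto simp: einterval_def)
      have "?h (ln ((y - a') / (b' - y))) = y"
        using y by (simp add: field_simps)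
      then show "y \<in> range ?h" by (metis rangeI)
    next
      fix y assume "y \<in> range ?h"
      then obtain x where x: "y = ?h x" by blast
      have "(b' - a') / (1 + exp x) < b' - a'" "0 < (b' - a') / (1 + exp x)"
        using \<open>a' < b'\<close> pos[of x] by (auto simp: divide_less_eq)
      then show "y \<in> einterval a b"
        unfolding x using real \<open>a = ereal a'\<close> by (simp add: einterval_def)
    qed
    ultimately show ?thesis using that by blast
  next
    case PInf
    let ?h = "\<lambda>x. a' + exp x"
    have "y \<in> range ?h" if "a' < y" for y
      by (rule range_eqI[of _ _ "ln (y - a')"]) (use that in auto)
    then have "range ?h = einterval a b"
      using PInf \<open>a = ereal a'\<close> by (auto simp: einterval_def)
    moreover have "continuous_on UNIV ?h" "strict_mono ?h"
      by (auto intro!: continuous_intros strict_monoI)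
    ultimately show ?thesis using that by blast
  qed (use assms in auto)
next
  case MInf
  show ?thesis
  proof (cases b)
    case (real b')
    let ?h = "\<lambda>x. b' - exp (- x)"
    have "y \<in> range ?h" if "y < b'" for y
      by (rule range_eqI[of _ _ "- ln (b' - y)"]) (use that in auto)
    then have "range ?h = einterval a b"
      using real MInf by (auto simp: einterval_def)
    moreover have "continuous_on UNIV ?h" "strict_mono ?h"
      by (auto intro!: continuous_intros strict_monoI)
    ultimately show ?thesis using that by blast
  next
    case PInf
    then have "range (\<lambda>x. x) = einterval a b" using MInf by (auto simp: einterval_def)
    then show ?thesis using that[of "\<lambda>x. x"] by (auto simp: strict_mono_def)
  qed (use assms in auto)
qed (use assms in auto)

text \<open>The right-continuous modification of a monotone function; it has the same Stieltjes measure,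
  and it determines the mass of half-open intervals.\<close>
definition mono_right_limit :: "ereal \<Rightarrow> ereal \<Rightarrow> (real \<Rightarrow> real) \<Rightarrow> real \<Rightarrow> real"
  where "mono_right_limit a b p x = Inf (p ` (einterval a b \<inter> {x<..}))"

lemma einterval_right_point:
  assumes "x \<in> einterval a b"
  obtains y where "y \<in> einterval a b" "x < y"
proof -
  obtain y where "ereal x < ereal y" "ereal y < b"
    using assms ereal_dense2[of "ereal x" b] by (auto simp: einterval_def)
  moreover from this assms have "a < ereal y"
    by (metis einterval_iff less_trans)
  ultimately show ?thesis using that by (simp add: einterval_iff)
qed

lemma einterval_left_point:
  assumes "x \<in> einterval a b"
  obtains y where "y \<in> einterval a b" "y < x"
proof -
  obtain y where "a < ereal y" "ereal y < ereal x"
    using assms ereal_dense2[of a "ereal x"] by (auto simp: einterval_def)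
  moreover from this assms have "ereal y < b"
    by (metis einterval_iff less_trans)
  ultimately show ?thesis using that by (simp add: einterval_iff)
qed

lemma mono_right_limit:
  fixes p :: "real \<Rightarrow> real"
  assumes p: "mono_on (einterval a b) p" and x: "x \<in> einterval a b"
  shows "(p \<longlongrightarrow> mono_right_limit a b p x) (at_right x)"
    and "y \<in> einterval a b \<Longrightarrow> x < y \<Longrightarrow> mono_right_limit a b p x \<le> p y"
    and "y \<in> einterval a b \<Longrightarrow> x < y \<Longrightarrow> p x \<le> mono_right_limit a b p x"
    and "(mono_right_limit a b p \<longlongrightarrow> mono_right_limit a b p x) (at_right x)"
    and "y \<in> einterval a b \<Longrightarrow> x < y \<Longrightarrow> mono_right_limit a b p x \<le> mono_right_limit a b p y"
proof -
  let ?S = "p ` (einterval a b \<inter> {x<..})"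
  obtain z where z: "z \<in> einterval a b" "x < z" using einterval_right_point[OF x] by blast
  have bdd: "bdd_below (p ` (einterval a b \<inter> {x<..}))" if "x \<in> einterval a b" for x
    using that p by (auto intro!: bdd_belowI[of _ "p x"] dest: mono_onD)
  have low: "mono_right_limit a b p x \<le> p y" if "x \<in> einterval a b" "y \<in> einterval a b" "x < y" for x y
    unfolding mono_right_limit_def using that by (auto intro!: cInf_lower bdd)
  have ge: "p x \<le> mono_right_limit a b p x" if xE: "x \<in> einterval a b" for x
  proof -
    obtain z where z: "z \<in> einterval a b" "x < z" using einterval_right_point[OF xE] by blast
    then show ?thesis
      unfolding mono_right_limit_def using p xE by (auto intro!: cInf_greatest dest: mono_onD)
  qed
  have up: "\<exists>y\<in>einterval a b. x < y \<and> p y < u" if "mono_right_limit a b p x < u" for u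
    using that z cInf_lessD[of ?S u] unfolding mono_right_limit_def by auto
  have ev: "eventually (\<lambda>y. y \<in> einterval a b \<and> x < y \<and> y < z) (at_right x)" if "z \<in> einterval a b" "x < z" for z
    unfolding eventually_at_right[OF that(2)] using that x mem_einterval_between[OF x that(1)]
    by (auto intro!: exI[of _ z])
  show "y \<in> einterval a b \<Longrightarrow> x < y \<Longrightarrow> mono_right_limit a b p x \<le> p y"
    using low x by blast
  show "y \<in> einterval a b \<Longrightarrow> x < y \<Longrightarrow> p x \<le> mono_right_limit a b p x"
    using ge x by blast
  show le: "y \<in> einterval a b \<Longrightarrow> x < y \<Longrightarrow> mono_right_limit a b p x \<le> mono_right_limit a b p y" for y
    using low[of x y] ge[of y] x by force
  show "(p \<longlongrightarrow> mono_right_limit a b p x) (at_right x)"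
  proof (rule order_tendstoI)
    fix l assume "l < mono_right_limit a b p x"
    then show "eventually (\<lambda>y. l < p y) (at_right x)"
      using ev[OF z] by (rule_tac eventually_mono) (use low x in force)+
  next
    fix u assume "mono_right_limit a b p x < u"
    then obtain y where y: "y \<in> einterval a b" "x < y" "p y < u" using up by blast
    show "eventually (\<lambda>y. p y < u) (at_right x)"
      using ev[OF y(1,2)] by (rule eventually_mono) (use y mono_onD[OF p] in force)
  qed
  show "(mono_right_limit a b p \<longlongrightarrow> mono_right_limit a b p x) (at_right x)"
  proof (rule order_tendstoI)
    fix l assume "l < mono_right_limit a b p x"
    then show "eventually (\<lambda>y. l < mono_right_limit a b p y) (at_right x)"
      using ev[OF z] by (rule_tac eventually_mono) (use le in force)+
  next
    fix u assume "mono_right_limit a b p x < u"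
    then obtain y where y: "y \<in> einterval a b" "x < y" "p y < u" using up by blast
    show "eventually (\<lambda>y. mono_right_limit a b p y < u) (at_right x)"
      using ev[OF y(1,2)] by (rule eventually_mono) (use y low in force)
  qed
qed

lemma stieltjes_measure:
  fixes p :: "real \<Rightarrow> real"
  assumes "a < b" and p: "mono_on (einterval a b) p"
  obtains \<mu> where "sets \<mu> = sets (restrict_space borel (einterval a b))"
    "\<And>c d. c \<in> einterval a b \<Longrightarrow> d \<in> einterval a b \<Longrightarrow> c \<le> d \<Longrightarrow>
       emeasure \<mu> {c<..d} = ennreal (mono_right_limit a b p d - mono_right_limit a b p c)"
proof -
  let ?E = "einterval a b" and ?R = "mono_right_limit a b p"
  obtain h :: "real \<Rightarrow> real" where h: "continuous_on UNIV h" "strict_mono h" "range h = ?E"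
    using einterval_eq_range_strict_mono[OF \<open>a < b\<close>] by blast
  have hE: "h x \<in> ?E" for x using h(3) by blast
  define F where "F = (\<lambda>x. ?R (h x))"
  have F: "F x \<le> F y" if "x \<le> y" for x y
    using that mono_right_limit(5)[OF p hE hE] strict_monoD[OF h(2)] unfolding F_def
    by (cases "x = y") auto
  have "continuous (at_right x) F" for x
  proof -
    have "filterlim h (nhds (h x)) (at_right x)"
      using h(1) by (auto simp: continuous_on_def intro: filterlim_mono[OF _ order_refl at_le])
    then have "filterlim h (at_right (h x)) (at_right x)"
      unfolding filterlim_at by (auto simp: eventually_at_filter strict_mono_less[OF h(2)] strict_mono_eq[OF h(2)])
    then show ?thesis
      unfolding continuous_within F_def
      by (rule filterlim_compose[OF mono_right_limit(4)[OF p hE]])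
  qed
  note IM = emeasure_interval_measure_Ioc[of _ _ F, OF _ F this]
  let ?\<mu> = "distr (interval_measure F) (restrict_space borel ?E) h"
  have meas: "h \<in> measurable (interval_measure F) (restrict_space borel ?E)"
    using h(1) hE by (auto intro!: measurable_restrict_space2 borel_measurable_continuous_onI
        simp: measurable_cong_sets[OF sets_interval_measure refl])
  have "emeasure ?\<mu> {c<..d} = ennreal (?R d - ?R c)" if cd: "c \<in> ?E" "d \<in> ?E" "c \<le> d" for c d
  proof -
    obtain s t where st: "c = h s" "d = h t" using cd(1,2) h(3) by (metis imageE)
    have "s \<le> t" using st cd(3) h(2) by (simp add: strict_mono_less_eq)
    have "{c<..d} \<in> sets (restrict_space borel ?E)"
      using mem_einterval_between[OF cd(1,2)] by (subst sets_restrict_space_iff) (auto simp: subset_eq)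
    moreover have "h -` {c<..d} = {s<..t}"
      using h(2) by (auto simp: st strict_mono_less strict_mono_less_eq)
    ultimately show ?thesis
      using IM[OF \<open>s \<le> t\<close>] unfolding st by (subst emeasure_distr[OF meas]) (simp_all add: F_def)
  qed
  then show ?thesis using that[of ?\<mu>] by simp
qed

lemma sets_restrict_einterval_Ioc:
  assumes "{c..d} \<subseteq> einterval a b"
  shows "{c<..d} \<in> sets (restrict_space borel (einterval a b))"
    "{c<..<d} \<in> sets (restrict_space borel (einterval a b))"
    "{c..d} \<in> sets (restrict_space borel (einterval a b))"
  using assms by (auto simp: sets_restrict_space_iff subset_eq)

lemma measurable_restrict_einterval:
  assumes "sets \<mu> = sets (restrict_space borel (einterval a b))" "f \<in> borel_measurable borel"
  shows "f \<in> borel_measurable \<mu>"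
  using assms measurable_restrict_space1 by (auto simp: measurable_cong_sets[OF assms(1) refl])

text \<open>A monotone function has at most countably many discontinuities.\<close>
lemma mono_right_limit_AE_eq:
  assumes "mono_on (einterval a b) p"
  shows "AE x in lborel. x \<in> einterval a b \<longrightarrow> mono_right_limit a b p x = p x"
proof -
  let ?N = "{x \<in> einterval a b. \<not> isCont p x}"
  have "mono_right_limit a b p x = p x" if "x \<in> einterval a b" "x \<notin> ?N" for x
  proof -
    have "(p \<longlongrightarrow> p x) (at_right x)"
      using that by (auto simp: isCont_def intro: filterlim_mono[OF _ order_refl at_le])
    then show ?thesis
      using mono_right_limit(1)[OF assms that(1)] tendsto_unique trivial_limit_at_right_real by blast
  qed
  moreover have "?N \<in> null_sets lborel"
    using mono_on_ctble_discont_open[OF open_einterval assms] by (rule countable_imp_null_set_lborel)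
  ultimately show ?thesis
    by (intro AE_I'[of ?N]) auto
qed

lemma continuous_compact_support_bounded:
  fixes g :: "real \<Rightarrow> real"
  assumes "\<And>S. continuous_on S g" "\<And>x. x \<notin> {c<..<d} \<Longrightarrow> g x = 0"
  shows "\<exists>B. \<forall>x. \<bar>g x\<bar> \<le> B"
proof -
  have "compact (g ` {c..d})"
    using assms(1) by (intro compact_continuous_image) auto
  then obtain B where B: "\<And>x. x \<in> {c..d} \<Longrightarrow> \<bar>g x\<bar> \<le> B"
    using compact_imp_bounded[THEN bounded_iff[THEN iffD1]] by (metis image_eqI real_norm_def)
  have "\<bar>g x\<bar> \<le> max B 0" for x
    using assms(2)[of x] B[of x] by (cases "x \<in> {c<..<d}") auto
  then show ?thesis by blast
qed

text \<open>Fubini's theorem for \<open>\<phi>'\<close> on the region \<open>{(x, y). c < x \<le> y \<le> d}\<close>, where the support of \<open>\<phi>\<close>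
  lies between \<open>c\<close> and \<open>d\<close>.\<close>

lemma stieltjes_integration_by_parts:
  assumes "a < b" and p: "mono_on (einterval a b) p"
    and sets_\<mu>: "sets \<mu> = sets (restrict_space borel (einterval a b))"
    and em: "\<And>c d. c \<in> einterval a b \<Longrightarrow> d \<in> einterval a b \<Longrightarrow> c \<le> d \<Longrightarrow>
       emeasure \<mu> {c<..d} = ennreal (mono_right_limit a b p d - mono_right_limit a b p c)"
    and \<phi>: "\<phi> \<in> test_functions a b"
  shows "integrable \<mu> \<phi>"
    and "set_integrable lborel (einterval a b) (\<lambda>x. deriv \<phi> x * p x)"
    and "(LINT x|\<mu>. \<phi> x) = - (LINT x:einterval a b|lborel. deriv \<phi> x * p x)"
proof -
  let ?R = "mono_right_limit a b p" and ?E = "einterval a b"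
  obtain c d where cd: "c < d" "{c..d} \<subseteq> ?E"
    "\<And>x. x \<notin> {c<..<d} \<Longrightarrow> \<phi> x = 0" "\<And>x. x \<notin> {c<..<d} \<Longrightarrow> deriv \<phi> x = 0"
    using test_function_support[OF \<open>a < b\<close> \<phi>] by metis
  have E[simp]: "c \<in> ?E" "d \<in> ?E" using cd by auto
  have R: "?R x \<le> ?R y" if "x \<in> ?E" "y \<in> ?E" "x \<le> y" for x y
    using mono_right_limit(5)[OF p that(1,2)] that(3) by (cases "x = y") auto
  note [measurable] = sets_restrict_einterval_Ioc[OF cd(2), folded sets_\<mu>]
  have \<phi>_borel[measurable]: "\<phi> \<in> borel_measurable borel" "deriv \<phi> \<in> borel_measurable borel"
    using test_function_continuous(1,2)[OF \<phi>, of UNIV] test_function_continuous(3)[OF \<phi>] by (auto intro: borel_measurable_continuous_onI)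
  have \<phi>_\<mu>[measurable]: "\<phi> \<in> borel_measurable \<mu>"
    using measurable_restrict_einterval[OF sets_\<mu> \<phi>_borel(1)] .
  define \<nu> where "\<nu> = distr (restrict_space \<mu> {c<..d}) borel (\<lambda>x. x)"
  have space_\<mu>: "space \<mu> = ?E"
    using sets_eq_imp_space_eq[OF sets_\<mu>] by (simp add: space_restrict_space)
  have id_meas: "(\<lambda>x. x) \<in> measurable (restrict_space \<mu> {c<..d}) borel"
    by (intro measurable_restrict_space1 measurable_restrict_einterval[OF sets_\<mu>]) auto
  have em_\<nu>: "emeasure \<nu> A = emeasure \<mu> ({c<..d} \<inter> A)" if "A \<in> sets borel" for A
  proof -
    have eq: "(\<lambda>x. x) -` A \<inter> space (restrict_space \<mu> {c<..d}) = {c<..d} \<inter> A"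
      using cd(2) by (auto simp: space_restrict_space space_\<mu>)
    have "{c<..d} \<inter> space \<mu> \<in> sets \<mu>"
      by measurable
    then show ?thesis
      unfolding \<nu>_def emeasure_distr[OF id_meas that] eq
      by (intro emeasure_restrict_space) auto
  qed
  have sets_\<nu>[measurable_cong]: "sets \<nu> = sets borel" by (simp add: \<nu>_def)
  interpret \<nu>: finite_measure \<nu>
    by (rule finite_measureI) (use cd(1) in \<open>simp add: \<nu>_def em_\<nu>[unfolded \<nu>_def] em\<close>)
  define L where "L = density lborel (\<lambda>x. ennreal (indicator {c..d} x))"
  have sets_L[measurable_cong]: "sets L = sets borel" by (simp add: L_def)
  interpret L: finite_measure L
    by (rule finite_measureI) (use cd(1) in \<open>simp add: L_def emeasure_density ennreal_indicator\<close>)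
  interpret P: finite_measure "\<nu> \<Otimes>\<^sub>M L"
    by (rule finite_measure_pair_measure) unfold_locales
  interpret pair_sigma_finite \<nu> L ..
  obtain B where B: "\<bar>deriv \<phi> x\<bar> \<le> B" for x
    using continuous_compact_support_bounded[of "deriv \<phi>" c d] test_function_continuous(2)[OF \<phi>] cd(4) by blast
  obtain C where C: "\<bar>\<phi> x\<bar> \<le> C" for x
    using continuous_compact_support_bounded[of \<phi> c d] test_function_continuous(1)[OF \<phi>] cd(3) by blast
  show "integrable \<mu> \<phi>"
    by (rule integrableI_bounded_set[of "{c<..d}" _ _ C]) (use C cd in \<open>auto simp: em\<close>)
  have p_meas[measurable]: "(\<lambda>y. indicat_real ?E y *\<^sub>R p y) \<in> borel_measurable borel"
    using borel_measurable_mono_on_fnc[OF p] by (subst (asm) borel_measurable_restrict_space_iff) auto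
  have \<phi>p_meas: "(\<lambda>y. indicat_real ?E y *\<^sub>R (deriv \<phi> y * p y)) \<in> borel_measurable lborel"
  proof -
    have "(\<lambda>y. deriv \<phi> y * (indicat_real ?E y *\<^sub>R p y)) \<in> borel_measurable lborel"
      by measurable
    then show ?thesis by (simp add: mult_ac)
  qed
  have "\<bar>p x\<bar> \<le> \<bar>p c\<bar> + \<bar>p d\<bar>" if "x \<in> {c..d}" for x
    using mono_onD[OF p, of c x] mono_onD[OF p, of x d] that cd(2) by auto
  then have bd: "\<bar>deriv \<phi> x * p x\<bar> \<le> B * (\<bar>p c\<bar> + \<bar>p d\<bar>)" if "x \<in> {c..d}" for x
    using B[of x] that unfolding abs_mult by (intro mult_mono) auto
  have \<phi>p_int: "integrable lborel (\<lambda>x. indicator ?E x *\<^sub>R (deriv \<phi> x * p x))"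
    by (rule integrableI_bounded_set[of "{c..d}" _ _ "B * (\<bar>p c\<bar> + \<bar>p d\<bar>)"])
      (use bd cd \<phi>p_meas order_trans[OF abs_ge_zero bd] in \<open>auto simp: indicator_def\<close>)
  then show "set_integrable lborel ?E (\<lambda>x. deriv \<phi> x * p x)"
    by (simp add: set_integrable_def)
  have \<phi>'_int: "integrable lborel (\<lambda>y. deriv \<phi> y * indicator {c..d} y)"
    by (rule integrableI_bounded_set[of "{c..d}" _ _ B])
      (use B cd(1) in \<open>auto simp: indicator_def\<close>)
  \<comment> \<open>Integrating in \<open>y\<close> gives \<open>- \<phi>\<close>, integrating in \<open>x\<close> gives \<open>\<phi>'\<close> times the increment of the
     right-continuous modification over \<open>(c, y]\<close>.\<close>
  define k where "k = (\<lambda>x y. if x \<le> y then deriv \<phi> y else 0)"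
  have k_meas: "(\<lambda>(x, y). k x y) \<in> borel_measurable (\<nu> \<Otimes>\<^sub>M L)"
    unfolding k_def by measurable
  have k_int: "integrable (\<nu> \<Otimes>\<^sub>M L) (\<lambda>(x, y). k x y)"
    by (rule P.integrable_const_bound[where B = "max B 0"]) (use B k_meas in \<open>auto intro!: AE_I2 simp: k_def le_max_iff_disj\<close>)
  have inner1: "(\<integral>y. k x y \<partial>L) = - \<phi> x" if "x \<in> {c<..d}" for x
  proof -
    have "(\<integral>y. k x y \<partial>L) = (\<integral>y. indicator {c..d} y *\<^sub>R k x y \<partial>lborel)"
      unfolding L_def k_def by (rule integral_density) (auto simp: )
    also have "\<dots> = (\<integral>y. deriv \<phi> y * indicator {x..d} y \<partial>lborel)"
      using that by (intro Bochner_Integration.integral_cong) (auto simp: k_def indicator_def)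
    also have "\<dots> = \<phi> d - \<phi> x"
      using that test_function_continuous(1,2)[OF \<phi>, of UNIV] test_function_continuous(3)[OF \<phi>]
      by (intro integral_FTC_Icc_real) (auto simp: continuous_on_eq_continuous_at)
    finally show ?thesis using cd(3)[of d] by simp
  qed
  have int_\<nu>: "(\<integral>x. f x \<partial>\<nu>) = (\<integral>x. indicator {c<..d} x *\<^sub>R f x \<partial>\<mu>)"
    if "f \<in> borel_measurable borel" for f :: "real \<Rightarrow> real"
    unfolding \<nu>_def using that
    by (subst integral_distr[OF id_meas]) (auto simp: integral_restrict_space)
  have AE_\<nu>: "AE x in \<nu>. x \<in> {c<..d}"
    by (rule AE_I[of _ _ "- {c<..d}"]) (auto simp: em_\<nu> sets_\<nu>)
  have "indicator {c<..d} x *\<^sub>R \<phi> x = \<phi> x" for x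
    using cd(3)[of x] by (cases "x \<in> {c<..<d}") auto
  then have "(\<integral>x. \<phi> x \<partial>\<mu>) = (\<integral>x. indicator {c<..d} x *\<^sub>R \<phi> x \<partial>\<mu>)"
    by (simp only:)
  also have "\<dots> = (\<integral>x. \<phi> x \<partial>\<nu>)" by (simp add: int_\<nu>)
  also have "\<dots> = (\<integral>x. - (\<integral>y. k x y \<partial>L) \<partial>\<nu>)"
  proof (rule integral_cong_AE)
    show "AE x in \<nu>. \<phi> x = - (\<integral>y. k x y \<partial>L)"
      using AE_\<nu> by (rule eventually_mono) (simp add: inner1)
    show "(\<lambda>x. - (\<integral>y. k x y \<partial>L)) \<in> borel_measurable \<nu>"
      using k_meas by measurable
  qed measurable
  also have "\<dots> = - (\<integral>y. (\<integral>x. k x y \<partial>\<nu>) \<partial>L)"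
    using Fubini_integral[OF k_int] by simp
  also have "(\<integral>y. (\<integral>x. k x y \<partial>\<nu>) \<partial>L) = (\<integral>y. indicator {c..d} y *\<^sub>R (\<integral>x. k x y \<partial>\<nu>) \<partial>lborel)"
    unfolding L_def k_def by (rule integral_density) auto
  also have "\<dots> = (\<integral>y. indicator ?E y *\<^sub>R (deriv \<phi> y * p y) - ?R c *\<^sub>R (deriv \<phi> y * indicator {c..d} y) \<partial>lborel)"
  proof (rule integral_cong_AE)
    show "(\<lambda>y. indicat_real ?E y *\<^sub>R (deriv \<phi> y * p y) - ?R c *\<^sub>R (deriv \<phi> y * indicat_real {c..d} y)) \<in> borel_measurable lborel"
      using \<phi>p_meas by measurable
    show "AE y in lborel. indicat_real {c..d} y *\<^sub>R (\<integral>x. k x y \<partial>\<nu>) =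
        indicat_real ?E y *\<^sub>R (deriv \<phi> y * p y) - ?R c *\<^sub>R (deriv \<phi> y * indicat_real {c..d} y)"
      using mono_right_limit_AE_eq[OF p]
    proof (rule eventually_mono)
      fix y assume R_eq: "y \<in> ?E \<longrightarrow> ?R y = p y"
      show "indicat_real {c..d} y *\<^sub>R (\<integral>x. k x y \<partial>\<nu>) =
        indicat_real ?E y *\<^sub>R (deriv \<phi> y * p y) - ?R c *\<^sub>R (deriv \<phi> y * indicat_real {c..d} y)"
      proof (cases "y \<in> {c..d}")
        case True
        then have y: "y \<in> ?E" "{c<..d} \<inter> {..y} = {c<..y}" using cd by auto
        have "(\<integral>x. k x y \<partial>\<nu>) = (\<integral>x. deriv \<phi> y * indicator {..y} x \<partial>\<nu>)"
          by (intro Bochner_Integration.integral_cong) (auto simp: k_def indicator_def)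
        also have "\<dots> = deriv \<phi> y * measure \<nu> {..y}"
          by (simp add: sets_\<nu>)
        also have "measure \<nu> {..y} = ?R y - ?R c"
          using em_\<nu>[of "{..y}"] y em[of c y] True R[of c y] by (auto simp: measure_def)
        finally show ?thesis using True y R_eq by (simp add: algebra_simps)
      qed (use cd(4)[of y] in auto)
    qed
  qed (auto simp: k_def)
  also have "\<dots> = (\<integral>y. indicator ?E y *\<^sub>R (deriv \<phi> y * p y) \<partial>lborel) - ?R c *\<^sub>R (\<integral>y. deriv \<phi> y * indicator {c..d} y \<partial>lborel)"
    using \<phi>p_int \<phi>'_int by (subst Bochner_Integration.integral_diff) auto
  \<comment> \<open>The value at \<open>c\<close>, subtracted in the increment, contributes nothing.\<close>
  also have "(\<integral>y. deriv \<phi> y * indicator {c..d} y \<partial>lborel) = 0"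
    using cd(1) cd(3)[of c] cd(3)[of d] test_function_continuous(1,2)[OF \<phi>, of UNIV] test_function_continuous(3)[OF \<phi>]
    by (subst integral_FTC_Icc_real[where F = \<phi>]) (auto simp: continuous_on_eq_continuous_at)
  finally show "(LINT x|\<mu>. \<phi> x) = - (LINT x:?E|lborel. deriv \<phi> x * p x)"
    by (simp add: set_lebesgue_integral_def)
qed

section \<open>Measures of functions of bounded variation\<close>

text \<open>The sum of the measures dominates each of them, so Radon-Nikodym densities exist. They
  reduce equations between several measures to pointwise ones.\<close>
lemma common_density:
  fixes \<nu> :: "'i \<Rightarrow> 'a measure"
  assumes S: "finite S"
    and sets_\<nu>: "\<And>s. s \<in> S \<Longrightarrow> sets (\<nu> s) = sets M"
    and A: "range A \<subseteq> sets M" "(\<Union>i. A i) = space M" "\<And>s i. s \<in> S \<Longrightarrow> emeasure (\<nu> s) (A (i::nat)) < \<infinity>"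
  obtains \<mu> g where "sets \<mu> = sets M"
    "\<And>X. X \<in> sets M \<Longrightarrow> emeasure \<mu> X = (\<Sum>s\<in>S. emeasure (\<nu> s) X)"
    "\<And>s. s \<in> S \<Longrightarrow> g s \<in> borel_measurable \<mu>" "\<And>s x. 0 \<le> (g s x :: real)"
    "\<And>s. s \<in> S \<Longrightarrow> \<nu> s = density \<mu> (\<lambda>x. ennreal (g s x))"
proof -
  define \<mu> where "\<mu> = measure_of (space M) (sets M) (\<lambda>X. \<Sum>s\<in>S. emeasure (\<nu> s) X)"
  have sets_\<mu>: "sets \<mu> = sets M"
    unfolding \<mu>_def by (simp add: sets.space_closed)
  then have space_\<mu>: "space \<mu> = space M" by (rule sets_eq_imp_space_eq)
  have em: "emeasure \<mu> X = (\<Sum>s\<in>S. emeasure (\<nu> s) X)" if "X \<in> sets M" for X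
  proof (rule emeasure_measure_of[OF \<mu>_def])
    show "countably_additive (sets \<mu>) (\<lambda>X. \<Sum>s\<in>S. emeasure (\<nu> s) X)"
    proof (rule countably_additiveI)
      fix B :: "nat \<Rightarrow> 'a set"
      assume B: "range B \<subseteq> sets \<mu>" "disjoint_family B" "\<Union>(range B) \<in> sets \<mu>"
      have "(\<Sum>i. \<Sum>s\<in>S. emeasure (\<nu> s) (B i)) = (\<Sum>s\<in>S. \<Sum>i. emeasure (\<nu> s) (B i))"
        by (rule suminf_sum) simp
      also have "\<dots> = (\<Sum>s\<in>S. emeasure (\<nu> s) (\<Union>(range B)))"
        using B sets_\<mu> sets_\<nu> by (intro sum.cong suminf_emeasure) auto
      finally show "(\<Sum>i. \<Sum>s\<in>S. emeasure (\<nu> s) (B i)) = (\<Sum>s\<in>S. emeasure (\<nu> s) (\<Union>(range B)))" .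
    qed
  qed (use that sets_\<mu> in \<open>auto simp: positive_def sets.space_closed dest: sets.sets_into_space\<close>)
  have \<mu>_fin: "emeasure \<mu> (A i) \<noteq> \<infinity>" for i
    using A S by (auto simp: em image_subset_iff less_top)
  interpret sigma_finite_measure \<mu>
    by standard (rule exI[of _ "range A"], use A \<mu>_fin sets_\<mu> space_\<mu> in auto)
  have "\<exists>g. g \<in> borel_measurable \<mu> \<and> (\<forall>x. 0 \<le> (g x :: real)) \<and> \<nu> s = density \<mu> (\<lambda>x. ennreal (g x))"
    if "s \<in> S" for s
  proof -
    have ac: "absolutely_continuous \<mu> (\<nu> s)"
      unfolding absolutely_continuous_def
      using that S sets_\<mu> sets_\<nu> by (auto simp: null_sets_def em)
    have sets_eq: "sets (\<nu> s) = sets \<mu>" using that sets_\<nu> sets_\<mu> by simp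
    have "sigma_finite_measure (\<nu> s)"
      by standard (rule exI[of _ "range A"],
        use A that sets_\<nu>[OF that] sets_eq_imp_space_eq[OF sets_\<nu>[OF that]] in \<open>auto simp: less_top[symmetric]\<close>)
    from RN_deriv_finite[OF this ac sets_eq]
    have "density \<mu> (RN_deriv \<mu> (\<nu> s)) = density \<mu> (\<lambda>x. ennreal (enn2real (RN_deriv \<mu> (\<nu> s) x)))"
      by (intro density_cong) (auto elim!: eventually_mono simp: less_top)
    then show ?thesis
      using density_RN_deriv[OF ac sets_eq]
      by (intro exI[of _ "\<lambda>x. enn2real (RN_deriv \<mu> (\<nu> s) x)"]) auto
  qed
  then obtain g where g: "\<And>s. s \<in> S \<Longrightarrow> g s \<in> borel_measurable \<mu> \<and> (\<forall>x. 0 \<le> (g s x :: real)) \<and>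
      \<nu> s = density \<mu> (\<lambda>x. ennreal (g s x))"
    using bchoice[of S] by meson
  show ?thesis
  proof (rule that[OF sets_\<mu> em])
    show "(\<lambda>x. if s \<in> S then g s x else 0) \<in> borel_measurable \<mu>" if "s \<in> S" for s
      using g[OF that] that by simp
    show "0 \<le> (if s \<in> S then g s x else 0)" for s x
      using g by simp
    show "\<nu> s = density \<mu> (\<lambda>x. ennreal (if s \<in> S then g s x else 0))" if "s \<in> S" for s
      using g[OF that] that by simp
  qed
qed

lemma einterval_exhaustion:
  assumes "a < b"
  obtains c d :: "nat \<Rightarrow> real" where "\<And>i. c i < d i" "\<And>i. {c i..d i} \<subseteq> einterval a b"
    "decseq c" "incseq d" "(\<Union>i. {c i<..d i}) = einterval a b"
proof -
  obtain u l :: "nat \<Rightarrow> real" where lu: "einterval a b = (\<Union>i. {l i..u i})" "incseq u" "decseq l"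
    "\<And>i. l i < u i" "\<And>i. a < l i" "\<And>i. u i < b" "l \<longlonglongrightarrow> a" "u \<longlonglongrightarrow> b"
    by (rule einterval_Icc_approximation[OF assms], rule that) assumption+
  have "x \<in> (\<Union>i. {l i<..u i})" if xE: "x \<in> einterval a b" for x
  proof -
    obtain y where y: "y \<in> einterval a b" "y < x" using einterval_left_point[OF xE] by blast
    obtain i j where "x \<in> {l i..u i}" "y \<in> {l j..u j}" using xE y(1) lu(1) by blast
    then have "x \<in> {l (max i j)<..u (max i j)}"
      using incseqD[OF lu(2), of i "max i j"] decseqD[OF lu(3), of j "max i j"] y(2) by auto
    then show ?thesis by blast
  qed
  moreover have "{l i<..u i} \<subseteq> {l i..u i}" for i by auto
  ultimately have "(\<Union>i. {l i<..u i}) = einterval a b" using lu(1) by blast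
  then show ?thesis using that lu by blast
qed

definition variation :: "(real \<Rightarrow> 'v::real_normed_vector) \<Rightarrow> real \<Rightarrow> real \<Rightarrow> real" where
  "variation f c d = Sup {\<Sum>i<m. norm (f (t (Suc i)) - f (t i)) | (m::nat) t.
     (\<forall>i\<le>m. t i \<in> {c..d}) \<and> (\<forall>i<m. t i \<le> t (Suc i))}"

lemma sum_le_variation:
  assumes "bounded_variation_on {c..d} f" "\<And>i. i \<le> m \<Longrightarrow> t i \<in> {c..d}" "\<And>i. i < m \<Longrightarrow> t i \<le> t (Suc i)"
  shows "(\<Sum>i<m. norm (f (t (Suc i)) - f (t i))) \<le> variation f c d"
  unfolding variation_def
proof (rule cSup_upper)
  from assms(1)[unfolded bounded_variation_on_def]
  obtain B where B: "\<forall>(m::nat) t. (\<forall>i\<le>m. t i \<in> {c..d}) \<and> (\<forall>i<m. t i \<le> t (Suc i)) \<longrightarrow>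
       (\<Sum>i<m. norm (f (t (Suc i)) - f (t i))) \<le> B"
    ..
  show "bdd_above {\<Sum>i<m. norm (f (t (Suc i)) - f (t i)) | (m::nat) t.
     (\<forall>i\<le>m. t i \<in> {c..d}) \<and> (\<forall>i<m. t i \<le> t (Suc i))}"
  proof (rule bdd_aboveI[of _ B], clarify)
    fix m :: nat and t assume "\<forall>i\<le>m. t i \<in> {c..d}" "\<forall>i<m. t i \<le> t (Suc i)"
    then show "(\<Sum>i<m. norm (f (t (Suc i)) - f (t i))) \<le> B" using B[rule_format, of m t] by blast
  qed
  show "(\<Sum>i<m. norm (f (t (Suc i)) - f (t i))) \<in> {\<Sum>i<m. norm (f (t (Suc i)) - f (t i)) | (m::nat) t.
     (\<forall>i\<le>m. t i \<in> {c..d}) \<and> (\<forall>i<m. t i \<le> t (Suc i))}"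
    by (intro CollectI exI[of _ m] exI[of _ t] conjI refl allI impI) (fact assms(2,3))+
qed

lemma variation_leI:
  assumes "c \<le> d"
    and "\<And>(m::nat) t. (\<And>i. i \<le> m \<Longrightarrow> t i \<in> {c..d}) \<Longrightarrow> (\<And>i. i < m \<Longrightarrow> t i \<le> t (Suc i)) \<Longrightarrow>
       (\<Sum>i<m. norm (f (t (Suc i)) - f (t i))) \<le> B"
  shows "variation f c d \<le> B"
  unfolding variation_def
proof (rule cSup_least)
  show "{\<Sum>i<m. norm (f (t (Suc i)) - f (t i)) | (m::nat) t.
     (\<forall>i\<le>m. t i \<in> {c..d}) \<and> (\<forall>i<m. t i \<le> t (Suc i))} \<noteq> {}"
    using \<open>c \<le> d\<close> by (auto intro!: exI[of _ 0] exI[of _ "\<lambda>_. c"])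
next
  fix x assume "x \<in> {\<Sum>i<m. norm (f (t (Suc i)) - f (t i)) | (m::nat) t.
     (\<forall>i\<le>m. t i \<in> {c..d}) \<and> (\<forall>i<m. t i \<le> t (Suc i))}"
  then obtain m :: nat and t where "x = (\<Sum>i<m. norm (f (t (Suc i)) - f (t i)))"
    "\<forall>i\<le>m. t i \<in> {c..d}" "\<forall>i<m. t i \<le> t (Suc i)"
    by (elim CollectE exE conjE)
  then show "x \<le> B" using assms(2)[of m t] by simp
qed

text \<open>A partition of \<open>[c, e]\<close> is extended by the two nodes \<open>e\<close> and \<open>d\<close>; the first is needed
  because the partition need not reach \<open>e\<close>.\<close>
lemma variation_snoc:
  assumes "bounded_variation_on {c..d} f" "c \<le> e" "e \<le> d"
  shows "variation f c e + norm (f d - f e) \<le> variation f c d"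
proof -
  have "variation f c e \<le> variation f c d - norm (f d - f e)"
  proof (rule variation_leI[OF assms(2)])
    fix m :: nat and t
    assume t: "\<And>i. i \<le> m \<Longrightarrow> t i \<in> {c..e}" "\<And>i. i < m \<Longrightarrow> t i \<le> t (Suc i)"
    define s where "s = (\<lambda>i. if i \<le> m then t i else if i = Suc m then e else d)"
    have "(\<Sum>i<m. norm (f (t (Suc i)) - f (t i))) + norm (f d - f e)
        \<le> (\<Sum>i<m. norm (f (s (Suc i)) - f (s i))) + norm (f e - f (t m)) + norm (f d - f e)"
      by (auto simp: s_def intro!: sum_mono)
    also have "\<dots> = (\<Sum>i<Suc (Suc m). norm (f (s (Suc i)) - f (s i)))"
      by (simp add: s_def)
    also have "\<dots> \<le> variation f c d"
    proof (rule sum_le_variation[OF assms(1)])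
      show "s i \<in> {c..d}" for i
        using t(1)[of i] assms by (auto simp: s_def)
      show "s i \<le> s (Suc i)" for i
        using t(1)[of m] t(2)[of i] assms by (cases "i = m") (auto simp: s_def)
    qed
    finally show "(\<Sum>i<m. norm (f (t (Suc i)) - f (t i))) \<le> variation f c d - norm (f d - f e)" by simp
  qed
  then show ?thesis by simp
qed

lemma variation_Cons:
  assumes "bounded_variation_on {c..d} f" "c \<le> e" "e \<le> d"
  shows "norm (f e - f c) + variation f e d \<le> variation f c d"
proof -
  have "variation f e d \<le> variation f c d - norm (f e - f c)"
  proof (rule variation_leI[OF assms(3)])
    fix m :: nat and t
    assume t: "\<And>i. i \<le> m \<Longrightarrow> t i \<in> {e..d}" "\<And>i. i < m \<Longrightarrow> t i \<le> t (Suc i)"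
    define s where "s = (\<lambda>i. case i of 0 \<Rightarrow> c | Suc 0 \<Rightarrow> e | Suc (Suc j) \<Rightarrow> t j)"
    have "norm (f e - f c) + (\<Sum>i<m. norm (f (t (Suc i)) - f (t i)))
        \<le> norm (f e - f c) + (norm (f (t 0) - f e) + (\<Sum>i<m. norm (f (t (Suc i)) - f (t i))))"
      by simp
    also have "\<dots> = (\<Sum>i<Suc (Suc m). norm (f (s (Suc i)) - f (s i)))"
      by (simp add: s_def sum.lessThan_Suc_shift del: sum.lessThan_Suc)
    also have "\<dots> \<le> variation f c d"
    proof (rule sum_le_variation[OF assms(1)])
      show "s i \<in> {c..d}" if "i \<le> Suc (Suc m)" for i
        using t(1)[of "i - 2"] that assms by (auto simp: s_def split: nat.split)
      show "s i \<le> s (Suc i)" if "i < Suc (Suc m)" for i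
        using t(1)[of 0] t(2)[of "i - 2"] that assms by (auto simp: s_def split: nat.split)
    qed
    finally show "(\<Sum>i<m. norm (f (t (Suc i)) - f (t i))) \<le> variation f c d - norm (f e - f c)" by simp
  qed
  then show ?thesis by simp
qed

lemma variation_nonneg:
  assumes "bounded_variation_on {c..d} f" "c \<le> d"
  shows "0 \<le> variation f c d"
  using sum_le_variation[OF assms(1), of 0 "\<lambda>_. c"] assms by simp

text \<open>The dominating function is the variation over the interval from a base point to \<open>x\<close>, with a
  minus sign to the left of the base point.\<close>
lemma variation_dominates:
  fixes f :: "real \<Rightarrow> 'v::real_normed_vector"
  assumes "a < b" "locally_bv a b f"
  obtains V where "\<And>x y. x \<in> einterval a b \<Longrightarrow> y \<in> einterval a b \<Longrightarrow> x \<le> y \<Longrightarrow> norm (f y - f x) \<le> V y - V x"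
proof -
  obtain z where z: "z \<in> einterval a b"
    using \<open>a < b\<close> ereal_dense2 unfolding einterval_def by blast
  have bv: "bounded_variation_on {x..y} f" if "x \<in> einterval a b" "y \<in> einterval a b" for x y
  proof -
    have "{x..y} \<subseteq> einterval a b" using mem_einterval_between[OF that] by auto
    then show ?thesis using assms(2) unfolding locally_bv_def by blast
  qed
  define V where "V = (\<lambda>x. if z \<le> x then variation f z x else - variation f x z)"
  have "norm (f y - f x) \<le> V y - V x" if "x \<in> einterval a b" "y \<in> einterval a b" "x \<le> y" for x y
  proof -
    consider "z \<le> x" | "y < z" | "x < z" "z \<le> y" by linarith
    then show ?thesis
    proof cases
      case 1
      then show ?thesis using variation_snoc[OF bv[OF z that(2)], of x] that by (simp add: V_def)
    next
      case 2
      then show ?thesis using variation_Cons[OF bv[OF that(1) z], of y] that by (simp add: V_def)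
    next
      case 3
      have "norm (f z - f x) \<le> variation f x z"
        using variation_Cons[OF bv[OF that(1) z], of z] variation_nonneg[OF bv[OF z z]] 3 by simp
      moreover have "norm (f y - f z) \<le> variation f z y"
        using variation_snoc[OF bv[OF z that(2)], of z] variation_nonneg[OF bv[OF z z]] 3 by simp
      moreover have "norm (f y - f x) \<le> norm (f y - f z) + norm (f z - f x)"
        using norm_triangle_ineq[of "f y - f z" "f z - f x"] by simp
      ultimately show ?thesis using 3 by (simp add: V_def)
    qed
  qed
  then show ?thesis using that by blast
qed

lemma has_integral_Basis_sum:
  fixes f :: "'v::euclidean_space \<Rightarrow> 'a \<Rightarrow> real"
  assumes "\<And>b. b \<in> Basis \<Longrightarrow> integrable M (f b)"
  shows "integrable M (\<lambda>x. \<Sum>b\<in>Basis. f b x *\<^sub>R b)"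
    and "(\<integral>x. (\<Sum>b\<in>Basis. f b x *\<^sub>R b) \<partial>M) = (\<Sum>b\<in>Basis. (\<integral>x. f b x \<partial>M) *\<^sub>R b)"
  using assms by (auto simp: Bochner_Integration.integral_sum)

lemma set_integrable_density_real:
  assumes "g \<in> borel_measurable \<mu>" "\<And>x. 0 \<le> (g x :: real)" "A \<in> sets \<mu>"
    "\<nu> = density \<mu> (\<lambda>x. ennreal (g x))" "emeasure \<nu> A < \<infinity>"
  shows "set_integrable \<mu> A g" "(LINT x:A|\<mu>. g x) = measure \<nu> A"
proof -
  have "(\<integral>\<^sup>+x. ennreal (indicator A x *\<^sub>R g x) \<partial>\<mu>) = emeasure \<nu> A"
    unfolding assms(4) using assms(1-3)
    by (subst emeasure_density) (auto intro!: nn_integral_cong simp: indicator_def)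
  then show "set_integrable \<mu> A g" "(LINT x:A|\<mu>. g x) = measure \<nu> A"
    unfolding set_integrable_def set_lebesgue_integral_def measure_def using assms
    by (auto intro!: integrableI_nonneg simp: integral_eq_nn_integral)
qed

text \<open>With \<open>V\<close> dominating the increments of \<open>U\<close>, the functions \<open>V\<close> and \<open>V + U \<bullet> i\<close> are monotone for
  every basis vector \<open>i\<close>. The components of \<open>U\<close> are differences of these, and \<open>H\<close> collects the
  differences of the densities of their Stieltjes measures with respect to a common measure.
  The function \<open>R\<close> consists of the right limits of \<open>U\<close>.\<close>
lemma bv_representation:
  fixes U :: "real \<Rightarrow> 'v::euclidean_space"
  assumes "a < b" "locally_bv a b U"
  obtains \<mu> H R where "sets \<mu> = sets (restrict_space borel (einterval a b))"
    "H \<in> borel_measurable \<mu>"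
    "U \<in> borel_measurable (restrict_space borel (einterval a b))"
    "\<And>c d. {c..d} \<subseteq> einterval a b \<Longrightarrow> emeasure \<mu> {c<..d} < \<infinity>"
    "\<And>c d. {c..d} \<subseteq> einterval a b \<Longrightarrow> set_integrable \<mu> {c<..d} H"
    "\<And>c d. {c..d} \<subseteq> einterval a b \<Longrightarrow> c \<le> d \<Longrightarrow> (LINT x:{c<..d}|\<mu>. H x) = R d - R c"
    "\<And>x. x \<in> einterval a b \<Longrightarrow> (U \<longlongrightarrow> R x) (at_right x)"
    "\<And>\<phi>. \<phi> \<in> test_functions a b \<Longrightarrow> set_integrable lborel (einterval a b) (\<lambda>x. deriv \<phi> x *\<^sub>R U x)"
    "\<And>\<phi>. \<phi> \<in> test_functions a b \<Longrightarrow> dist_deriv a b U \<phi> = (LINT x|\<mu>. \<phi> x *\<^sub>R H x)"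
proof -
  let ?E = "einterval a b" and ?B = "restrict_space borel (einterval a b)"
  obtain V where V: "\<And>x y. x \<in> ?E \<Longrightarrow> y \<in> ?E \<Longrightarrow> x \<le> y \<Longrightarrow> norm (U y - U x) \<le> V y - V x"
    using variation_dominates[OF assms] by blast
  define P where "P = (\<lambda>s x. case s of None \<Rightarrow> V x | Some i \<Rightarrow> V x + U x \<bullet> i)"
  define S where "S = insert None (Some ` (Basis :: 'v set))"
  have S[simp]: "finite S" "None \<in> S" "\<And>i. i \<in> Basis \<Longrightarrow> Some i \<in> S" by (auto simp: S_def)
  have P_mono: "mono_on ?E (P s)" if "s \<in> S" for s
  proof (rule mono_onI)
    fix x y assume xy: "x \<in> ?E" "y \<in> ?E" "x \<le> y"
    note V_xy = V[OF xy]
    show "P s x \<le> P s y"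
    proof (cases s)
      case None
      then show ?thesis using order_trans[OF norm_ge_zero V_xy] by (simp add: P_def)
    next
      case (Some i)
      then have "\<bar>(U y - U x) \<bullet> i\<bar> \<le> norm (U y - U x)" using that Basis_le_norm by (auto simp: S_def)
      then show ?thesis using V_xy Some by (simp add: P_def inner_diff_left)
    qed
  qed
  have "\<exists>\<nu>. sets \<nu> = sets ?B \<and> (\<forall>c d. c \<in> ?E \<longrightarrow> d \<in> ?E \<longrightarrow> c \<le> d \<longrightarrow>
     emeasure \<nu> {c<..d} = ennreal (mono_right_limit a b (P s) d - mono_right_limit a b (P s) c))" if "s \<in> S" for s
    using stieltjes_measure[OF assms(1) P_mono[OF that]] by metis
  then obtain \<nu> where \<nu>: "\<And>s. s \<in> S \<Longrightarrow> sets (\<nu> s) = sets ?B"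
    "\<And>s c d. s \<in> S \<Longrightarrow> c \<in> ?E \<Longrightarrow> d \<in> ?E \<Longrightarrow> c \<le> d \<Longrightarrow>
     emeasure (\<nu> s) {c<..d} = ennreal (mono_right_limit a b (P s) d - mono_right_limit a b (P s) c)"
    by metis
  have \<nu>_fin: "emeasure (\<nu> s) {c<..d} < \<infinity>" if "s \<in> S" "{c..d} \<subseteq> ?E" for s c d
  proof (cases "c \<le> d")
    case True
    with that(2) have E: "c \<in> ?E" "d \<in> ?E" by auto
    show ?thesis using \<nu>(2)[OF that(1) E True] by simp
  qed auto
  obtain l u :: "nat \<Rightarrow> real" where lu: "\<And>i. {l i..u i} \<subseteq> ?E" "(\<Union>i. {l i<..u i}) = ?E"
    using einterval_exhaustion[OF assms(1)] by metis
  obtain \<mu> g where \<mu>: "sets \<mu> = sets ?B"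
    "\<And>X. X \<in> sets ?B \<Longrightarrow> emeasure \<mu> X = (\<Sum>s\<in>S. emeasure (\<nu> s) X)"
    "\<And>s. s \<in> S \<Longrightarrow> g s \<in> borel_measurable \<mu>" "\<And>s x. 0 \<le> (g s x :: real)"
    "\<And>s. s \<in> S \<Longrightarrow> \<nu> s = density \<mu> (\<lambda>x. ennreal (g s x))"
  proof (rule common_density[OF S(1) \<nu>(1), where A = "\<lambda>i. {l i<..u i}"])
    show "range (\<lambda>i. {l i<..u i}) \<subseteq> sets ?B" using sets_restrict_einterval_Ioc(1)[OF lu(1)] by blast
    show "(\<Union>i. {l i<..u i}) = space ?B" using lu(2) by (simp add: space_restrict_space)
    show "emeasure (\<nu> s) {l i<..u i} < \<infinity>" if "s \<in> S" for s i by (rule \<nu>_fin[OF that lu(1)])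
  qed (assumption | blast)+
  define R where "R = (\<lambda>x. \<Sum>i\<in>Basis. (mono_right_limit a b (P (Some i)) x - mono_right_limit a b (P None) x) *\<^sub>R i)"
  define H where "H = (\<lambda>x. \<Sum>i\<in>Basis. (g (Some i) x - g None x) *\<^sub>R i)"
  have U_eq: "U x = (\<Sum>i\<in>Basis. (P (Some i) x - P None x) *\<^sub>R i)" for x
    by (simp add: P_def euclidean_representation)
  have H_meas: "H \<in> borel_measurable \<mu>"
    unfolding H_def using \<mu>(3) by (intro borel_measurable_sum borel_measurable_scaleR borel_measurable_diff) auto
  have g_int: "set_integrable \<mu> {c<..d} (g s)" "(LINT x:{c<..d}|\<mu>. g s x) = measure (\<nu> s) {c<..d}"
    if "s \<in> S" "{c..d} \<subseteq> ?E" for s c d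
    using set_integrable_density_real[OF \<mu>(3)[OF that(1)] \<mu>(4) _ \<mu>(5)[OF that(1)] \<nu>_fin[OF that]]
      sets_restrict_einterval_Ioc(1)[OF that(2)] \<mu>(1) by auto
  have H_int: "set_integrable \<mu> {c<..d} H"
    "(LINT x:{c<..d}|\<mu>. H x) = (\<Sum>i\<in>Basis. (measure (\<nu> (Some i)) {c<..d} - measure (\<nu> None) {c<..d}) *\<^sub>R i)"
    if "{c..d} \<subseteq> ?E" for c d
  proof -
    have eq: "indicator {c<..d} x *\<^sub>R H x = (\<Sum>i\<in>Basis. (indicator {c<..d} x *\<^sub>R g (Some i) x - indicator {c<..d} x *\<^sub>R g None x) *\<^sub>R i)" for x
      by (simp add: H_def scaleR_sum_right right_diff_distrib)
    have int: "integrable \<mu> (\<lambda>x. indicator {c<..d} x *\<^sub>R g (Some i) x - indicator {c<..d} x *\<^sub>R g None x)" if "i \<in> Basis" for i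
      using g_int(1)[OF _ \<open>{c..d} \<subseteq> ?E\<close>] that unfolding set_integrable_def by (intro Bochner_Integration.integrable_diff) auto
    have "(\<integral>x. indicator {c<..d} x *\<^sub>R g (Some i) x - indicator {c<..d} x *\<^sub>R g None x \<partial>\<mu>) =
       measure (\<nu> (Some i)) {c<..d} - measure (\<nu> None) {c<..d}" if "i \<in> Basis" for i
      using g_int[OF _ \<open>{c..d} \<subseteq> ?E\<close>] that unfolding set_integrable_def set_lebesgue_integral_def
      by (subst Bochner_Integration.integral_diff) auto
    note int_eq = this
    show "set_integrable \<mu> {c<..d} H"
      unfolding set_integrable_def eq by (rule has_integral_Basis_sum(1), rule int)
    show "(LINT x:{c<..d}|\<mu>. H x) = (\<Sum>i\<in>Basis. (measure (\<nu> (Some i)) {c<..d} - measure (\<nu> None) {c<..d}) *\<^sub>R i)"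
      unfolding set_lebesgue_integral_def eq
      by (subst has_integral_Basis_sum(2), erule int, intro sum.cong refl, subst int_eq) auto
  qed
  show ?thesis
  proof (rule that[OF \<mu>(1) H_meas])
    have "(\<lambda>x. \<Sum>i\<in>Basis. (P (Some i) x - P None x) *\<^sub>R i) \<in> borel_measurable ?B"
      using borel_measurable_mono_on_fnc[OF P_mono]
      by (intro borel_measurable_sum borel_measurable_scaleR borel_measurable_diff) auto
    then show "U \<in> borel_measurable ?B" by (simp add: U_eq[symmetric])
    show "emeasure \<mu> {c<..d} < \<infinity>" if "{c..d} \<subseteq> ?E" for c d
      using \<nu>_fin[OF _ that] \<mu>(2) sets_restrict_einterval_Ioc(1)[OF that] by (simp add: less_top)
    show "set_integrable \<mu> {c<..d} H" if "{c..d} \<subseteq> ?E" for c d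
      by (rule H_int[OF that])
    show "(LINT x:{c<..d}|\<mu>. H x) = R d - R c" if "{c..d} \<subseteq> ?E" "c \<le> d" for c d
    proof -
      have E: "c \<in> ?E" "d \<in> ?E" using that by auto
      have "mono_right_limit a b (P s) c \<le> mono_right_limit a b (P s) d" if "s \<in> S" for s
        using mono_right_limit(5)[OF P_mono[OF that] E(1) E(2)] \<open>c \<le> d\<close> by (cases "c = d") auto
      then have m: "measure (\<nu> s) {c<..d} = mono_right_limit a b (P s) d - mono_right_limit a b (P s) c" if "s \<in> S" for s
        using \<nu>(2)[OF that E \<open>c \<le> d\<close>] that by (simp add: measure_def)
      show ?thesis
        unfolding H_int(2)[OF that(1)] R_def sum_subtractf[symmetric] scaleR_left_diff_distrib[symmetric]
        by (intro sum.cong refl arg_cong2[of _ _ _ _ scaleR]) (simp add: m)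
    qed
    show "(U \<longlongrightarrow> R x) (at_right x)" if "x \<in> ?E" for x
      unfolding R_def U_eq using mono_right_limit(1)[OF P_mono that]
      by (intro tendsto_sum tendsto_scaleR tendsto_diff tendsto_const) auto
    fix \<phi> assume \<phi>: "\<phi> \<in> test_functions a b"
    have parts: "integrable (\<nu> s) \<phi>" "set_integrable lborel ?E (\<lambda>x. deriv \<phi> x * P s x)"
      "(LINT x|\<nu> s. \<phi> x) = - (LINT x:?E|lborel. deriv \<phi> x * P s x)" if "s \<in> S" for s
      by (rule stieltjes_integration_by_parts[OF assms(1) P_mono[OF that] \<nu>(1)[OF that] \<nu>(2)[OF that] \<phi>], assumption+)+
    have eq: "indicator ?E x *\<^sub>R (deriv \<phi> x *\<^sub>R U x) = (\<Sum>i\<in>Basis. (indicator ?E x *\<^sub>R (deriv \<phi> x * P (Some i) x) -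
        indicator ?E x *\<^sub>R (deriv \<phi> x * P None x)) *\<^sub>R i)" for x
      by (simp add: U_eq[of x] scaleR_sum_right right_diff_distrib algebra_simps)
    have int: "integrable lborel (\<lambda>x. indicator ?E x *\<^sub>R (deriv \<phi> x * P (Some i) x) -
        indicator ?E x *\<^sub>R (deriv \<phi> x * P None x))" if "i \<in> Basis" for i
      using parts(2) that unfolding set_integrable_def by (intro Bochner_Integration.integrable_diff) auto
    have \<phi>_meas: "\<phi> \<in> borel_measurable \<mu>"
      using test_function_continuous(1)[OF \<phi>, of UNIV]
      by (intro measurable_restrict_einterval[OF \<mu>(1)] borel_measurable_continuous_onI)
    have int': "integrable \<mu> (\<lambda>x. g s x *\<^sub>R \<phi> x)" "(\<integral>x. \<phi> x \<partial>\<nu> s) = (\<integral>x. g s x *\<^sub>R \<phi> x \<partial>\<mu>)" if "s \<in> S" for s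
      using parts(1)[OF that] integrable_density[OF \<phi>_meas \<mu>(3)[OF that]] integral_density[OF \<phi>_meas \<mu>(3)[OF that]]
        \<mu>(4) \<mu>(5)[OF that] by auto
    have eq': "\<phi> x *\<^sub>R H x = (\<Sum>i\<in>Basis. (g (Some i) x *\<^sub>R \<phi> x - g None x *\<^sub>R \<phi> x) *\<^sub>R i)" for x
      by (simp add: H_def scaleR_sum_right algebra_simps)
    show "set_integrable lborel ?E (\<lambda>x. deriv \<phi> x *\<^sub>R U x)"
      unfolding set_integrable_def eq by (rule has_integral_Basis_sum(1), rule int)
    have "dist_deriv a b U \<phi> = - (\<Sum>i\<in>Basis. (\<integral>x. indicator ?E x *\<^sub>R (deriv \<phi> x * P (Some i) x) -
        indicator ?E x *\<^sub>R (deriv \<phi> x * P None x) \<partial>lborel) *\<^sub>R i)"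
      unfolding dist_deriv_def set_lebesgue_integral_def eq
      by (subst has_integral_Basis_sum(2), erule int) (rule refl)
    also have "\<dots> = (\<Sum>i\<in>Basis. ((\<integral>x. \<phi> x \<partial>\<nu> (Some i)) - (\<integral>x. \<phi> x \<partial>\<nu> None)) *\<^sub>R i)"
      unfolding sum_negf[symmetric] using parts(2,3)
      by (intro sum.cong refl, subst Bochner_Integration.integral_diff)
        (auto simp: set_integrable_def set_lebesgue_integral_def algebra_simps)
    also have "\<dots> = (\<Sum>i\<in>Basis. (\<integral>x. g (Some i) x *\<^sub>R \<phi> x - g None x *\<^sub>R \<phi> x \<partial>\<mu>) *\<^sub>R i)"
      using int' by (intro sum.cong refl, subst Bochner_Integration.integral_diff) auto
    also have "\<dots> = (LINT x|\<mu>. \<phi> x *\<^sub>R H x)"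
      unfolding eq' using int' by (subst has_integral_Basis_sum(2)) (auto intro!: Bochner_Integration.integrable_diff)
    finally show "dist_deriv a b U \<phi> = (LINT x|\<mu>. \<phi> x *\<^sub>R H x)" .
  qed
qed

section \<open>Sign conditions on test functions\<close>

text \<open>Intervals that reach an end point of \<open>(a, b)\<close> are left out of the generator, as they may have
  infinite measure.\<close>
lemma sets_einterval_generated:
  assumes "a < b"
  shows "sets (restrict_space borel (einterval a b)) =
    sigma_sets (einterval a b) {{c<..d} |c d. c \<in> einterval a b \<and> d \<in> einterval a b}"
proof -
  let ?E = "einterval a b" and ?G = "{{c<..d} |c d. c \<in> einterval a b \<and> d \<in> einterval a b}"
  have G: "{c<..d} \<subseteq> ?E" "{c..d} \<subseteq> ?E" if "c \<in> ?E" "d \<in> ?E" for c d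
    using mem_einterval_between[OF that] by auto
  obtain l u :: "nat \<Rightarrow> real" where lu: "\<And>i. l i < u i" "\<And>i. {l i..u i} \<subseteq> ?E" "(\<Union>i. {l i<..u i}) = ?E"
    using einterval_exhaustion[OF assms] by metis
  have "?E \<inter> {..x} \<in> sigma_sets ?E ?G" for x
  proof -
    have "{l i<..min x (u i)} \<in> sigma_sets ?E ?G" for i
    proof (cases "l i \<le> x")
      case True
      then have "min x (u i) \<in> {l i..u i}" using lu(1)[of i] by auto
      then have "l i \<in> ?E" "min x (u i) \<in> ?E" using lu(1,2)[of i] by auto
      then show ?thesis by (intro sigma_sets.Basic) blast
    next
      case False
      then have "{l i<..min x (u i)} = {}" by auto
      then show ?thesis by (simp only: sigma_sets.Empty)
    qed
    then have "(\<Union>i. {l i<..min x (u i)}) \<in> sigma_sets ?E ?G"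
      by (rule sigma_sets.Union)
    also have "(\<Union>i. {l i<..min x (u i)}) = (\<Union>i. {l i<..u i}) \<inter> {..x}"
      by auto
    also have "\<dots> = ?E \<inter> {..x}"
      unfolding lu(3) ..
    finally show ?thesis .
  qed
  then have "sigma_sets ?E ((\<inter>) ?E ` range (\<lambda>x. {..x})) \<subseteq> sigma_sets ?E ?G"
    by (intro sigma_sets_mono) auto
  moreover have "sets (restrict_space borel ?E) = sigma_sets ?E ((\<inter>) ?E ` range (\<lambda>x. {..x}))"
  proof -
    have B: "sigma_sets UNIV (range (\<lambda>x::real. {..x})) = sets borel"
      by (simp add: borel_eq_atMost)
    show ?thesis
      unfolding sets_restrict_space B[symmetric]
      by (rule sigma_sets_Int) (simp_all add: B)
  qed
  moreover have "sigma_sets ?E ?G \<subseteq> sets (restrict_space borel ?E)"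
  proof -
    have "?G \<subseteq> sets (restrict_space borel ?E)"
    proof clarify
      fix c d assume "c \<in> ?E" "d \<in> ?E"
      then show "{c<..d} \<in> sets (restrict_space borel ?E)" by (intro sets_restrict_einterval_Ioc(1) G(2))
    qed
    then show ?thesis
      using sets.sigma_sets_subset[of ?G "restrict_space borel ?E"] by (simp add: space_restrict_space)
  qed
  ultimately show ?thesis by (simp only: subset_antisym)
qed

lemma measure_eqI_einterval:
  assumes "a < b" "sets \<mu> = sets (restrict_space borel (einterval a b))" "sets \<nu> = sets (restrict_space borel (einterval a b))"
    and eq: "\<And>c d. c \<in> einterval a b \<Longrightarrow> d \<in> einterval a b \<Longrightarrow> c < d \<Longrightarrow> emeasure \<mu> {c<..d} = emeasure \<nu> {c<..d}"
    and fin: "\<And>c d. c \<in> einterval a b \<Longrightarrow> d \<in> einterval a b \<Longrightarrow> c < d \<Longrightarrow> emeasure \<mu> {c<..d} < \<infinity>"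
  shows "\<mu> = \<nu>"
proof -
  let ?E = "einterval a b" and ?G = "{{c<..d} |c d. c \<in> einterval a b \<and> d \<in> einterval a b}"
  obtain l u :: "nat \<Rightarrow> real" where lu: "\<And>i. l i < u i" "\<And>i. {l i..u i} \<subseteq> ?E" "(\<Union>i. {l i<..u i}) = ?E"
    using einterval_exhaustion[OF assms(1)] by metis
  have lu_E: "l i \<in> ?E" "u i \<in> ?E" for i using lu(1,2)[of i] by auto
  show ?thesis
  proof (rule measure_eqI_generator_eq[of ?G ?E \<mu> \<nu> "\<lambda>i. {l i<..u i}"])
    show "Int_stable ?G"
    proof (rule Int_stableI, clarify)
      fix c d c' d' assume "c \<in> ?E" "d \<in> ?E" "c' \<in> ?E" "d' \<in> ?E"
      then show "\<exists>e f. {c<..d} \<inter> {c'<..d'} = {e<..f} \<and> e \<in> ?E \<and> f \<in> ?E"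
        by (intro exI[of _ "max c c'"] exI[of _ "min d d'"]) (simp add: max_def min_def)
    qed
    show "?G \<subseteq> Pow ?E"
    proof clarify
      fix c d x assume "c \<in> ?E" "d \<in> ?E" "x \<in> {c<..d}"
      then show "x \<in> ?E" using mem_einterval_between[of c a b d x] by simp
    qed
    show "emeasure \<mu> X = emeasure \<nu> X" if XG: "X \<in> ?G" for X
    proof -
      obtain c d where X: "X = {c<..d}" "c \<in> ?E" "d \<in> ?E" using XG by (elim CollectE exE conjE)
      show ?thesis using eq[OF X(2,3)] unfolding X(1) by (cases "c < d") auto
    qed
    show "emeasure \<mu> {l i<..u i} \<noteq> \<infinity>" for i
      using fin[OF lu_E lu(1)] by (simp add: less_top[symmetric])
    show "range (\<lambda>i. {l i<..u i}) \<subseteq> ?G" using lu_E by blast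
  qed (simp_all only: assms(2,3) sets_einterval_generated[OF assms(1)] lu(3))
qed

text \<open>Nonnegativity passes from test functions to intervals by dominated convergence. The
  resulting set function on intervals is then the Stieltjes measure of a monotone function, and
  adding it to the negative part of the given measure yields the positive part.\<close>

lemma AE_nonneg_if_test_nonneg:
  fixes g :: "real \<Rightarrow> real"
  assumes "a < b" and sets_\<mu>: "sets \<mu> = sets (restrict_space borel (einterval a b))"
    and g: "g \<in> borel_measurable \<mu>"
    and g_int: "\<And>c d. {c..d} \<subseteq> einterval a b \<Longrightarrow> set_integrable \<mu> {c..d} g"
    and nonneg: "\<And>\<phi>. \<phi> \<in> test_functions a b \<Longrightarrow> (\<And>x. 0 \<le> \<phi> x) \<Longrightarrow> 0 \<le> (LINT x|\<mu>. \<phi> x * g x)"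
  shows "AE x in \<mu>. 0 \<le> g x"
proof -
  let ?E = "einterval a b"
  have Icc: "{c..d} \<subseteq> ?E" if "c \<in> ?E" "d \<in> ?E" for c d
    using mem_einterval_between[OF that] by auto
  have [measurable]: "{c<..d} \<in> sets \<mu>" "{c<..<d} \<in> sets \<mu>" "{c..d} \<in> sets \<mu>" if "c \<in> ?E" "d \<in> ?E" for c d
    using sets_restrict_einterval_Ioc[OF Icc[OF that]] sets_\<mu> by auto
  note [measurable] = g
  have dom: "integrable \<mu> (\<lambda>x. indicator {c..d} x * \<bar>g x\<bar>)" if "c \<in> ?E" "d \<in> ?E" for c d
    using integrable_abs[OF g_int[OF Icc[OF that], unfolded set_integrable_def]] by (simp add: abs_mult)
  \<comment> \<open>Integrals over open intervals are limits of integrals against bump functions. Half-open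
     intervals are treated next, as they are the ones that add up.\<close>
  have int_Ioo: "0 \<le> (\<integral>x. indicator {c<..<d} x * g x \<partial>\<mu>)" if cd: "c \<in> ?E" "d \<in> ?E" for c d
  proof -
    obtain \<phi> where \<phi>: "\<And>m. \<phi> m \<in> test_functions a b" "\<And>m x. 0 \<le> \<phi> m x" "\<And>m x. \<phi> m x \<le> 1"
      "\<And>m x. x \<notin> {c<..<d} \<Longrightarrow> \<phi> m x = 0" "\<And>x. (\<lambda>m. \<phi> m x) \<longlonglongrightarrow> indicator {c<..<d} x"
      using bump_functions[OF Icc[OF cd]] by metis
    have \<phi>_meas[measurable]: "\<phi> m \<in> borel_measurable \<mu>" for m
      using test_function_continuous(1)[OF \<phi>(1), of UNIV]
      by (intro measurable_restrict_einterval[OF sets_\<mu>] borel_measurable_continuous_onI)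
    have "(\<lambda>m. \<integral>x. \<phi> m x * g x \<partial>\<mu>) \<longlonglongrightarrow> (\<integral>x. indicator {c<..<d} x * g x \<partial>\<mu>)"
    proof (rule integral_dominated_convergence[OF _ _ dom[OF cd]])
      show "AE x in \<mu>. norm (\<phi> m x * g x) \<le> indicator {c..d} x * \<bar>g x\<bar>" for m
      proof (rule AE_I2)
        fix x show "norm (\<phi> m x * g x) \<le> indicator {c..d} x * \<bar>g x\<bar>"
          using \<phi>(4)[of x m] \<phi>(2)[of m x] \<phi>(3)[of m x]
          by (cases "x \<in> {c<..<d}") (auto simp: abs_mult mult_left_le_one_le)
      qed
    qed (use \<phi>(5) cd in \<open>auto intro!: AE_I2 tendsto_mult\<close>)
    then show ?thesis
      by (rule tendsto_lowerbound) (use nonneg[OF \<phi>(1)] \<phi>(2) in auto)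
  qed
  define G where "G = (\<lambda>c d. \<integral>x. indicator {c<..d} x * g x \<partial>\<mu>)"
  have Ioc_int: "integrable \<mu> (\<lambda>x. indicator {c<..d} x * g x)" if "c \<in> ?E" "d \<in> ?E" for c d
  proof (rule Bochner_Integration.integrable_bound[OF dom[OF that]])
    show "(\<lambda>x. indicator {c<..d} x * g x) \<in> borel_measurable \<mu>"
      using that by measurable
  qed (auto simp: indicator_def)
  have G_add: "G c d + G d e = G c e" if "c \<in> ?E" "d \<in> ?E" "e \<in> ?E" "c \<le> d" "d \<le> e" for c d e
  proof -
    have "G c d + G d e = (\<integral>x. indicator {c<..d} x * g x + indicator {d<..e} x * g x \<partial>\<mu>)"
      unfolding G_def using that by (intro Bochner_Integration.integral_add[symmetric] Ioc_int)
    also have "\<dots> = G c e"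
      unfolding G_def using that by (intro Bochner_Integration.integral_cong) (auto simp: indicator_def)
    finally show ?thesis .
  qed
  have G_limits: "0 \<le> G c d" "\<exists>y. (\<forall>m. y m \<in> ?E \<and> d < y m) \<and> (\<lambda>m::nat. G d (y m)) \<longlonglongrightarrow> 0"
    if cd: "c \<in> ?E" "d \<in> ?E" for c d
  proof -
    obtain e where e: "e \<in> ?E" "d < e" using einterval_right_point[OF cd(2)] by blast
    define y where "y = (\<lambda>m. d + (e - d) / real (Suc m))"
    have y_less: "d < y m" "y m \<le> e" for m
    proof -
      show "d < y m" using e by (simp add: y_def)
      have "(e - d) / (1 + real m) \<le> e - d" using e by (simp add: divide_le_eq mult_le_cancel_left1)
      then show "y m \<le> e" by (simp add: y_def)
    qed
    have y_E: "y m \<in> ?E" for m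
      using mem_einterval_between[OF cd(2) e(1)] y_less by (auto simp: less_imp_le)
    have y_lim: "y \<longlonglongrightarrow> d"
      unfolding y_def using tendsto_add[OF tendsto_const[of d] LIMSEQ_Suc[OF lim_const_over_n[of "e - d"]]] by simp
    have ev: "eventually (\<lambda>m. y m < x) sequentially" if "d < x" for x
      using order_tendstoD(2)[OF y_lim that] .
    have "(\<lambda>m. \<integral>x. indicator {c<..<y m} x * g x \<partial>\<mu>) \<longlonglongrightarrow> G c d"
      unfolding G_def
    proof (rule integral_dominated_convergence[OF _ _ dom[OF cd(1) e(1)]])
      have "(\<lambda>m. indicator {c<..<y m} x * g x) \<longlonglongrightarrow> indicator {c<..d} x * g x" for x
      proof (rule tendsto_eventually)
        show "\<forall>\<^sub>F m in sequentially. indicator {c<..<y m} x * g x = indicator {c<..d} x * g x"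
        proof (cases "d < x")
          case True
          show ?thesis using ev[OF True] by (rule eventually_mono) (use True in auto)
        next
          case False
          then have "x < y m" for m using y_less(1)[of m] by simp
          then show ?thesis using False by (auto simp: indicator_def)
        qed
      qed
      then show "AE x in \<mu>. (\<lambda>m. indicator {c<..<y m} x * g x) \<longlonglongrightarrow> indicator {c<..d} x * g x" by simp
      show "AE x in \<mu>. norm (indicator {c<..<y m} x * g x) \<le> indicator {c..e} x * \<bar>g x\<bar>" for m
        using y_less(2)[of m] by (auto intro!: AE_I2 simp: indicator_def)
    qed (use cd y_E in auto)
    then show "0 \<le> G c d"
      by (rule tendsto_lowerbound) (use int_Ioo[OF cd(1) y_E] in auto)
    have "(\<lambda>m. G d (y m)) \<longlonglongrightarrow> (\<integral>x. 0 \<partial>\<mu>)"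
      unfolding G_def
    proof (rule integral_dominated_convergence[OF _ _ dom[OF cd(2) e(1)]])
      have "(\<lambda>m. indicator {d<..y m} x * g x) \<longlonglongrightarrow> 0" for x
      proof (rule tendsto_eventually)
        show "\<forall>\<^sub>F m in sequentially. indicator {d<..y m} x * g x = 0"
        proof (cases "d < x")
          case True
          show ?thesis using ev[OF True] by (rule eventually_mono) auto
        qed auto
      qed
      then show "AE x in \<mu>. (\<lambda>m. indicator {d<..y m} x * g x) \<longlonglongrightarrow> 0" by simp
      show "AE x in \<mu>. norm (indicator {d<..y m} x * g x) \<le> indicator {d..e} x * \<bar>g x\<bar>" for m
        using y_less(2)[of m] by (auto intro!: AE_I2 simp: indicator_def)
    qed (use cd y_E in auto)
    then show "\<exists>y. (\<forall>m. y m \<in> ?E \<and> d < y m) \<and> (\<lambda>m::nat. G d (y m)) \<longlonglongrightarrow> 0"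
      using y_less(1) y_E by (intro exI[of _ y]) auto
  qed
  obtain z where z: "z \<in> ?E"
    using \<open>a < b\<close> ereal_dense2 unfolding einterval_def by blast
  \<comment> \<open>The primitive of \<open>g \<mu>\<close>. It is monotone and right-continuous, so its Stieltjes measure is a
     positive measure that agrees with \<open>g \<mu>\<close> on half-open intervals.\<close>
  define p where "p = (\<lambda>x. if z \<le> x then G z x else - G x z)"
  have p_diff: "p y - p x = G x y" if "x \<in> ?E" "y \<in> ?E" "x \<le> y" for x y
    using G_add[OF z that(1,2)] G_add[OF that(1) z that(2)] G_add[OF that(1,2) z] that by (auto simp: p_def)
  have p_mono: "mono_on ?E p"
    using p_diff G_limits(1) by (intro mono_onI) (smt (verit))
  have p_right: "mono_right_limit a b p x = p x" if xE: "x \<in> ?E" for x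
  proof (rule antisym)
    obtain y where y: "\<And>m. y m \<in> ?E" "\<And>m. x < y m" "(\<lambda>m::nat. G x (y m)) \<longlonglongrightarrow> 0"
      using G_limits(2)[OF xE xE] by blast
    have "(\<lambda>m. p x + G x (y m)) \<longlonglongrightarrow> p x + 0"
      by (intro tendsto_add tendsto_const y)
    moreover have "mono_right_limit a b p x \<le> p x + G x (y m)" for m
      using mono_right_limit(2)[OF p_mono xE y(1,2)[of m]] p_diff[OF xE y(1)[of m]] y(2)[of m] by simp
    ultimately show "mono_right_limit a b p x \<le> p x"
      using tendsto_lowerbound[of _ "p x + 0" sequentially "mono_right_limit a b p x"] by simp
    show "p x \<le> mono_right_limit a b p x"
      using mono_right_limit(3)[OF p_mono xE y(1,2)[of 0]] .
  qed
  obtain \<rho> where \<rho>: "sets \<rho> = sets (restrict_space borel ?E)"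
    "\<And>c d. c \<in> ?E \<Longrightarrow> d \<in> ?E \<Longrightarrow> c \<le> d \<Longrightarrow> emeasure \<rho> {c<..d} = ennreal (G c d)"
    using stieltjes_measure[OF \<open>a < b\<close> p_mono] p_right p_diff by metis
  let ?pos = "density \<mu> (\<lambda>x. ennreal (g x))" and ?neg = "density \<mu> (\<lambda>x. ennreal (- g x))"
  have part_int: "integrable \<mu> (\<lambda>x. indicator {c<..d} x * max 0 (g x))" "integrable \<mu> (\<lambda>x. indicator {c<..d} x * max 0 (- g x))"
    if "c \<in> ?E" "d \<in> ?E" for c d
  proof -
    have [measurable]: "(\<lambda>x. indicator {c<..d} x * max 0 (g x)) \<in> borel_measurable \<mu>"
      "(\<lambda>x. indicator {c<..d} x * max 0 (- g x)) \<in> borel_measurable \<mu>"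
      using that by measurable
    show "integrable \<mu> (\<lambda>x. indicator {c<..d} x * max 0 (g x))"
      by (rule Bochner_Integration.integrable_bound[OF dom[OF that]], measurable) (auto simp: indicator_def)
    show "integrable \<mu> (\<lambda>x. indicator {c<..d} x * max 0 (- g x))"
      by (rule Bochner_Integration.integrable_bound[OF dom[OF that]], measurable) (auto simp: indicator_def)
  qed
  have em_part: "emeasure ?pos {c<..d} = ennreal (\<integral>x. indicator {c<..d} x * max 0 (g x) \<partial>\<mu>)"
    "emeasure ?neg {c<..d} = ennreal (\<integral>x. indicator {c<..d} x * max 0 (- g x) \<partial>\<mu>)" if "c \<in> ?E" "d \<in> ?E" for c d
    using that part_int[OF that]
    by (auto simp: emeasure_density nn_integral_eq_integral[symmetric] ennreal_neg max_def indicator_def intro!: nn_integral_cong)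
  define \<nu> where "\<nu> = (\<lambda>s. if s then \<rho> else ?neg)"
  obtain l u :: "nat \<Rightarrow> real" where lu: "\<And>i. l i < u i" "\<And>i. {l i..u i} \<subseteq> ?E" "(\<Union>i. {l i<..u i}) = ?E"
    using einterval_exhaustion[OF assms(1)] by metis
  have lu_E: "l i \<in> ?E" "u i \<in> ?E" for i using lu(1,2)[of i] by auto
  have \<nu>_fin: "emeasure (\<nu> s) {c<..d} < \<infinity>" if "c \<in> ?E" "d \<in> ?E" "c \<le> d" for s c d
    using \<rho>(2)[OF that] em_part(2)[OF that(1,2)] by (auto simp: \<nu>_def)
  have \<nu>_sets: "sets (\<nu> s) = sets (restrict_space borel ?E)" for s
    using \<rho>(1) sets_\<mu> by (simp add: \<nu>_def)
  obtain \<sigma> where \<sigma>: "sets \<sigma> = sets (restrict_space borel ?E)"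
    "\<And>X. X \<in> sets (restrict_space borel ?E) \<Longrightarrow> emeasure \<sigma> X = (\<Sum>s\<in>UNIV. emeasure (\<nu> s) X)"
  proof (rule common_density[of UNIV \<nu> "restrict_space borel ?E" "\<lambda>i. {l i<..u i}"])
    show "range (\<lambda>i. {l i<..u i}) \<subseteq> sets (restrict_space borel ?E)" using sets_restrict_einterval_Ioc(1)[OF lu(2)] by blast
    show "(\<Union>i. {l i<..u i}) = space (restrict_space borel ?E)" using lu(3) by (simp add: space_restrict_space)
    show "emeasure (\<nu> s) {l i<..u i} < \<infinity>" for s i using \<nu>_fin[OF lu_E] lu(1)[of i] by simp
  qed (use \<nu>_sets in auto)
  \<comment> \<open>Uniqueness of measures extends the identity \<open>pos = \<rho> + neg\<close> from intervals to the set where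
     \<open>g < 0\<close>, which is null for \<open>pos\<close> and therefore for \<open>neg\<close>.\<close>
  have \<sigma>_eq: "emeasure \<sigma> X = emeasure \<rho> X + emeasure ?neg X" if "X \<in> sets \<mu>" for X
    using \<sigma>(2)[of X] that sets_\<mu> by (simp add: \<nu>_def UNIV_bool add.commute)
  have "\<sigma> = ?pos"
  proof (rule measure_eqI_einterval[OF \<open>a < b\<close> \<sigma>(1)])
    fix c d assume cd: "c \<in> ?E" "d \<in> ?E" "c < d"
    have *: "G c d = (\<integral>x. indicator {c<..d} x * max 0 (g x) \<partial>\<mu>) - (\<integral>x. indicator {c<..d} x * max 0 (- g x) \<partial>\<mu>)"
    proof -
      have "G c d = (\<integral>x. indicator {c<..d} x * max 0 (g x) - indicator {c<..d} x * max 0 (- g x) \<partial>\<mu>)"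
        unfolding G_def by (intro Bochner_Integration.integral_cong) (auto simp: indicator_def max_def)
      then show ?thesis
        using part_int[OF cd(1,2)] by (simp only: Bochner_Integration.integral_diff)
    qed
    have "emeasure \<sigma> {c<..d} = ennreal (G c d) + ennreal (\<integral>x. indicator {c<..d} x * max 0 (- g x) \<partial>\<mu>)"
      using cd \<rho>(2)[OF cd(1,2)] em_part[OF cd(1,2)] by (subst \<sigma>_eq) auto
    also have "\<dots> = ennreal (\<integral>x. indicator {c<..d} x * max 0 (g x) \<partial>\<mu>)"
      using G_limits(1)[OF cd(1,2)] by (subst ennreal_plus[symmetric]) (auto simp: * intro!: integral_nonneg)
    finally show "emeasure \<sigma> {c<..d} = emeasure ?pos {c<..d}" using em_part[OF cd(1,2)] by simp
    then show "emeasure \<sigma> {c<..d} < \<infinity>" using em_part[OF cd(1,2)] by simp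
  qed (simp add: sets_\<mu>)
  define N where "N = {x \<in> space \<mu>. g x < 0}"
  have N: "N \<in> sets \<mu>" unfolding N_def by measurable
  have "emeasure ?pos N = 0"
    using N by (auto simp: emeasure_density N_def nn_integral_0_iff_AE ennreal_neg indicator_def intro!: AE_I2)
  then have "emeasure ?neg N = 0"
    using \<sigma>_eq[OF N] \<open>\<sigma> = ?pos\<close> by simp
  then have "AE x in \<mu>. ennreal (- g x) * indicator N x = 0"
    using N by (auto simp: emeasure_density nn_integral_0_iff_AE)
  then show ?thesis
    using AE_space by eventually_elim (auto simp: N_def indicator_def ennreal_eq_0_iff split: if_splits)
qed

section \<open>A product rule for balanced functions\<close>

text \<open>Giving weight \<open>1/2\<close> to the diagonal, an integral against this kernel is the average of the
  integrals over \<open>x < y\<close> and over \<open>x \<le> y\<close>. It is therefore the balanced primitive of a measure.\<close>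
definition half_kernel :: "real \<Rightarrow> real \<Rightarrow> complex"
  where "half_kernel x y = (if x < y then 1 else if x = y then 1 / 2 else 0)"

lemma half_kernel_sum: "half_kernel x y + half_kernel y x = 1"
  by (auto simp: half_kernel_def)

text \<open>The product of the integrals of \<open>f\<close> and \<open>g\<close> is a double integral, which splits according to
  \<open>half_kernel x y + half_kernel y x = 1\<close>; both parts are evaluated by Fubini's theorem.\<close>
lemma product_rule_half_kernel:
  fixes f g :: "real \<Rightarrow> complex" and \<alpha> \<beta> :: complex
  assumes "finite_measure M" and id_meas: "(\<lambda>x. x) \<in> borel_measurable M"
    and f: "integrable M f" and g: "integrable M g"
  defines "F \<equiv> \<lambda>y. \<alpha> + (\<integral>x. half_kernel x y * f x \<partial>M)"
    and "G \<equiv> \<lambda>y. \<beta> + (\<integral>x. half_kernel x y * g x \<partial>M)"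
  shows "integrable M (\<lambda>x. f x * G x + F x * g x)"
    and "(\<integral>x. f x * G x + F x * g x \<partial>M) = (\<alpha> + (\<integral>x. f x \<partial>M)) * (\<beta> + (\<integral>x. g x \<partial>M)) - \<alpha> * \<beta>"
proof -
  interpret finite_measure M by fact
  interpret P: pair_sigma_finite M M ..
  note [measurable] = id_meas borel_measurable_integrable[OF f] borel_measurable_integrable[OF g]
  have prod: "integrable (M \<Otimes>\<^sub>M M) (\<lambda>(x, y). h x y * (f x * g y))"
    if h[measurable]: "case_prod h \<in> borel_measurable (M \<Otimes>\<^sub>M M)" and bound: "\<And>x y. norm (h x y) \<le> 1"
    for h :: "real \<Rightarrow> real \<Rightarrow> complex"
  proof (rule Bochner_Integration.integrable_bound)
    show "integrable (M \<Otimes>\<^sub>M M) (\<lambda>(x, y). f x * g y)"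
    proof (rule P.Fubini_integrable)
      show "integrable M (\<lambda>x. \<integral>y. norm (case (x, y) of (x, y) \<Rightarrow> f x * g y) \<partial>M)"
        using f g by (simp add: norm_mult)
      show "AE x in M. integrable M (\<lambda>y. case (x, y) of (x, y) \<Rightarrow> f x * g y)"
        using g by simp
    qed measurable
    show "AE p in M \<Otimes>\<^sub>M M. norm (case p of (x, y) \<Rightarrow> h x y * (f x * g y)) \<le> norm (case p of (x, y) \<Rightarrow> f x * g y)"
      using bound by (auto intro!: AE_I2 mult_left_le_one_le simp: norm_mult split: prod.split)
    show "(\<lambda>(x, y). h x y * (f x * g y)) \<in> borel_measurable (M \<Otimes>\<^sub>M M)"
      by measurable
  qed
  have k_meas: "(\<lambda>(x, y). half_kernel x y) \<in> borel_measurable (M \<Otimes>\<^sub>M M)"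
    "(\<lambda>(x, y). half_kernel y x) \<in> borel_measurable (M \<Otimes>\<^sub>M M)"
    unfolding half_kernel_def by measurable
  have k_int: "integrable (M \<Otimes>\<^sub>M M) (\<lambda>(x, y). half_kernel x y * (f x * g y))"
    "integrable (M \<Otimes>\<^sub>M M) (\<lambda>(x, y). half_kernel y x * (f x * g y))"
    using k_meas by (auto intro!: prod simp: half_kernel_def)
  have one: "integrable M (\<lambda>y. \<integral>x. half_kernel x y * (f x * g y) \<partial>M)"
    "(\<integral>y. (\<integral>x. half_kernel x y * (f x * g y) \<partial>M) \<partial>M) = (\<integral>p. (case p of (x, y) \<Rightarrow> half_kernel x y * (f x * g y)) \<partial>(M \<Otimes>\<^sub>M M))"
    using P.integrable_snd[OF k_int(1)] P.integral_snd[OF k_int(1)] by simp_all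
  have two: "integrable M (\<lambda>x. \<integral>y. half_kernel y x * (f x * g y) \<partial>M)"
    "(\<integral>x. (\<integral>y. half_kernel y x * (f x * g y) \<partial>M) \<partial>M) = (\<integral>p. (case p of (x, y) \<Rightarrow> half_kernel y x * (f x * g y)) \<partial>(M \<Otimes>\<^sub>M M))"
    using P.integrable_fst[OF k_int(2)] P.integral_fst[OF k_int(2)] by simp_all
  have "(\<integral>p. (case p of (x, y) \<Rightarrow> half_kernel x y * (f x * g y)) \<partial>(M \<Otimes>\<^sub>M M)) +
      (\<integral>p. (case p of (x, y) \<Rightarrow> half_kernel y x * (f x * g y)) \<partial>(M \<Otimes>\<^sub>M M)) =
      (\<integral>p. (case p of (x, y) \<Rightarrow> f x * g y) \<partial>(M \<Otimes>\<^sub>M M))"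
    using half_kernel_sum
    by (subst Bochner_Integration.integral_add[OF k_int, symmetric])
      (auto intro!: Bochner_Integration.integral_cong simp flip: distrib_right split: prod.split)
  also have "\<dots> = (\<integral>x. f x \<partial>M) * (\<integral>x. g x \<partial>M)"
    using P.integral_fst[OF prod[of "\<lambda>x y. 1"]] by simp
  finally have sum: "(\<integral>y. (\<integral>x. half_kernel x y * (f x * g y) \<partial>M) \<partial>M) + (\<integral>x. (\<integral>y. half_kernel y x * (f x * g y) \<partial>M) \<partial>M) =
      (\<integral>x. f x \<partial>M) * (\<integral>x. g x \<partial>M)"
    unfolding one(2) two(2) .
  have eq: "f x * G x + F x * g x = f x * \<beta> + \<alpha> * g x +
      ((\<integral>y. half_kernel y x * (f y * g x) \<partial>M) + (\<integral>y. half_kernel y x * (f x * g y) \<partial>M))" for x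
  proof -
    have "(\<integral>y. half_kernel y x * (f y * g x) \<partial>M) = (\<integral>y. (half_kernel y x * f y) * g x \<partial>M)"
      "(\<integral>y. half_kernel y x * (f x * g y) \<partial>M) = (\<integral>y. f x * (half_kernel y x * g y) \<partial>M)"
      by (simp_all add: mult_ac)
    then show ?thesis
      by (simp only: F_def G_def integral_mult_left_zero integral_mult_right_zero) (simp add: algebra_simps)
  qed
  show "integrable M (\<lambda>x. f x * G x + F x * g x)"
    unfolding eq using f g one(1) two(1) by (intro Bochner_Integration.integrable_add) auto
  show "(\<integral>x. f x * G x + F x * g x \<partial>M) = (\<alpha> + (\<integral>x. f x \<partial>M)) * (\<beta> + (\<integral>x. g x \<partial>M)) - \<alpha> * \<beta>"
    unfolding eq using f g one(1) two(1) sum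
    by (simp add: algebra_simps)
qed

text \<open>A right limit at a point between \<open>c\<close> and \<open>y\<close> is a limit of values at points that still lie to
  the left of \<open>y\<close>, so any closed ball around \<open>l\<close> that contains these values contains it as well.\<close>

lemma tendsto_right_limits_at_left:
  fixes u :: "real \<Rightarrow> 'v::real_normed_vector"
  assumes u: "(u \<longlongrightarrow> l) (at_left y)" and R: "\<And>x. c < x \<Longrightarrow> x < y \<Longrightarrow> (u \<longlongrightarrow> R x) (at_right x)" and "c < y"
  shows "(R \<longlongrightarrow> l) (at_left y)"
proof (rule tendstoI)
  fix e :: real assume "0 < e"
  then have "\<forall>\<^sub>F x in at_left y. dist (u x) l < e / 2"
    using tendstoD[OF u, of "e / 2"] by simp
  then obtain z where z: "z < y" "\<And>x. z < x \<Longrightarrow> x < y \<Longrightarrow> dist (u x) l < e / 2"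
    unfolding eventually_at_left[OF \<open>c < y\<close>] by blast
  have "dist (R x) l < e" if "max c z < x" "x < y" for x
  proof -
    have "\<forall>\<^sub>F s in at_right x. dist (u s) l \<le> e / 2"
      unfolding eventually_at_right[OF that(2)]
    proof (intro exI[of _ y] conjI allI impI)
      fix s assume "x < s" "s < y"
      then show "dist (u s) l \<le> e / 2" using z(2)[of s] that by simp
    qed (use that in simp)
    moreover have "((\<lambda>s. dist (u s) l) \<longlongrightarrow> dist (R x) l) (at_right x)"
      using that by (intro tendsto_intros R) auto
    ultimately have "dist (R x) l \<le> e / 2"
      using tendsto_upperbound trivial_limit_at_right_real by blast
    then show ?thesis using \<open>0 < e\<close> by simp
  qed
  then show "\<forall>\<^sub>F x in at_left y. dist (R x) l < e"
    unfolding eventually_at_left[OF \<open>c < y\<close>] using \<open>c < y\<close> z(1) by (intro exI[of _ "max c z"]) auto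
qed

text \<open>The right limit at \<open>y\<close> is obtained from the measure of \<open>(c, y]\<close>, the left limit from that of
  \<open>(c, y)\<close>, and the value of a balanced function is their average.\<close>
lemma balanced_value:
  fixes u H :: "real \<Rightarrow> 'v::euclidean_space"
  assumes "balanced a b u" and sets_\<kappa>: "sets \<kappa> = sets (restrict_space borel (einterval a b))"
    and H: "H \<in> borel_measurable \<kappa>"
    and int: "\<And>c d. {c..d} \<subseteq> einterval a b \<Longrightarrow> set_integrable \<kappa> {c<..d} H"
    and incr: "\<And>c d. {c..d} \<subseteq> einterval a b \<Longrightarrow> c \<le> d \<Longrightarrow> (LINT x:{c<..d}|\<kappa>. H x) = R d - R c"
    and R: "\<And>x. x \<in> einterval a b \<Longrightarrow> (u \<longlongrightarrow> R x) (at_right x)"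
    and cy: "{c..y} \<subseteq> einterval a b" "c < y"
  shows "u y = R c + (1/2) *\<^sub>R ((LINT x:{c<..<y}|\<kappa>. H x) + (LINT x:{c<..y}|\<kappa>. H x))"
proof -
  let ?E = "einterval a b"
  have y: "y \<in> ?E" using cy by auto
  obtain l r where lr: "(u \<longlongrightarrow> l) (at_left y)" "(u \<longlongrightarrow> r) (at_right y)" "u y = (1/2) *\<^sub>R (l + r)"
    using assms(1) y unfolding balanced_def by blast
  have r: "r = R y"
    using tendsto_unique[OF trivial_limit_at_right_real lr(2) R[OF y]] .
  have "(R \<longlongrightarrow> l) (at_left y)"
    using cy by (intro tendsto_right_limits_at_left[OF lr(1) R, of c]) auto
  moreover define s where "s = (\<lambda>m::nat. y - (y - c) / real (Suc m))"
  have s_less: "c \<le> s m" "s m < y" for m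
  proof -
    have "(y - c) / real (Suc m) \<le> (y - c) / 1"
      using cy(2) by (intro divide_left_mono) auto
    then show "c \<le> s m" unfolding s_def by simp
    show "s m < y" using cy(2) by (simp add: s_def)
  qed
  have s_lim: "s \<longlonglongrightarrow> y"
    unfolding s_def using tendsto_diff[OF tendsto_const[of y] LIMSEQ_Suc[OF lim_const_over_n[of "y - c"]]] by simp
  then have "filterlim s (at_left y) sequentially"
    unfolding filterlim_at using s_less by (auto simp: less_imp_neq)
  ultimately have "(\<lambda>m. R (s m)) \<longlonglongrightarrow> l" by (rule filterlim_compose)
  moreover have "(\<lambda>m. R (s m)) \<longlonglongrightarrow> R c + (LINT x:{c<..<y}|\<kappa>. H x)"
  proof -
    have sub: "{c..s m} \<subseteq> ?E" for m using cy(1) s_less(2)[of m] by auto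
    note [measurable] = H sets_restrict_einterval_Ioc[OF cy(1), folded sets_\<kappa>] sets_restrict_einterval_Ioc[OF sub, folded sets_\<kappa>]
    have "(\<lambda>m. \<integral>x. indicator {c<..s m} x *\<^sub>R H x \<partial>\<kappa>) \<longlonglongrightarrow> (\<integral>x. indicator {c<..<y} x *\<^sub>R H x \<partial>\<kappa>)"
    proof (rule integral_dominated_convergence)
      show "integrable \<kappa> (\<lambda>x. norm (indicator {c<..y} x *\<^sub>R H x))"
        using int[OF cy(1)] unfolding set_integrable_def by (rule integrable_norm)
      show "AE x in \<kappa>. norm (indicator {c<..s m} x *\<^sub>R H x) \<le> norm (indicator {c<..y} x *\<^sub>R H x)" for m
        using s_less(2)[of m] by (auto intro!: AE_I2 simp: indicator_def)
      have "(\<lambda>m. indicator {c<..s m} x *\<^sub>R H x) \<longlonglongrightarrow> indicator {c<..<y} x *\<^sub>R H x" for x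
      proof (rule tendsto_eventually)
        show "\<forall>\<^sub>F m in sequentially. indicator {c<..s m} x *\<^sub>R H x = indicator {c<..<y} x *\<^sub>R H x"
        proof (cases "x < y")
          case True
          show ?thesis
            using order_tendstoD(1)[OF s_lim True] by (rule eventually_mono) (use True in \<open>auto simp: indicator_def\<close>)
        next
          case False
          then have "s m < x" for m using s_less(2)[of m] by simp
          then show ?thesis using False by (auto simp: indicator_def not_le)
        qed
      qed
      then show "AE x in \<kappa>. (\<lambda>m. indicator {c<..s m} x *\<^sub>R H x) \<longlonglongrightarrow> indicator {c<..<y} x *\<^sub>R H x" by simp
    qed measurable
    moreover have "R (s m) = R c + (\<integral>x. indicator {c<..s m} x *\<^sub>R H x \<partial>\<kappa>)" for m
      using incr[OF sub s_less(1), of m] by (simp add: set_lebesgue_integral_def algebra_simps)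
    ultimately show ?thesis
      by (simp only: set_lebesgue_integral_def) (intro tendsto_intros)
  qed
  ultimately have "l = R c + (LINT x:{c<..<y}|\<kappa>. H x)"
    by (rule LIMSEQ_unique)
  moreover have "R y = R c + (LINT x:{c<..y}|\<kappa>. H x)"
    using incr[OF cy(1)] cy(2) by simp
  ultimately show ?thesis
    using lr(3) r by (simp add: algebra_simps scaleR_add_left[symmetric])
qed

section \<open>Hermitian and non-negative matrices\<close>

definition sesq :: "complex^'n^'n \<Rightarrow> complex^'n \<Rightarrow> complex^'n \<Rightarrow> complex"
  where "sesq A x y = (\<Sum>i\<in>UNIV. cnj (x $ i) * (A *v y) $ i)"

lemma quad_form_eq_sesq: "quad_form A x = sesq A x x"
  by (simp add: quad_form_def sesq_def)

lemma sesq_add_left: "sesq A (x + y) z = sesq A x z + sesq A y z"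
  and sesq_add_right: "sesq A x (y + z) = sesq A x y + sesq A x z"
  and sesq_diff_left: "sesq A (x - y) z = sesq A x z - sesq A y z"
  and sesq_diff_right: "sesq A x (y - z) = sesq A x y - sesq A x z"
  and sesq_scale_left: "sesq A (c *s x) y = cnj c * sesq A x y"
  and sesq_scale_right: "sesq A x (c *s y) = c * sesq A x y"
  by (simp_all add: sesq_def matrix_vector_right_distrib matrix_vector_mult_diff_distrib vector_scalar_commute
      algebra_simps sum.distrib sum_subtractf sum_distrib_left)

lemma sesq_eq_sum: "sesq A x y = (\<Sum>i\<in>UNIV. \<Sum>j\<in>UNIV. cnj (x $ i) * A $ i $ j * y $ j)"
  by (simp add: sesq_def matrix_vector_mult_def sum_distrib_left mult.assoc)

lemma sesq_cnj_hermitian: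
  assumes "hermitian A"
  shows "sesq A y x = cnj (sesq A x y)"
proof -
  have h: "cnj (A $ i $ j) = A $ j $ i" for i j
    using arg_cong[OF assms[unfolded hermitian_def], of "\<lambda>B. B $ j $ i"] by (simp add: adjoint_matrix_def)
  have "cnj (sesq A x y) = (\<Sum>i\<in>UNIV. \<Sum>j\<in>UNIV. cnj (y $ j) * A $ j $ i * x $ i)"
    by (simp add: sesq_eq_sum h mult_ac)
  also have "\<dots> = sesq A y x" unfolding sesq_eq_sum by (rule sum.swap)
  finally show ?thesis ..
qed

lemma sesq_cnj_skew_hermitian:
  assumes "skew_hermitian A"
  shows "sesq A y x = - cnj (sesq A x y)"
proof -
  have h: "cnj (A $ i $ j) = - A $ j $ i" for i j
    using arg_cong[OF assms[unfolded skew_hermitian_def], of "\<lambda>B. B $ j $ i"] by (simp add: adjoint_matrix_def)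
  have "- cnj (sesq A x y) = (\<Sum>i\<in>UNIV. \<Sum>j\<in>UNIV. cnj (y $ j) * A $ j $ i * x $ i)"
    by (simp add: sesq_eq_sum h mult_ac sum_negf)
  also have "\<dots> = sesq A y x" unfolding sesq_eq_sum by (rule sum.swap)
  finally show ?thesis ..
qed

lemma quad_form_hermitian_real: "hermitian A \<Longrightarrow> Im (quad_form A x) = 0"
  using sesq_cnj_hermitian[of A x x] by (simp add: quad_form_eq_sesq complex_eq_iff)

text \<open>Polarization: the quadratic form is real at \<open>x + y\<close> and at \<open>x + \<i> y\<close>.\<close>
lemma nonneg_matrix_hermitian_form:
  assumes "nonneg_matrix A"
  shows "sesq A y x = cnj (sesq A x y)"
proof -
  have *: "Im (sesq A z z) = 0" for z
    using assms unfolding nonneg_matrix_def quad_form_eq_sesq by blast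
  have "Im (sesq A x y + sesq A y x) = 0"
    using *[of "x + y"] *[of x] *[of y] by (simp add: sesq_add_left sesq_add_right)
  moreover have "Im (sesq A x (\<i> *s y) + sesq A (\<i> *s y) x) = 0"
    using *[of "x + \<i> *s y"] *[of x] *[of "\<i> *s y"] by (simp add: sesq_add_left sesq_add_right)
  ultimately show ?thesis by (simp add: complex_eq_iff sesq_scale_left sesq_scale_right)
qed

text \<open>The variation of the quadratic form at \<open>x\<close> in the direction \<open>- A x\<close> would make it negative
  if \<open>A x\<close> did not vanish.\<close>

lemma nonneg_matrix_kernel:
  assumes "nonneg_matrix A" "Re (quad_form A x) = 0"
  shows "A *v x = 0"
proof -
  let ?y = "A *v x"
  define n where "n = (\<Sum>i\<in>UNIV. (cmod (?y $ i))\<^sup>2)"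
  define q where "q = Re (sesq A ?y ?y)"
  have yx: "sesq A ?y x = of_real n"
    unfolding sesq_def n_def of_real_sum
    by (intro sum.cong refl) (metis complex_norm_square mult.commute)
  have "0 \<le> q * t\<^sup>2 - 2 * n * t" for t :: real
  proof -
    have "0 \<le> Re (sesq A (x - of_real t *s ?y) (x - of_real t *s ?y))"
      using assms(1) unfolding nonneg_matrix_def quad_form_eq_sesq by blast
    also have "\<dots> = Re (sesq A x x) - 2 * n * t + q * t\<^sup>2"
      using yx nonneg_matrix_hermitian_form[OF assms(1), of x ?y]
      by (simp add: sesq_diff_left sesq_diff_right sesq_scale_left sesq_scale_right q_def power2_eq_square algebra_simps)
    finally show ?thesis using assms(2) by (simp add: quad_form_eq_sesq)
  qed
  note pos = this
  \<comment> \<open>Any small positive multiple of \<open>n\<close> would do; this one makes the quadratic term harmless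
     whatever the size of \<open>q\<close> is.\<close>
  define s where "s = n / (\<bar>q\<bar> + 1)"
  have n_s: "n = s * (\<bar>q\<bar> + 1)"
    by (simp add: s_def add_nonneg_eq_0_iff)
  have "0 \<le> q * s\<^sup>2 - 2 * (s * (\<bar>q\<bar> + 1)) * s"
    using pos[of s] n_s by simp
  also have "\<dots> = s\<^sup>2 * (q - 2 * (\<bar>q\<bar> + 1))"
    by (simp add: algebra_simps power2_eq_square)
  finally have "0 \<le> s\<^sup>2 * (q - 2 * (\<bar>q\<bar> + 1))" .
  moreover have "q - 2 * (\<bar>q\<bar> + 1) < 0" using abs_ge_self[of q] abs_ge_zero[of q] by argo
  ultimately have "s = 0"
    by (auto simp: zero_le_mult_iff)
  then have "n = 0" using n_s by simp
  then have "\<forall>i\<in>UNIV. (cmod (?y $ i))\<^sup>2 = 0"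
    using sum_nonneg_eq_0_iff[of UNIV "\<lambda>i. (cmod (?y $ i))\<^sup>2"] by (simp add: n_def)
  then show ?thesis by (simp add: vec_eq_iff)
qed

lemma nonneg_matrix_quad_form_zero_iff:
  assumes "nonneg_matrix A"
  shows "Re (quad_form A x) = 0 \<longleftrightarrow> A *v x = 0"
  using nonneg_matrix_kernel[OF assms] by (auto simp: quad_form_def)

text \<open>By the parallelogram identity.\<close>
lemma quad_form_add_le:
  assumes "nonneg_matrix A"
  shows "Re (quad_form A (x + y)) \<le> 2 * Re (quad_form A x) + 2 * Re (quad_form A y)"
proof -
  have "quad_form A (x + y) + quad_form A (x - y) = 2 * quad_form A x + 2 * quad_form A y"
    by (simp add: quad_form_eq_sesq sesq_add_left sesq_add_right sesq_diff_left sesq_diff_right)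
  from arg_cong[OF this, of Re]
  have "Re (quad_form A (x + y)) + Re (quad_form A (x - y)) = 2 * Re (quad_form A x) + 2 * Re (quad_form A y)"
    by simp
  moreover have "0 \<le> Re (quad_form A (x - y))" using assms by (simp add: nonneg_matrix_def)
  ultimately show ?thesis by linarith
qed

lemma quad_form_scale: "quad_form A (c *s x) = of_real ((cmod c)\<^sup>2) * quad_form A x"
  unfolding complex_norm_square by (simp add: quad_form_eq_sesq sesq_scale_left sesq_scale_right)

lemma bilinear_matrix_vector_mult: "bilinear ((*v) :: complex^'n^'m \<Rightarrow> complex^'n \<Rightarrow> complex^'m)"
  unfolding bilinear_def
  by (auto intro!: linearI simp: matrix_vector_right_distrib matrix_vector_mult_add_rdistrib
      matrix_vector_mult_def vec_eq_iff scaleR_sum_right distrib_right sum.distrib)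

lemma bounded_bilinear_matrix_vector_mult:
  "bounded_bilinear ((*v) :: complex^'n^'m \<Rightarrow> complex^'n \<Rightarrow> complex^'m)"
  using bilinear_matrix_vector_mult by (simp add: bilinear_conv_bounded_bilinear)

lemma borel_measurable_matrix_vector_mult[measurable (raw)]:
  fixes A :: "'a \<Rightarrow> complex^'n^'m"
  assumes "A \<in> borel_measurable M" "v \<in> borel_measurable M"
  shows "(\<lambda>x. A x *v v x) \<in> borel_measurable M"
  by (rule borel_measurable_continuous_Pair[OF assms])
    (intro bounded_bilinear.continuous_on[OF bounded_bilinear_matrix_vector_mult] continuous_intros)

lemma borel_measurable_quad_form[measurable (raw)]:
  fixes A :: "'a \<Rightarrow> complex^'n^'n"
  assumes "A \<in> borel_measurable M" "v \<in> borel_measurable M"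
  shows "(\<lambda>x. quad_form (A x) (v x)) \<in> borel_measurable M"
proof -
  have nth: "(\<lambda>x. g x $ i) \<in> borel_measurable M" if "g \<in> borel_measurable M" for g :: "'a \<Rightarrow> complex^'n" and i
    using measurable_compose[OF that borel_measurable_continuous_onI[of "\<lambda>v. v $ i"]]
    by (simp add: continuous_intros)
  have "(\<lambda>x. cnj (v x $ i)) \<in> borel_measurable M" for i
    using measurable_compose[OF nth[OF assms(2)] borel_measurable_continuous_onI[of cnj]]
    by (simp add: continuous_intros)
  then show ?thesis
    unfolding quad_form_def
    by (intro borel_measurable_sum borel_measurable_times nth borel_measurable_matrix_vector_mult assms)
qed

lemma set_integrable_matrix_vector_mult:
  fixes A :: "real \<Rightarrow> complex^'n^'n"
  assumes A: "A \<in> borel_measurable M" and v: "v \<in> borel_measurable M" and S: "S \<in> sets M"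
    and int: "set_integrable M S A" and bound: "\<And>x. x \<in> S \<Longrightarrow> norm (v x) \<le> B"
  shows "set_integrable M S (\<lambda>x. A x *v v x)"
proof -
  obtain K where K: "\<And>A x. norm ((A :: complex^'n^'n) *v x) \<le> norm A * norm x * K" "0 < K"
    using bounded_bilinear.pos_bounded[OF bounded_bilinear_matrix_vector_mult] by metis
  show ?thesis
    unfolding set_integrable_def
  proof (rule Bochner_Integration.integrable_bound)
    show "integrable M (\<lambda>x. (\<bar>B\<bar> * K) *\<^sub>R (indicator S x *\<^sub>R A x))"
      using int unfolding set_integrable_def by (intro integrable_scaleR_right)
    show "(\<lambda>x. indicator S x *\<^sub>R (A x *v v x)) \<in> borel_measurable M"
      using A v S by measurable
    show "AE x in M. norm (indicator S x *\<^sub>R (A x *v v x)) \<le> norm ((\<bar>B\<bar> * K) *\<^sub>R (indicator S x *\<^sub>R A x))"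
    proof (rule AE_I2)
      fix x
      show "norm (indicator S x *\<^sub>R (A x *v v x)) \<le> norm ((\<bar>B\<bar> * K) *\<^sub>R (indicator S x *\<^sub>R A x))"
      proof (cases "x \<in> S")
        case True
        have "norm (A x *v v x) \<le> norm (A x) * norm (v x) * K" by (rule K)
        also have "\<dots> \<le> norm (A x) * \<bar>B\<bar> * K"
          using bound[OF True] K(2) by (intro mult_right_mono mult_left_mono) auto
        finally show ?thesis using True K(2) by (simp add: abs_mult mult_ac)
      qed simp
    qed
  qed
qed

lemma locally_bv_bounded:
  assumes "locally_bv a b u" "{c..d} \<subseteq> einterval a b"
  shows "\<exists>B. \<forall>x\<in>{c..d}. norm (u x) \<le> B"
proof -
  have "bounded_variation_on {c..d} u" using assms unfolding locally_bv_def by blast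
  then obtain B where B: "\<forall>(m::nat) t. (\<forall>i\<le>m. t i \<in> {c..d}) \<and> (\<forall>i<m. t i \<le> t (Suc i)) \<longrightarrow>
       (\<Sum>i<m. norm (u (t (Suc i)) - u (t i))) \<le> B"
    unfolding bounded_variation_on_def ..
  have "norm (u x) \<le> B + norm (u c)" if "x \<in> {c..d}" for x
  proof -
    have "(\<Sum>i<1::nat. norm (u ((\<lambda>i. if i = 0 then c else x) (Suc i)) - u ((\<lambda>i. if i = 0 then c else x) i))) \<le> B"
      by (rule B[rule_format]) (use that in auto)
    then have "norm (u x - u c) \<le> B" by simp
    then show ?thesis using norm_triangle_sub[of "u x" "u c"] by linarith
  qed
  then show ?thesis by blast
qed

section \<open>Representing measures of distributions of order zero\<close>

lemma linear_bounded_linear: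
  fixes T :: "'v::euclidean_space \<Rightarrow> 'w::real_normed_vector"
  shows "linear T \<Longrightarrow> bounded_linear T"
  by (simp add: linear_conv_bounded_linear)

text \<open>The choice in the definition of \<^const>\<open>rep\<close> is justified by \<open>bv_representation\<close>, applied to
  a function whose derivative is the distribution.\<close>
lemma order_zero_represents_rep:
  fixes T :: "('v::euclidean_space) dist"
  assumes "a < b" "order_zero a b T"
  shows "represents a b T (rep_measure a b T) (rep_density a b T)"
proof -
  obtain U where U: "locally_bv a b U" "\<And>\<phi>. \<phi> \<in> test_functions a b \<Longrightarrow> T \<phi> = dist_deriv a b U \<phi>"
    using assms(2) unfolding order_zero_def by blast
  obtain \<mu> H R where \<mu>: "sets \<mu> = sets (restrict_space borel (einterval a b))"
    "H \<in> borel_measurable \<mu>"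
    "U \<in> borel_measurable (restrict_space borel (einterval a b))"
    "\<And>c d. {c..d} \<subseteq> einterval a b \<Longrightarrow> emeasure \<mu> {c<..d} < \<infinity>"
    "\<And>c d. {c..d} \<subseteq> einterval a b \<Longrightarrow> set_integrable \<mu> {c<..d} H"
    "\<And>c d. {c..d} \<subseteq> einterval a b \<Longrightarrow> c \<le> d \<Longrightarrow> (LINT x:{c<..d}|\<mu>. H x) = R d - R c"
    "\<And>x. x \<in> einterval a b \<Longrightarrow> (U \<longlongrightarrow> R x) (at_right x)"
    "\<And>\<phi>. \<phi> \<in> test_functions a b \<Longrightarrow> set_integrable lborel (einterval a b) (\<lambda>x. deriv \<phi> x *\<^sub>R U x)"
    "\<And>\<phi>. \<phi> \<in> test_functions a b \<Longrightarrow> dist_deriv a b U \<phi> = (LINT x|\<mu>. \<phi> x *\<^sub>R H x)"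
    by (rule bv_representation[OF assms(1) U(1)], rule that) assumption+
  have "emeasure \<mu> K < \<infinity> \<and> set_integrable \<mu> K H" if K: "compact K" "K \<subseteq> einterval a b" for K
  proof -
    obtain c d where cd: "K \<subseteq> {c<..<d}" "{c..d} \<subseteq> einterval a b"
      using compact_subset_einterval[OF assms(1) K] by metis
    have "K \<in> sets \<mu>"
      using K borel_closed[OF compact_imp_closed[OF K(1)]] by (simp add: \<mu>(1) sets_restrict_space_iff)
    moreover have "K \<subseteq> {c<..d}" using cd(1) by auto
    moreover have "{c<..d} \<in> sets \<mu>" using sets_restrict_einterval_Ioc(1)[OF cd(2)] \<mu>(1) by simp
    ultimately show ?thesis
      using \<mu>(4,5)[OF cd(2)] emeasure_mono[of K "{c<..d}" \<mu>] set_integrable_subset[of \<mu> "{c<..d}" H K]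
      by (auto simp: less_top[symmetric] top_unique)
  qed
  then have "represents a b T \<mu> H"
    unfolding represents_def using \<mu>(1,2,9) U(2) by auto
  then have "\<exists>p. case p of (\<mu>, H) \<Rightarrow> represents a b T \<mu> H"
    by (intro exI[of _ "(\<mu>, H)"]) (simp only: prod.case)
  then have "case rep a b T of (\<mu>, H) \<Rightarrow> represents a b T \<mu> H"
    unfolding rep_def by (rule someI_ex)
  then show ?thesis by (simp only: split_beta)
qed

lemma represents_Icc:
  assumes "represents a b T \<mu> H" "{c..d} \<subseteq> einterval a b"
  shows "emeasure \<mu> {c..d} < \<infinity>" "set_integrable \<mu> {c..d} H"
proof -
  have "\<forall>K. compact K \<and> K \<subseteq> einterval a b \<longrightarrow> emeasure \<mu> K < \<infinity> \<and> set_integrable \<mu> K H"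
    using assms(1) unfolding represents_def by (elim conjE)
  from this[rule_format, of "{c..d}"] assms(2)
  show "emeasure \<mu> {c..d} < \<infinity>" "set_integrable \<mu> {c..d} H" by auto
qed

lemma represents_sets:
  assumes "represents a b T \<mu> H"
  shows "sets \<mu> = sets (restrict_space borel (einterval a b))" "space \<mu> = einterval a b"
    "H \<in> borel_measurable \<mu>"
proof -
  show 1: "sets \<mu> = sets (restrict_space borel (einterval a b))"
    using assms unfolding represents_def by (rule conjunct1)
  show "H \<in> borel_measurable \<mu>"
    using assms unfolding represents_def by (elim conjE)
  show "space \<mu> = einterval a b"
    using sets_eq_imp_space_eq[OF 1] by (simp add: space_restrict_space)
qed

lemma test_function_times_integrable:
  fixes g :: "real \<Rightarrow> 'v::euclidean_space"
  assumes "a < b" "sets \<mu> = sets (restrict_space borel (einterval a b))" "g \<in> borel_measurable \<mu>"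
    "\<And>c d. {c..d} \<subseteq> einterval a b \<Longrightarrow> set_integrable \<mu> {c..d} g" "\<phi> \<in> test_functions a b"
  shows "integrable \<mu> (\<lambda>x. \<phi> x *\<^sub>R g x)"
proof -
  obtain c d where cd: "{c..d} \<subseteq> einterval a b" "\<And>x. x \<notin> {c<..<d} \<Longrightarrow> \<phi> x = 0"
    using test_function_support[OF assms(1,5)] by metis
  obtain B where B: "\<And>x. \<bar>\<phi> x\<bar> \<le> B"
    using continuous_compact_support_bounded[of \<phi> c d] test_function_continuous(1)[OF assms(5)] cd(2) by blast
  have \<phi>_meas: "\<phi> \<in> borel_measurable \<mu>"
    using test_function_continuous(1)[OF assms(5), of UNIV]
    by (intro measurable_restrict_einterval[OF assms(2)] borel_measurable_continuous_onI)
  show ?thesis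
  proof (rule Bochner_Integration.integrable_bound)
    show "integrable \<mu> (\<lambda>x. B *\<^sub>R (indicator {c..d} x *\<^sub>R g x))"
      using assms(4)[OF cd(1)] unfolding set_integrable_def by (intro integrable_scaleR_right)
    show "(\<lambda>x. \<phi> x *\<^sub>R g x) \<in> borel_measurable \<mu>"
      using \<phi>_meas assms(3) by measurable
    show "AE x in \<mu>. norm (\<phi> x *\<^sub>R g x) \<le> norm (B *\<^sub>R (indicator {c..d} x *\<^sub>R g x))"
    proof (rule AE_I2)
      fix x
      have "\<bar>\<phi> x\<bar> \<le> \<bar>B\<bar>" using B[of x] by linarith
      then show "norm (\<phi> x *\<^sub>R g x) \<le> norm (B *\<^sub>R (indicator {c..d} x *\<^sub>R g x))"
        using cd(2)[of x] by (cases "x \<in> {c<..<d}") (auto intro: mult_right_mono)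
    qed
  qed
qed

lemma AE_zero_if_test_zero:
  fixes g :: "real \<Rightarrow> 'v::euclidean_space"
  assumes "a < b" and sets_\<mu>: "sets \<mu> = sets (restrict_space borel (einterval a b))"
    and g: "g \<in> borel_measurable \<mu>"
    and g_int: "\<And>c d. {c..d} \<subseteq> einterval a b \<Longrightarrow> set_integrable \<mu> {c..d} g"
    and zero: "\<And>\<phi>. \<phi> \<in> test_functions a b \<Longrightarrow> (LINT x|\<mu>. \<phi> x *\<^sub>R g x) = 0"
  shows "AE x in \<mu>. g x = 0"
proof -
  have nonneg: "AE x in \<mu>. 0 \<le> g x \<bullet> v" for v
  proof (rule AE_nonneg_if_test_nonneg[OF assms(1,2)])
    show "(\<lambda>x. g x \<bullet> v) \<in> borel_measurable \<mu>" using g by measurable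
    show "set_integrable \<mu> {c..d} (\<lambda>x. g x \<bullet> v)" if "{c..d} \<subseteq> einterval a b" for c d
      using integrable_inner_left[OF g_int[OF that, unfolded set_integrable_def], of v] by (simp add: set_integrable_def)
    show "0 \<le> (LINT x|\<mu>. \<phi> x * (g x \<bullet> v))" if "\<phi> \<in> test_functions a b" for \<phi>
      using integral_inner_left[OF test_function_times_integrable[OF assms(1,2) g g_int that], of v] zero[OF that] by simp
  qed
  have "AE x in \<mu>. \<forall>i\<in>Basis. g x \<bullet> i = 0"
  proof (rule AE_finite_allI)
    fix i :: 'v
    show "AE x in \<mu>. g x \<bullet> i = 0"
      using nonneg[of i] nonneg[of "- i"] by eventually_elim simp
  qed simp
  then show ?thesis
    by eventually_elim (simp add: euclidean_all_zero_iff)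
qed

locale canonical_system =
  fixes a b :: ereal and J :: "complex^'n^'n" and q w :: "(complex^'n^'n) dist"
  assumes interval: "a < b"
    and J: "skew_hermitian J"
    and q: "order_zero a b q" "hermitian_dist a b q"
    and w: "order_zero a b w" "nonneg_dist a b w"
begin

abbreviation E where "E \<equiv> einterval a b"
abbreviation \<mu>w where "\<mu>w \<equiv> rep_measure a b w"
abbreviation W where "W \<equiv> rep_density a b w"
abbreviation \<mu>q where "\<mu>q \<equiv> rep_measure a b q"
abbreviation Q where "Q \<equiv> rep_density a b q"

lemmas w_rep = order_zero_represents_rep[OF interval w(1)]
lemmas q_rep = order_zero_represents_rep[OF interval q(1)]
lemmas w_sets = represents_sets[OF w_rep] and q_sets = represents_sets[OF q_rep]
lemmas w_Icc = represents_Icc[OF w_rep] and q_Icc = represents_Icc[OF q_rep]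

lemma represents_test:
  "represents a b t \<mu> H \<Longrightarrow> \<phi> \<in> test_functions a b \<Longrightarrow> t \<phi> = (LINT x|\<mu>. \<phi> x *\<^sub>R H x)"
  unfolding represents_def by (elim conjE) (erule (1) bspec)

lemma linear_image_of_representation:
  fixes T :: "complex^'n^'n \<Rightarrow> 'v::euclidean_space"
  assumes T: "linear T" and rep: "represents a b t \<mu> H"
  shows "(\<lambda>x. T (H x)) \<in> borel_measurable \<mu>"
    "{c..d} \<subseteq> E \<Longrightarrow> set_integrable \<mu> {c..d} (\<lambda>x. T (H x))"
    "\<phi> \<in> test_functions a b \<Longrightarrow> (LINT x|\<mu>. \<phi> x *\<^sub>R T (H x)) = T (t \<phi>)"
proof -
  note T' = linear_bounded_linear[OF T]
  note sets = represents_sets[OF rep]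
  show "(\<lambda>x. T (H x)) \<in> borel_measurable \<mu>"
    using measurable_compose[OF sets(3) borel_measurable_continuous_onI[OF linear_continuous_on[OF T']]] .
  show "set_integrable \<mu> {c..d} (\<lambda>x. T (H x))" if "{c..d} \<subseteq> E" for c d
    using integrable_bounded_linear[OF T' represents_Icc(2)[OF rep that, unfolded set_integrable_def]]
    by (simp add: set_integrable_def linear_scale[OF T])
  show "(LINT x|\<mu>. \<phi> x *\<^sub>R T (H x)) = T (t \<phi>)" if \<phi>: "\<phi> \<in> test_functions a b" for \<phi>
  proof -
    note represents_test[OF rep \<phi>]
    then show ?thesis
      using integral_bounded_linear[OF T' test_function_times_integrable[OF interval sets(1,3) represents_Icc(2)[OF rep] \<phi>]]
      by (simp add: linear_scale[OF T])
  qed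
qed

lemma linear_quad_form: "linear (\<lambda>A :: complex^'n^'n. quad_form A x)"
  by (auto intro!: linearI simp: quad_form_eq_sesq sesq_eq_sum algebra_simps sum.distrib scaleR_sum_right)

text \<open>For a fixed vector the quadratic form of the density is non-negative almost everywhere. The
  exceptional set depends on the vector, so vectors from a countable dense set are used, and
  continuity does the rest.\<close>
lemma W_nonneg: "AE x in \<mu>w. nonneg_matrix (W x)"
proof -
  have re: "linear (\<lambda>A :: complex^'n^'n. Re (quad_form A x))" "linear (\<lambda>A :: complex^'n^'n. Im (quad_form A x))" for x
    by (auto intro!: linearI simp: linear_add[OF linear_quad_form] linear_scale[OF linear_quad_form])
  have 1: "AE x in \<mu>w. 0 \<le> Re (quad_form (W x) \<xi>)" for \<xi>
  proof (rule AE_nonneg_if_test_nonneg[OF interval w_sets(1)])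
    fix \<phi> assume \<phi>: "\<phi> \<in> test_functions a b" "\<And>x. 0 \<le> \<phi> x"
    then have "0 \<le> Re (quad_form (w \<phi>) \<xi>)"
      using w(2) unfolding nonneg_dist_def nonneg_matrix_def by blast
    then show "0 \<le> (LINT x|\<mu>w. \<phi> x * Re (quad_form (W x) \<xi>))"
      using linear_image_of_representation(3)[OF re(1) w_rep \<phi>(1)] by simp
  qed (use linear_image_of_representation(1,2)[OF re(1) w_rep] in auto)
  have im: "AE x in \<mu>w. 0 \<le> s * Im (quad_form (W x) \<xi>)" for s \<xi>
  proof (rule AE_nonneg_if_test_nonneg[OF interval w_sets(1)])
    have s: "linear (\<lambda>A :: complex^'n^'n. s * Im (quad_form A \<xi>))"
      using linear_compose_scale_right[OF re(2), of s \<xi>] by simp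
    fix \<phi> assume \<phi>: "\<phi> \<in> test_functions a b" "\<And>x. 0 \<le> \<phi> x"
    then have "Im (quad_form (w \<phi>) \<xi>) = 0"
      using w(2) unfolding nonneg_dist_def nonneg_matrix_def by blast
    then show "0 \<le> (LINT x|\<mu>w. \<phi> x * (s * Im (quad_form (W x) \<xi>)))"
      using linear_image_of_representation(3)[OF s w_rep \<phi>(1)] by simp
  next
    have s: "linear (\<lambda>A :: complex^'n^'n. s * Im (quad_form A \<xi>))"
      using linear_compose_scale_right[OF re(2), of s \<xi>] by simp
    show "(\<lambda>x. s * Im (quad_form (W x) \<xi>)) \<in> borel_measurable \<mu>w"
      by (rule linear_image_of_representation(1)[OF s w_rep])
    show "set_integrable \<mu>w {c..d} (\<lambda>x. s * Im (quad_form (W x) \<xi>))" if "{c..d} \<subseteq> E" for c d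
      by (rule linear_image_of_representation(2)[OF s w_rep that])
  qed
  have 2: "AE x in \<mu>w. Im (quad_form (W x) \<xi>) = 0" for \<xi>
    using im[of 1 \<xi>] im[of "-1" \<xi>] by eventually_elim simp
  obtain D :: "(complex^'n) set" where D: "countable D" "D \<subseteq> UNIV" "UNIV \<subseteq> closure D"
    by (rule separable)
  have "AE x in \<mu>w. \<forall>\<xi>\<in>D. 0 \<le> Re (quad_form (W x) \<xi>) \<and> Im (quad_form (W x) \<xi>) = 0"
    using 1 2 by (subst AE_ball_countable[OF D(1)]) auto
  then show ?thesis
  proof (rule eventually_mono)
    fix x assume x: "\<forall>\<xi>\<in>D. 0 \<le> Re (quad_form (W x) \<xi>) \<and> Im (quad_form (W x) \<xi>) = 0"
    have cont: "continuous_on UNIV (\<lambda>\<xi>. quad_form (W x) \<xi>)"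
      unfolding quad_form_def matrix_vector_mult_def by (auto intro!: continuous_intros)
    have "closed ({\<xi>. 0 \<le> Re (quad_form (W x) \<xi>)} \<inter> {\<xi>. Im (quad_form (W x) \<xi>) = 0})"
      by (intro closed_Int closed_Collect_le closed_Collect_eq continuous_intros cont)
    moreover have "D \<subseteq> {\<xi>. 0 \<le> Re (quad_form (W x) \<xi>)} \<inter> {\<xi>. Im (quad_form (W x) \<xi>) = 0}"
      using x by auto
    ultimately have "UNIV \<subseteq> {\<xi>. 0 \<le> Re (quad_form (W x) \<xi>)} \<inter> {\<xi>. Im (quad_form (W x) \<xi>) = 0}"
      using closure_minimal D(3) by blast
    then show "nonneg_matrix (W x)" unfolding nonneg_matrix_def by blast
  qed
qed

lemma Q_hermitian: "AE x in \<mu>q. hermitian (Q x)"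
proof -
  let ?T = "\<lambda>A :: complex^'n^'n. adjoint_matrix A - A"
  have T: "linear ?T"
    by (auto intro!: linearI simp: adjoint_matrix_def vec_eq_iff algebra_simps)
  have "AE x in \<mu>q. ?T (Q x) = 0"
  proof (rule AE_zero_if_test_zero[OF interval q_sets(1)])
    show "(\<lambda>x. ?T (Q x)) \<in> borel_measurable \<mu>q"
      by (rule linear_image_of_representation(1)[OF T q_rep])
    show "set_integrable \<mu>q {c..d} (\<lambda>x. ?T (Q x))" if "{c..d} \<subseteq> E" for c d
      by (rule linear_image_of_representation(2)[OF T q_rep that])
    show "(LINT x|\<mu>q. \<phi> x *\<^sub>R ?T (Q x)) = 0" if \<phi>: "\<phi> \<in> test_functions a b" for \<phi>
      using linear_image_of_representation(3)[OF T q_rep \<phi>] q(2) \<phi> by (simp add: hermitian_dist_def hermitian_def)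
  qed
  then show ?thesis by eventually_elim (simp add: hermitian_def)
qed

text \<open>An element of the deficiency space for \<open>z\<close> is a pair \<open>([u], [f])\<close> with \<open>[f] = z [u]\<close>. As \<open>f\<close>
  enters the equation only through \<open>w f\<close>, it can be replaced by \<open>z u\<close>.\<close>
definition solution :: "complex \<Rightarrow> (real \<Rightarrow> complex^'n) \<Rightarrow> bool"
  where "solution z u \<longleftrightarrow> u \<in> pre_L2 a b w \<and> u \<in> balanced_bv a b \<and>
    (\<forall>\<phi>\<in>test_functions a b. J *v dist_deriv a b u \<phi> + dist_times a b q u \<phi> = dist_times a b w (\<lambda>x. z *s u x) \<phi>)"

lemma times_locally_bounded_integrable:
  fixes u :: "real \<Rightarrow> complex^'n"
  assumes rep: "represents a b t \<mu> (H :: real \<Rightarrow> complex^'n^'n)" and u: "u \<in> borel_measurable (restrict_space borel E)"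
    and bv: "locally_bv a b u"
  shows "u \<in> borel_measurable \<mu>" "(\<lambda>x. H x *v u x) \<in> borel_measurable \<mu>"
    "{c..d} \<subseteq> E \<Longrightarrow> set_integrable \<mu> {c..d} (\<lambda>x. H x *v u x)"
    "\<phi> \<in> test_functions a b \<Longrightarrow> integrable \<mu> (\<lambda>x. \<phi> x *\<^sub>R (H x *v u x))"
proof -
  note sets = represents_sets[OF rep]
  show u_meas: "u \<in> borel_measurable \<mu>" using u measurable_cong_sets[OF sets(1) refl] by blast
  then show Hu: "(\<lambda>x. H x *v u x) \<in> borel_measurable \<mu>" using sets(3) by measurable
  show int: "set_integrable \<mu> {c..d} (\<lambda>x. H x *v u x)" if cd: "{c..d} \<subseteq> E" for c d
  proof -
    obtain B where "\<forall>x\<in>{c..d}. norm (u x) \<le> B" using locally_bv_bounded[OF bv cd] by blast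
    then show ?thesis
      using sets_restrict_einterval_Ioc(3)[OF cd] sets(1)
      by (intro set_integrable_matrix_vector_mult[OF sets(3) u_meas _ represents_Icc(2)[OF rep cd]]) auto
  qed
  show "integrable \<mu> (\<lambda>x. \<phi> x *\<^sub>R (H x *v u x))" if "\<phi> \<in> test_functions a b" for \<phi>
    by (rule test_function_times_integrable[OF interval sets(1) Hu int that])
qed

end

section \<open>The Lagrange identity\<close>

lemma density_transfer:
  fixes f :: "real \<Rightarrow> 'v::euclidean_space" and k :: "real \<Rightarrow> real"
  assumes "\<nu> = density \<mu> (\<lambda>x. ennreal (k x))" "k \<in> borel_measurable \<mu>" "\<And>x. 0 \<le> k x"
    and "f \<in> borel_measurable \<nu>"
  shows "f \<in> borel_measurable \<mu>"
    and "(\<integral>x. f x \<partial>\<nu>) = (\<integral>x. k x *\<^sub>R f x \<partial>\<mu>)"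
    and "integrable \<nu> f \<longleftrightarrow> integrable \<mu> (\<lambda>x. k x *\<^sub>R f x)"
    and "A \<in> sets \<mu> \<Longrightarrow> set_integrable \<nu> A f \<longleftrightarrow> set_integrable \<mu> A (\<lambda>x. k x *\<^sub>R f x)"
    and "A \<in> sets \<mu> \<Longrightarrow> (LINT x:A|\<nu>. f x) = (LINT x:A|\<mu>. k x *\<^sub>R f x)"
proof -
  show f: "f \<in> borel_measurable \<mu>" using assms(1,4) by simp
  show int: "(\<integral>x. f x \<partial>\<nu>) = (\<integral>x. k x *\<^sub>R f x \<partial>\<mu>)" "integrable \<nu> f \<longleftrightarrow> integrable \<mu> (\<lambda>x. k x *\<^sub>R f x)"
    unfolding assms(1) using f assms(2,3) by (auto simp: integral_density integrable_density)
  assume [measurable]: "A \<in> sets \<mu>"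
  have Af: "(\<lambda>x. indicator A x *\<^sub>R f x) \<in> borel_measurable \<mu>" using f by measurable
  show "set_integrable \<nu> A f \<longleftrightarrow> set_integrable \<mu> A (\<lambda>x. k x *\<^sub>R f x)"
    "(LINT x:A|\<nu>. f x) = (LINT x:A|\<mu>. k x *\<^sub>R f x)"
    unfolding assms(1) set_integrable_def set_lebesgue_integral_def
    using Af assms(2,3) by (simp_all add: integral_density integrable_density mult_ac)
qed

context canonical_system
begin

text \<open>The derivative of \<open>u\<close>, \<open>q\<close> and \<open>w\<close> are expressed by densities with respect to one measure
  \<open>\<mu>\<close>. The difference of the two sides of the equation then is a locally integrable density
  which annihilates all test functions.\<close>
lemma solution_equation_AE:
  assumes u: "solution z u" and \<kappa>: "sets \<kappa> = sets (restrict_space borel E)"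
    and H: "H \<in> borel_measurable \<kappa>" "\<And>c d. {c..d} \<subseteq> E \<Longrightarrow> set_integrable \<kappa> {c..d} H"
    and du: "\<And>\<phi>. \<phi> \<in> test_functions a b \<Longrightarrow> dist_deriv a b u \<phi> = (LINT x|\<kappa>. \<phi> x *\<^sub>R H x)"
    and \<mu>: "sets \<mu> = sets (restrict_space borel E)"
    and k0: "\<kappa> = density \<mu> (\<lambda>x. ennreal (k0 x))" "k0 \<in> borel_measurable \<mu>" "\<And>x. 0 \<le> k0 x"
    and k1: "\<mu>w = density \<mu> (\<lambda>x. ennreal (k1 x))" "k1 \<in> borel_measurable \<mu>" "\<And>x. 0 \<le> k1 x"
    and k2: "\<mu>q = density \<mu> (\<lambda>x. ennreal (k2 x))" "k2 \<in> borel_measurable \<mu>" "\<And>x. 0 \<le> k2 x"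
  shows "AE x in \<mu>. J *v (k0 x *\<^sub>R H x) + k2 x *\<^sub>R (Q x *v u x) - k1 x *\<^sub>R (z *s (W x *v u x)) = 0"
proof -
  have u': "u \<in> borel_measurable (restrict_space borel E)" "locally_bv a b u"
    using u unfolding solution_def pre_L2_def balanced_bv_def by auto
  have lin: "linear (\<lambda>v. J *v v)" "linear (\<lambda>v :: complex^'n. z *s v)"
    using bilinear_matrix_vector_mult unfolding bilinear_def
    by (auto intro!: linearI simp: vec_eq_iff algebra_simps)
  note J_bl = linear_bounded_linear[OF lin(1)] and z_bl = linear_bounded_linear[OF lin(2)]
  note Wu = times_locally_bounded_integrable[OF w_rep u'] and Qu = times_locally_bounded_integrable[OF q_rep u']
  have JH: "(\<lambda>x. J *v H x) \<in> borel_measurable \<kappa>"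
    using measurable_compose[OF H(1) borel_measurable_continuous_onI[OF linear_continuous_on[OF J_bl]]] .
  have JH_int: "set_integrable \<kappa> {c..d} (\<lambda>x. J *v H x)" if "{c..d} \<subseteq> E" for c d
    using integrable_bounded_linear[OF J_bl H(2)[OF that, unfolded set_integrable_def]]
    by (simp add: set_integrable_def linear_scale[OF lin(1)])
  have zW: "(\<lambda>x. z *s (W x *v u x)) \<in> borel_measurable \<mu>w"
    using measurable_compose[OF Wu(2) borel_measurable_continuous_onI[OF linear_continuous_on[OF z_bl]]] .
  have zW_int: "set_integrable \<mu>w {c..d} (\<lambda>x. z *s (W x *v u x))" if "{c..d} \<subseteq> E" for c d
    using integrable_bounded_linear[OF z_bl Wu(3)[OF that, unfolded set_integrable_def]]
    by (simp add: set_integrable_def linear_scale[OF lin(2)])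
  note t0 = density_transfer[OF k0 JH] and t1 = density_transfer[OF k1 zW] and t2 = density_transfer[OF k2 Qu(2)]
  let ?G = "\<lambda>x. k0 x *\<^sub>R (J *v H x) + k2 x *\<^sub>R (Q x *v u x) - k1 x *\<^sub>R (z *s (W x *v u x))"
  have G_meas: "?G \<in> borel_measurable \<mu>"
    using t0(1) t1(1) t2(1) k0(2) k1(2) k2(2) by measurable
  have parts: "set_integrable \<mu> {c..d} (\<lambda>x. k0 x *\<^sub>R (J *v H x))"
    "set_integrable \<mu> {c..d} (\<lambda>x. k1 x *\<^sub>R (z *s (W x *v u x)))"
    "set_integrable \<mu> {c..d} (\<lambda>x. k2 x *\<^sub>R (Q x *v u x))" if cd: "{c..d} \<subseteq> E" for c d
  proof -
    have S: "{c..d} \<in> sets \<mu>" using sets_restrict_einterval_Ioc(3)[OF cd] \<mu> by simp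
    show "set_integrable \<mu> {c..d} (\<lambda>x. k0 x *\<^sub>R (J *v H x))" using t0(4)[OF S] JH_int[OF cd] by simp
    show "set_integrable \<mu> {c..d} (\<lambda>x. k1 x *\<^sub>R (z *s (W x *v u x)))" using t1(4)[OF S] zW_int[OF cd] by simp
    show "set_integrable \<mu> {c..d} (\<lambda>x. k2 x *\<^sub>R (Q x *v u x))" using t2(4)[OF S] Qu(3)[OF cd] by simp
  qed
  have "AE x in \<mu>. ?G x = 0"
  proof (rule AE_zero_if_test_zero[OF interval \<mu> G_meas])
    show "set_integrable \<mu> {c..d} ?G" if "{c..d} \<subseteq> E" for c d
      by (intro set_integral_diff(1) set_integral_add(1) parts that)
    fix \<phi> assume \<phi>: "\<phi> \<in> test_functions a b"
    have \<phi>_meas: "\<phi> \<in> borel_measurable borel"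
      using test_function_continuous(1)[OF \<phi>, of UNIV] by (rule borel_measurable_continuous_onI)
    have m0: "(\<lambda>x. \<phi> x *\<^sub>R (J *v H x)) \<in> borel_measurable \<kappa>"
      using JH measurable_restrict_einterval[OF \<kappa> \<phi>_meas] by measurable
    have m1: "(\<lambda>x. \<phi> x *\<^sub>R (z *s (W x *v u x))) \<in> borel_measurable \<mu>w"
      using zW measurable_restrict_einterval[OF w_sets(1) \<phi>_meas] by measurable
    have m2: "(\<lambda>x. \<phi> x *\<^sub>R (Q x *v u x)) \<in> borel_measurable \<mu>q"
      using Qu(2) measurable_restrict_einterval[OF q_sets(1) \<phi>_meas] by measurable
    have i0: "integrable \<mu> (\<lambda>x. \<phi> x *\<^sub>R (k0 x *\<^sub>R (J *v H x)))"
      by (rule test_function_times_integrable[OF interval \<mu> _ parts(1) \<phi>]) (use t0(1) k0(2) in measurable)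
    have i1: "integrable \<mu> (\<lambda>x. \<phi> x *\<^sub>R (k1 x *\<^sub>R (z *s (W x *v u x))))"
      by (rule test_function_times_integrable[OF interval \<mu> _ parts(2) \<phi>]) (use t1(1) k1(2) in measurable)
    have i2: "integrable \<mu> (\<lambda>x. \<phi> x *\<^sub>R (k2 x *\<^sub>R (Q x *v u x)))"
      by (rule test_function_times_integrable[OF interval \<mu> _ parts(3) \<phi>]) (use t2(1) k2(2) in measurable)
    have e0: "J *v dist_deriv a b u \<phi> = (\<integral>x. \<phi> x *\<^sub>R (k0 x *\<^sub>R (J *v H x)) \<partial>\<mu>)"
    proof -
      have "J *v dist_deriv a b u \<phi> = (\<integral>x. \<phi> x *\<^sub>R (J *v H x) \<partial>\<kappa>)"
        unfolding du[OF \<phi>]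
        using integral_bounded_linear[OF J_bl test_function_times_integrable[OF interval \<kappa> H \<phi>]]
        by (simp add: linear_scale[OF lin(1)])
      then show ?thesis using density_transfer(2)[OF k0 m0] by (simp add: mult_ac)
    qed
    have e1: "dist_times a b w (\<lambda>x. z *s u x) \<phi> = (\<integral>x. \<phi> x *\<^sub>R (k1 x *\<^sub>R (z *s (W x *v u x))) \<partial>\<mu>)"
      unfolding dist_times_def using density_transfer(2)[OF k1 m1]
      by (simp add: mult_ac vector_scalar_commute)
    have e2: "dist_times a b q u \<phi> = (\<integral>x. \<phi> x *\<^sub>R (k2 x *\<^sub>R (Q x *v u x)) \<partial>\<mu>)"
      unfolding dist_times_def using density_transfer(2)[OF k2 m2] by (simp add: mult_ac)
    have "(\<integral>x. \<phi> x *\<^sub>R ?G x \<partial>\<mu>) = (\<integral>x. \<phi> x *\<^sub>R (k0 x *\<^sub>R (J *v H x)) + \<phi> x *\<^sub>R (k2 x *\<^sub>R (Q x *v u x)) -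
        \<phi> x *\<^sub>R (k1 x *\<^sub>R (z *s (W x *v u x))) \<partial>\<mu>)"
      by (simp only: scaleR_add_right scaleR_diff_right)
    also have "\<dots> = J *v dist_deriv a b u \<phi> + dist_times a b q u \<phi> - dist_times a b w (\<lambda>x. z *s u x) \<phi>"
      unfolding e0 e1 e2 using i0 i1 i2 by simp
    also have "\<dots> = 0" using u \<phi> unfolding solution_def by simp
    finally show "(LINT x|\<mu>. \<phi> x *\<^sub>R ?G x) = 0" .
  qed
  then show ?thesis by eventually_elim (simp add: linear_scale[OF lin(1)])
qed

end

context canonical_system
begin

text \<open>With \<open>G\<close> the density of \<open>u'\<close>, the product rule gives the increment of \<open>u\<^sup>* J u\<close> as the integral
  of \<open>s - cnj s\<close>, where \<open>s = u\<^sup>* J G\<close>, because \<open>J\<close> is skew-Hermitian. By the equation,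
  \<open>s = z u\<^sup>* w u - u\<^sup>* q u\<close>, whose imaginary part is \<open>Im z u\<^sup>* w u\<close>. If the increment vanishes, so does
  the integral of the non-negative density \<open>u\<^sup>* w u\<close>.\<close>
lemma solution_null_if_equal_limits:
  assumes u: "solution z u" and z: "Im z \<noteq> 0" and cd: "{c..d} \<subseteq> E" "c < d"
    and lim: "(u \<longlongrightarrow> r) (at_right c)" "(u \<longlongrightarrow> r) (at_right d)"
  shows "AE x in \<mu>w. x \<in> {c<..d} \<longrightarrow> W x *v u x = 0"
proof -
  have u': "u \<in> borel_measurable (restrict_space borel E)" "locally_bv a b u" "balanced a b u"
    using u unfolding solution_def pre_L2_def balanced_bv_def by auto
  obtain \<kappa> H R where \<kappa>: "sets \<kappa> = sets (restrict_space borel E)"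
    "H \<in> borel_measurable \<kappa>"
    "u \<in> borel_measurable (restrict_space borel E)"
    "\<And>c d. {c..d} \<subseteq> E \<Longrightarrow> emeasure \<kappa> {c<..d} < \<infinity>"
    "\<And>c d. {c..d} \<subseteq> E \<Longrightarrow> set_integrable \<kappa> {c<..d} H"
    "\<And>c d. {c..d} \<subseteq> E \<Longrightarrow> c \<le> d \<Longrightarrow> (LINT x:{c<..d}|\<kappa>. H x) = R d - R c"
    "\<And>x. x \<in> E \<Longrightarrow> (u \<longlongrightarrow> R x) (at_right x)"
    "\<And>\<phi>. \<phi> \<in> test_functions a b \<Longrightarrow> set_integrable lborel E (\<lambda>x. deriv \<phi> x *\<^sub>R u x)"
    "\<And>\<phi>. \<phi> \<in> test_functions a b \<Longrightarrow> dist_deriv a b u \<phi> = (LINT x|\<kappa>. \<phi> x *\<^sub>R H x)"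
    by (rule bv_representation[OF interval u'(2)], rule that) assumption+
  have cdE: "c \<in> E" "d \<in> E" using cd by auto
  have R_eq: "R c = r" "R d = r"
    using tendsto_unique[OF trivial_limit_at_right_real \<kappa>(7)] lim cdE by blast+
  have H_Icc: "set_integrable \<kappa> {c..d} H" if "{c..d} \<subseteq> E" for c d
  proof (cases "c \<le> d")
    case True
    then have "c \<in> E" using that by auto
    then obtain e where e: "e \<in> E" "e < c" using einterval_left_point by blast
    have sub: "{e..d} \<subseteq> E"
    proof
      fix x assume "x \<in> {e..d}"
      then show "x \<in> E" using mem_einterval_between[OF e(1) \<open>c \<in> E\<close>, of x] e(2) that by (cases "x < c") auto
    qed
    show ?thesis
      by (rule set_integrable_subset[OF \<kappa>(5)[OF sub]])
        (use sets_restrict_einterval_Ioc(3)[OF that] \<kappa>(1) e(2) in auto)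
  qed (simp add: set_integrable_def)
  \<comment> \<open>The measures of \<open>u'\<close>, \<open>w\<close> and \<open>q\<close> are numbered 0, 1 and 2.\<close>
  define \<nu> where "\<nu> = (\<lambda>i::nat. if i = 0 then \<kappa> else if i = 1 then \<mu>w else \<mu>q)"
  obtain l v :: "nat \<Rightarrow> real" where lv: "\<And>i. l i < v i" "\<And>i. {l i..v i} \<subseteq> E" "(\<Union>i. {l i<..v i}) = E"
    using einterval_exhaustion[OF interval] by metis
  have \<nu>_sets: "sets (\<nu> i) = sets (restrict_space borel E)" for i
    using \<kappa>(1) w_sets(1) q_sets(1) by (simp add: \<nu>_def)
  have \<nu>_fin: "emeasure (\<nu> i) {c<..d} < \<infinity>" if "{c..d} \<subseteq> E" for i c d
  proof -
    have Icc: "{c<..d} \<subseteq> {c..d}" by auto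
    have S: "{c..d} \<in> sets \<mu>w" "{c..d} \<in> sets \<mu>q"
      using sets_restrict_einterval_Ioc(3)[OF that] w_sets(1) q_sets(1) by simp_all
    show ?thesis
      using \<kappa>(4)[OF that] le_less_trans[OF emeasure_mono[OF Icc S(1)] w_Icc(1)[OF that]]
        le_less_trans[OF emeasure_mono[OF Icc S(2)] q_Icc(1)[OF that]]
      by (simp add: \<nu>_def)
  qed
  obtain \<mu> k where \<mu>: "sets \<mu> = sets (restrict_space borel E)"
    "\<And>X. X \<in> sets (restrict_space borel E) \<Longrightarrow> emeasure \<mu> X = (\<Sum>i<3. emeasure (\<nu> i) X)"
    and k: "\<And>i. i \<in> {..<3::nat} \<Longrightarrow> k i \<in> borel_measurable \<mu>" "\<And>i x. 0 \<le> (k i x :: real)"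
    "\<And>i. i \<in> {..<3} \<Longrightarrow> \<nu> i = density \<mu> (\<lambda>x. ennreal (k i x))"
  proof (rule common_density[of "{..<3::nat}" \<nu> "restrict_space borel E" "\<lambda>i. {l i<..v i}"])
    show "range (\<lambda>i. {l i<..v i}) \<subseteq> sets (restrict_space borel E)" using sets_restrict_einterval_Ioc(1)[OF lv(2)] by blast
    show "(\<Union>i. {l i<..v i}) = space (restrict_space borel E)" using lv(3) by (simp add: space_restrict_space)
    show "emeasure (\<nu> s) {l i<..v i} < \<infinity>" for s i by (rule \<nu>_fin[OF lv(2)])
  qed (use \<nu>_sets in auto)
  have k0: "\<kappa> = density \<mu> (\<lambda>x. ennreal (k 0 x))" "k 0 \<in> borel_measurable \<mu>" "\<And>x. 0 \<le> k 0 x"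
    and k1: "\<mu>w = density \<mu> (\<lambda>x. ennreal (k 1 x))" "k 1 \<in> borel_measurable \<mu>" "\<And>x. 0 \<le> k 1 x"
    and k2: "\<mu>q = density \<mu> (\<lambda>x. ennreal (k 2 x))" "k 2 \<in> borel_measurable \<mu>" "\<And>x. 0 \<le> k 2 x"
    using k(3)[of 0] k(3)[of 1] k(3)[of 2] k(1)[of 0] k(1)[of 1] k(1)[of 2] k(2) by (simp_all add: \<nu>_def)
  have eq_AE: "AE x in \<mu>. J *v (k 0 x *\<^sub>R H x) + k 2 x *\<^sub>R (Q x *v u x) - k 1 x *\<^sub>R (z *s (W x *v u x)) = 0"
    by (rule solution_equation_AE[OF u \<kappa>(1,2) H_Icc \<kappa>(9) \<mu>(1) k0 k1 k2])
  define G where "G = (\<lambda>x. k 0 x *\<^sub>R H x)"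
  let ?I = "{c<..d}"
  have I: "?I \<in> sets \<mu>" using sets_restrict_einterval_Ioc(1)[OF cd(1)] \<mu>(1) by simp
  have space_\<mu>: "space \<mu> = E" using sets_eq_imp_space_eq[OF \<mu>(1)] by (simp add: space_restrict_space)
  have IE: "?I \<subseteq> E" using cd by auto
  define M where "M = restrict_space \<mu> ?I"
  have space_M: "space M = ?I" using IE space_\<mu> by (auto simp: M_def space_restrict_space)
  have I_space: "?I \<inter> space \<mu> \<in> sets \<mu>" using I by auto
  have "emeasure M (space M) = emeasure \<mu> ?I"
    unfolding space_M unfolding M_def by (rule emeasure_restrict_space[OF I_space]) simp
  also have "\<dots> < \<infinity>"
    using \<nu>_fin[OF cd(1)] sets_restrict_einterval_Ioc(1)[OF cd(1)] by (simp add: \<mu>(2) less_top)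
  finally have M_fin: "finite_measure M" by (intro finite_measureI) auto
  have id_M: "(\<lambda>x. x) \<in> borel_measurable M"
    unfolding M_def by (intro measurable_restrict_space1 measurable_restrict_einterval[OF \<mu>(1)]) auto
  have H_\<mu>: "H \<in> borel_measurable \<mu>" using \<kappa>(2) k0(1) by simp
  have int_M: "(\<integral>x. f x \<partial>M) = (\<integral>x. indicator ?I x *\<^sub>R f x \<partial>\<mu>)" for f :: "real \<Rightarrow> complex"
    unfolding M_def by (rule integral_restrict_space[OF I_space])
  have G_int: "integrable M G"
    using density_transfer(4)[OF k0 \<kappa>(2) I] \<kappa>(5)[OF cd(1)]
    by (simp add: M_def integrable_restrict_space[OF I_space] set_integrable_def G_def)
  have G_nth: "integrable M (\<lambda>x. G x $ i)" for i
    using integrable_bounded_linear[OF bounded_linear_vec_nth G_int] .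
  have nth_LINT: "(LINT x:A|\<kappa>. H x) $ i = (\<integral>x. indicator A x *\<^sub>R (G x $ i) \<partial>\<mu>)"
    "integrable \<mu> (\<lambda>x. indicator A x *\<^sub>R (G x $ i))"
    if "A \<in> sets \<mu>" "set_integrable \<kappa> A H" for A i
  proof -
    have int: "set_integrable \<mu> A G" "(LINT x:A|\<kappa>. H x) = (LINT x:A|\<mu>. G x)"
      using density_transfer(4,5)[OF k0 \<kappa>(2) that(1)] that(2) by (simp_all add: G_def)
    show "integrable \<mu> (\<lambda>x. indicator A x *\<^sub>R (G x $ i))"
      using integrable_bounded_linear[OF bounded_linear_vec_nth int(1)[unfolded set_integrable_def], of i] by simp
    show "(LINT x:A|\<kappa>. H x) $ i = (\<integral>x. indicator A x *\<^sub>R (G x $ i) \<partial>\<mu>)"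
      unfolding int(2) unfolding set_lebesgue_integral_def
      using integral_bounded_linear[OF bounded_linear_vec_nth int(1)[unfolded set_integrable_def], of i] by simp
  qed
  have G_total: "(\<integral>x. G x $ i \<partial>M) = 0" for i
    using nth_LINT(1)[OF I \<kappa>(5)[OF cd(1)], of i] \<kappa>(6)[OF cd(1)] cd(2) R_eq by (simp add: int_M)
  have u_nth: "u y $ i = r $ i + (\<integral>x. half_kernel x y * G x $ i \<partial>M)" if y: "y \<in> ?I" for y i
  proof -
    have cy: "{c..y} \<subseteq> E" "c < y" using y cd by auto
    have A: "{c<..<y} \<in> sets \<mu>" "{c<..y} \<in> sets \<mu>"
      using sets_restrict_einterval_Ioc[OF cy(1)] \<mu>(1) by simp_all
    have i2: "set_integrable \<kappa> {c<..y} H" by (rule \<kappa>(5)[OF cy(1)])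
    have i1: "set_integrable \<kappa> {c<..<y} H"
      by (rule set_integrable_subset[OF i2]) (use A \<mu>(1) \<kappa>(1) in auto)
    have "(\<integral>x. half_kernel x y * G x $ i \<partial>M) =
       (\<integral>x. (1/2) *\<^sub>R (indicator {c<..<y} x *\<^sub>R (G x $ i) + indicator {c<..y} x *\<^sub>R (G x $ i)) \<partial>\<mu>)"
      unfolding int_M using y
      by (intro Bochner_Integration.integral_cong refl) (auto simp: half_kernel_def indicator_def scaleR_conv_of_real)
    also have "\<dots> = (1/2) *\<^sub>R ((LINT x:{c<..<y}|\<kappa>. H x) $ i + (LINT x:{c<..y}|\<kappa>. H x) $ i)"
      unfolding nth_LINT(1)[OF A(1) i1] nth_LINT(1)[OF A(2) i2]
      using nth_LINT(2)[OF A(1) i1] nth_LINT(2)[OF A(2) i2] by (simp only: integral_scaleR_right Bochner_Integration.integral_add)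
    finally show ?thesis
      using balanced_value[OF u'(3) \<kappa>(1,2,5,6,7) cy] by (simp add: R_eq)
  qed
  have cnj_kernel: "cnj (half_kernel x y) = half_kernel x y" for x y by (simp add: half_kernel_def)
  have u_cnj: "cnj (u y $ i) = cnj (r $ i) + (\<integral>x. half_kernel x y * cnj (G x $ i) \<partial>M)" if y: "y \<in> ?I" for y i
  proof -
    have "cnj (\<integral>x. half_kernel x y * G x $ i \<partial>M) = (\<integral>x. cnj (half_kernel x y * G x $ i) \<partial>M)"
      by (simp only: Bochner_Integration.integral_cnj)
    then show ?thesis using u_nth[OF y, of i] by (simp add: cnj_kernel)
  qed
  have cnj_int: "integrable M (\<lambda>x. cnj (G x $ i))" "(\<integral>x. cnj (G x $ i) \<partial>M) = 0" for i
    using G_nth[of i] G_total[of i] by simp_all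
  \<comment> \<open>\<open>G\<close> has integral 0, as the limits agree, so each entry of \<open>u u\<^sup>*\<close> has increment 0.\<close>
  have prod_rule: "integrable M (\<lambda>x. cnj (G x $ i) * u x $ j + cnj (u x $ i) * G x $ j)"
    "(\<integral>x. cnj (G x $ i) * u x $ j + cnj (u x $ i) * G x $ j \<partial>M) = 0" for i j
  proof -
    note P = product_rule_half_kernel[OF M_fin id_M cnj_int(1)[of i] G_nth[of j], of "r $ j" "cnj (r $ i)"]
    have eq: "cnj (G x $ i) * u x $ j + cnj (u x $ i) * G x $ j =
       cnj (G x $ i) * (r $ j + (\<integral>y. half_kernel y x * G y $ j \<partial>M)) +
       (cnj (r $ i) + (\<integral>y. half_kernel y x * cnj (G y $ i) \<partial>M)) * G x $ j" if "x \<in> space M" for x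
      using u_nth u_cnj that by (simp add: space_M)
    show "integrable M (\<lambda>x. cnj (G x $ i) * u x $ j + cnj (u x $ i) * G x $ j)"
      using P(1) by (subst Bochner_Integration.integrable_cong[OF refl eq]) auto
    show "(\<integral>x. cnj (G x $ i) * u x $ j + cnj (u x $ i) * G x $ j \<partial>M) = 0"
      using P(2) cnj_int(2) G_total by (subst Bochner_Integration.integral_cong[OF refl eq]) auto
  qed
  define s where "s = (\<lambda>x. sesq J (u x) (G x))"
  have s_eq: "(\<Sum>i\<in>UNIV. \<Sum>j\<in>UNIV. J $ i $ j * (cnj (G x $ i) * u x $ j + cnj (u x $ i) * G x $ j)) = s x - cnj (s x)" for x
  proof -
    have "(\<Sum>i\<in>UNIV. \<Sum>j\<in>UNIV. J $ i $ j * (cnj (G x $ i) * u x $ j + cnj (u x $ i) * G x $ j)) = sesq J (G x) (u x) + sesq J (u x) (G x)"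
      unfolding sesq_eq_sum sum.distrib[symmetric] by (intro sum.cong refl) (simp add: algebra_simps)
    also have "\<dots> = s x - cnj (s x)"
      using sesq_cnj_skew_hermitian[OF J, of "G x" "u x"] by (simp add: s_def)
    finally show ?thesis .
  qed
  have "integrable M (\<lambda>x. s x - cnj (s x))" "(\<integral>x. s x - cnj (s x) \<partial>M) = 0"
    unfolding s_eq[symmetric] using prod_rule by (simp_all add: Bochner_Integration.integral_sum)
  then have Im_s: "integrable M (\<lambda>x. Im (s x - cnj (s x)))" "(\<integral>x. Im (s x - cnj (s x)) \<partial>M) = 0"
    using integrable_Im integral_Im by (metis, metis zero_complex.sel(2))
  have AE_M: "(AE x in M. P x) \<longleftrightarrow> (AE x in \<mu>. x \<in> ?I \<longrightarrow> P x)" for P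
    unfolding M_def by (rule AE_restrict_space_iff[OF I_space])
  define g where "g = (\<lambda>x. k 1 x * Re (quad_form (W x) (u x)))"
  have pos_AE: "AE x in \<mu>. 0 < k 1 x \<longrightarrow> nonneg_matrix (W x)"
    using W_nonneg unfolding k1(1) by (subst (asm) AE_density) (use k1(2) in auto)
  have herm_AE: "AE x in \<mu>. 0 < k 2 x \<longrightarrow> hermitian (Q x)"
    using Q_hermitian unfolding k2(1) by (subst (asm) AE_density) (use k2(2) in auto)
  have Im_s_eq: "AE x in \<mu>. Im (s x) = Im z * g x \<and> 0 \<le> g x"
    using eq_AE pos_AE herm_AE
  proof eventually_elim
    case (elim x)
    have JG: "J *v G x = k 1 x *\<^sub>R (z *s (W x *v u x)) - k 2 x *\<^sub>R (Q x *v u x)"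
      using elim(1) by (simp add: G_def algebra_simps)
    have s_x: "s x = of_real (k 1 x) * z * quad_form (W x) (u x) - of_real (k 2 x) * quad_form (Q x) (u x)"
      unfolding s_def sesq_def JG quad_form_def
      by (simp add: scaleR_conv_of_real[where 'a = complex] algebra_simps sum_subtractf sum_distrib_left)
    have "Im (s x) = Re z * (k 1 x * Im (quad_form (W x) (u x))) + Im z * g x - k 2 x * Im (quad_form (Q x) (u x))"
      unfolding s_x g_def by (simp add: algebra_simps)
    moreover have "k 1 x * Im (quad_form (W x) (u x)) = 0" "0 \<le> g x"
      using elim(2) k1(3)[of x] by (cases "k 1 x = 0"; force simp: nonneg_matrix_def g_def)+
    moreover have "k 2 x * Im (quad_form (Q x) (u x)) = 0"
      using elim(3) k2(3)[of x] quad_form_hermitian_real by (cases "k 2 x = 0") force+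
    ultimately show ?case by simp
  qed
  have W_\<mu>: "W \<in> borel_measurable \<mu>" using w_sets(3) k1(1) by simp
  have u_\<mu>: "u \<in> borel_measurable \<mu>" using u'(1) measurable_cong_sets[OF \<mu>(1) refl] by blast
  have g_M: "g \<in> borel_measurable M"
    unfolding M_def g_def by (rule measurable_restrict_space1) (use W_\<mu> u_\<mu> k1(2) in measurable)
  have gs: "AE x in M. Im (s x - cnj (s x)) = (2 * Im z) * g x"
    unfolding AE_M using Im_s_eq by eventually_elim auto
  have g_nn: "AE x in M. 0 \<le> g x"
    unfolding AE_M using Im_s_eq by eventually_elim auto
  have zg: "integrable M (\<lambda>x. (2 * Im z) * g x)" "(\<integral>x. (2 * Im z) * g x \<partial>M) = 0"
    using Im_s integrable_cong_AE[OF borel_measurable_integrable[OF Im_s(1)] _ gs]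
      integral_cong_AE[OF borel_measurable_integrable[OF Im_s(1)] _ gs] g_M by auto
  then have "integrable M g" "(\<integral>x. g x \<partial>M) = 0" using z by simp_all
  then have "AE x in M. g x = 0"
    using integral_nonneg_eq_0_iff_AE[OF _ g_nn] by blast
  then have "AE x in \<mu>. x \<in> ?I \<longrightarrow> g x = 0" unfolding AE_M .
  with pos_AE have "AE x in \<mu>. 0 < k 1 x \<longrightarrow> x \<in> ?I \<longrightarrow> W x *v u x = 0"
    by eventually_elim (auto simp: g_def nonneg_matrix_quad_form_zero_iff)
  then show ?thesis
    unfolding k1(1) by (subst AE_density) (use k1(2) in auto)
qed

end

section \<open>Linear dependence of solutions\<close>

lemma linear_scalar_mult: "linear (\<lambda>v :: complex^'n. c *s v)"
  by (auto intro!: linearI simp: vec_eq_iff algebra_simps)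

lemma linear_coordinate_sum: "linear (\<lambda>\<alpha> :: complex^'k. \<Sum>k\<in>UNIV. \<alpha> $ k *s (v k :: complex^'n))"
  by (auto intro!: linearI simp: vec_eq_iff distrib_right sum.distrib scaleR_sum_right)

lemma locally_bv_D:
  "locally_bv a b f \<Longrightarrow> {c..d} \<subseteq> einterval a b \<Longrightarrow> bounded_variation_on {c..d} f"
  unfolding locally_bv_def by blast

lemma locally_bv_add:
  assumes "locally_bv a b f" "locally_bv a b g"
  shows "locally_bv a b (\<lambda>x. f x + g x)"
  unfolding locally_bv_def
proof (intro allI impI)
  fix c d assume cd: "{c..d} \<subseteq> einterval a b"
  obtain B1 where B1: "\<forall>(m::nat) t. (\<forall>i\<le>m. t i \<in> {c..d}) \<and> (\<forall>i<m. t i \<le> t (Suc i)) \<longrightarrow>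
       (\<Sum>i<m. norm (f (t (Suc i)) - f (t i))) \<le> B1"
    using locally_bv_D[OF assms(1) cd] unfolding bounded_variation_on_def ..
  obtain B2 where B2: "\<forall>(m::nat) t. (\<forall>i\<le>m. t i \<in> {c..d}) \<and> (\<forall>i<m. t i \<le> t (Suc i)) \<longrightarrow>
       (\<Sum>i<m. norm (g (t (Suc i)) - g (t i))) \<le> B2"
    using locally_bv_D[OF assms(2) cd] unfolding bounded_variation_on_def ..
  show "bounded_variation_on {c..d} (\<lambda>x. f x + g x)"
    unfolding bounded_variation_on_def
  proof (intro exI[of _ "B1 + B2"] allI impI)
    fix m :: nat and t assume t: "(\<forall>i\<le>m. t i \<in> {c..d}) \<and> (\<forall>i<m. t i \<le> t (Suc i))"
    have "(\<Sum>i<m. norm (f (t (Suc i)) + g (t (Suc i)) - (f (t i) + g (t i)))) \<le>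
       (\<Sum>i<m. norm (f (t (Suc i)) - f (t i)) + norm (g (t (Suc i)) - g (t i)))"
      by (intro sum_mono norm_diff_triangle_ineq)
    also have "\<dots> \<le> B1 + B2"
      unfolding sum.distrib using B1[rule_format, OF t] B2[rule_format, OF t] by (rule add_mono)
    finally show "(\<Sum>i<m. norm (f (t (Suc i)) + g (t (Suc i)) - (f (t i) + g (t i)))) \<le> B1 + B2" .
  qed
qed

lemma locally_bv_linear:
  fixes T :: "'v::euclidean_space \<Rightarrow> 'w::real_normed_vector"
  assumes "linear T" "locally_bv a b f"
  shows "locally_bv a b (\<lambda>x. T (f x))"
  unfolding locally_bv_def
proof (intro allI impI)
  fix c d assume cd: "{c..d} \<subseteq> einterval a b"
  obtain B where B: "\<forall>(m::nat) t. (\<forall>i\<le>m. t i \<in> {c..d}) \<and> (\<forall>i<m. t i \<le> t (Suc i)) \<longrightarrow>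
       (\<Sum>i<m. norm (f (t (Suc i)) - f (t i))) \<le> B"
    using locally_bv_D[OF assms(2) cd] unfolding bounded_variation_on_def ..
  obtain K where K: "0 < K" "\<And>x. norm (T x) \<le> norm x * K"
    using bounded_linear.pos_bounded[OF linear_bounded_linear[OF assms(1)]] by blast
  show "bounded_variation_on {c..d} (\<lambda>x. T (f x))"
    unfolding bounded_variation_on_def
  proof (intro exI[of _ "B * K"] allI impI)
    fix m :: nat and t assume t: "(\<forall>i\<le>m. t i \<in> {c..d}) \<and> (\<forall>i<m. t i \<le> t (Suc i))"
    have "(\<Sum>i<m. norm (T (f (t (Suc i))) - T (f (t i)))) \<le> (\<Sum>i<m. norm (f (t (Suc i)) - f (t i)) * K)"
      unfolding linear_diff[OF assms(1), symmetric] by (intro sum_mono K)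
    also have "\<dots> \<le> B * K"
      unfolding sum_distrib_right[symmetric] using B[rule_format, OF t] K(1) by (intro mult_right_mono) auto
    finally show "(\<Sum>i<m. norm (T (f (t (Suc i))) - T (f (t i)))) \<le> B * K" .
  qed
qed

lemma balanced_add:
  assumes "balanced a b f" "balanced a b g"
  shows "balanced a b (\<lambda>x. f x + g x)"
  unfolding balanced_def
proof
  fix x assume x: "x \<in> einterval a b"
  obtain l r where f: "(f \<longlongrightarrow> l) (at_left x)" "(f \<longlongrightarrow> r) (at_right x)" "f x = (1/2) *\<^sub>R (l + r)"
    using assms(1) x unfolding balanced_def by blast
  obtain l' r' where g: "(g \<longlongrightarrow> l') (at_left x)" "(g \<longlongrightarrow> r') (at_right x)" "g x = (1/2) *\<^sub>R (l' + r')"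
    using assms(2) x unfolding balanced_def by blast
  show "\<exists>l r. ((\<lambda>x. f x + g x) \<longlongrightarrow> l) (at_left x) \<and> ((\<lambda>x. f x + g x) \<longlongrightarrow> r) (at_right x) \<and>
      f x + g x = (1/2) *\<^sub>R (l + r)"
    by (intro exI[of _ "l + l'"] exI[of _ "r + r'"] conjI tendsto_add f g) (simp add: f(3) g(3) algebra_simps)
qed

lemma balanced_linear:
  fixes T :: "'v::euclidean_space \<Rightarrow> 'w::real_normed_vector"
  assumes "linear T" "balanced a b f"
  shows "balanced a b (\<lambda>x. T (f x))"
  unfolding balanced_def
proof
  fix x assume x: "x \<in> einterval a b"
  obtain l r where f: "(f \<longlongrightarrow> l) (at_left x)" "(f \<longlongrightarrow> r) (at_right x)" "f x = (1/2) *\<^sub>R (l + r)"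
    using assms(2) x unfolding balanced_def by blast
  show "\<exists>l r. ((\<lambda>x. T (f x)) \<longlongrightarrow> l) (at_left x) \<and> ((\<lambda>x. T (f x)) \<longlongrightarrow> r) (at_right x) \<and>
      T (f x) = (1/2) *\<^sub>R (l + r)"
    by (intro exI[of _ "T l"] exI[of _ "T r"] conjI bounded_linear.tendsto[OF linear_bounded_linear[OF assms(1)]] f)
      (simp add: f(3) linear_scale[OF assms(1)] linear_add[OF assms(1)])
qed

text \<open>Local boundedness and Borel measurability of \<open>u\<close> are both contained in \<open>bv_representation\<close>.\<close>
lemma locally_bv_deriv_integrable:
  fixes u :: "real \<Rightarrow> 'v::euclidean_space"
  assumes "a < b" "locally_bv a b u" "\<phi> \<in> test_functions a b"
  shows "set_integrable lborel (einterval a b) (\<lambda>x. deriv \<phi> x *\<^sub>R u x)"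
proof (rule bv_representation[OF assms(1,2)])
  assume "\<And>\<phi>. \<phi> \<in> test_functions a b \<Longrightarrow> set_integrable lborel (einterval a b) (\<lambda>x. deriv \<phi> x *\<^sub>R u x)"
  then show ?thesis using assms(3) .
qed

lemma dist_deriv_add:
  fixes u v :: "real \<Rightarrow> 'v::euclidean_space"
  assumes "a < b" "locally_bv a b u" "locally_bv a b v" "\<phi> \<in> test_functions a b"
  shows "dist_deriv a b (\<lambda>x. u x + v x) \<phi> = dist_deriv a b u \<phi> + dist_deriv a b v \<phi>"
  unfolding dist_deriv_def
  using set_integral_add(2)[OF locally_bv_deriv_integrable[OF assms(1,2,4)] locally_bv_deriv_integrable[OF assms(1,3,4)]]
  by (simp add: scaleR_add_right)

lemma dist_deriv_linear:
  fixes T :: "'v::euclidean_space \<Rightarrow> 'w::euclidean_space"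
  assumes "a < b" "locally_bv a b u" "\<phi> \<in> test_functions a b" and T: "linear T"
  shows "dist_deriv a b (\<lambda>x. T (u x)) \<phi> = T (dist_deriv a b u \<phi>)"
  unfolding dist_deriv_def set_lebesgue_integral_def
  using integral_bounded_linear[OF linear_bounded_linear[OF T]
      locally_bv_deriv_integrable[OF assms(1-3), unfolded set_integrable_def]]
  by (simp add: linear_scale[OF T] linear_neg[OF T])

context canonical_system
begin

lemma dist_times_add:
  assumes "represents a b t (rep_measure a b t) (rep_density a b t :: real \<Rightarrow> complex^'n^'n)"
    and "u \<in> borel_measurable (restrict_space borel E)" "locally_bv a b u"
    and "v \<in> borel_measurable (restrict_space borel E)" "locally_bv a b v"
    and "\<phi> \<in> test_functions a b"
  shows "dist_times a b t (\<lambda>x. u x + v x) \<phi> = dist_times a b t u \<phi> + dist_times a b t v \<phi>"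
  unfolding dist_times_def
  using times_locally_bounded_integrable(4)[OF assms(1-3,6)] times_locally_bounded_integrable(4)[OF assms(1,4-6)]
  by (simp add: matrix_vector_right_distrib scaleR_add_right)

lemma dist_times_scale:
  assumes "represents a b t (rep_measure a b t) (rep_density a b t :: real \<Rightarrow> complex^'n^'n)"
    and "u \<in> borel_measurable (restrict_space borel E)" "locally_bv a b u"
    and "\<phi> \<in> test_functions a b"
  shows "dist_times a b t (\<lambda>x. c *s u x) \<phi> = c *s dist_times a b t u \<phi>"
  unfolding dist_times_def
  using integral_bounded_linear[OF linear_bounded_linear[OF linear_scalar_mult[of c]] times_locally_bounded_integrable(4)[OF assms]]
  by (simp add: vector_scalar_commute linear_scale[OF linear_scalar_mult])

lemma pre_L2_add:
  assumes "u \<in> pre_L2 a b w" "v \<in> pre_L2 a b w"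
  shows "(\<lambda>x. u x + v x) \<in> pre_L2 a b w"
proof -
  have m: "u \<in> borel_measurable \<mu>w" "v \<in> borel_measurable \<mu>w"
    using assms measurable_cong_sets[OF w_sets(1) refl] unfolding pre_L2_def by auto
  note [measurable] = m w_sets(3)
  have "norm_sq a b w (\<lambda>x. u x + v x) \<le> (\<integral>\<^sup>+x. 2 * ennreal (Re (quad_form (W x) (u x))) + 2 * ennreal (Re (quad_form (W x) (v x))) \<partial>\<mu>w)"
    unfolding norm_sq_def
  proof (rule nn_integral_mono_AE, use W_nonneg in eventually_elim)
    case (elim x)
    have nn: "0 \<le> Re (quad_form (W x) \<xi>)" for \<xi> using elim by (simp add: nonneg_matrix_def)
    have "ennreal (Re (quad_form (W x) (u x + v x))) \<le> ennreal (2 * Re (quad_form (W x) (u x)) + 2 * Re (quad_form (W x) (v x)))"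
      by (rule ennreal_leI) (rule quad_form_add_le[OF elim])
    also have "\<dots> = 2 * ennreal (Re (quad_form (W x) (u x))) + 2 * ennreal (Re (quad_form (W x) (v x)))"
      using nn by (simp add: ennreal_plus ennreal_mult)
    finally show ?case .
  qed
  also have "\<dots> = 2 * norm_sq a b w u + 2 * norm_sq a b w v"
    unfolding norm_sq_def by (subst nn_integral_add, measurable) (simp add: nn_integral_cmult)
  also have "\<dots> < \<infinity>"
    using assms unfolding pre_L2_def by (auto simp: ennreal_mult_less_top)
  finally show ?thesis using assms unfolding pre_L2_def by auto
qed

lemma pre_L2_scale:
  assumes "u \<in> pre_L2 a b w"
  shows "(\<lambda>x. c *s u x) \<in> pre_L2 a b w"
proof -
  have m: "u \<in> borel_measurable \<mu>w"
    using assms measurable_cong_sets[OF w_sets(1) refl] unfolding pre_L2_def by auto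
  note [measurable] = m w_sets(3)
  have "norm_sq a b w (\<lambda>x. c *s u x) = ennreal ((cmod c)\<^sup>2) * norm_sq a b w u"
    unfolding norm_sq_def quad_form_scale by (simp add: ennreal_mult' nn_integral_cmult)
  also have "\<dots> < \<infinity>"
    using assms unfolding pre_L2_def by (auto simp: ennreal_mult_less_top)
  finally have "norm_sq a b w (\<lambda>x. c *s u x) < \<infinity>" .
  moreover have "(\<lambda>x. c *s u x) \<in> borel_measurable (restrict_space borel E)"
    using assms measurable_compose[OF _ borel_measurable_continuous_onI[OF linear_continuous_on[OF linear_bounded_linear[OF linear_scalar_mult[of c]]]]]
    unfolding pre_L2_def by blast
  ultimately show ?thesis by (simp add: pre_L2_def)
qed

lemma solution_D:
  assumes "solution z u"
  shows "u \<in> pre_L2 a b w" "u \<in> borel_measurable (restrict_space borel E)" "locally_bv a b u" "balanced a b u"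
    "\<phi> \<in> test_functions a b \<Longrightarrow> J *v dist_deriv a b u \<phi> + dist_times a b q u \<phi> = z *s dist_times a b w u \<phi>"
proof -
  show u: "u \<in> pre_L2 a b w" "u \<in> borel_measurable (restrict_space borel E)" "locally_bv a b u" "balanced a b u"
    using assms unfolding solution_def pre_L2_def balanced_bv_def by auto
  show "J *v dist_deriv a b u \<phi> + dist_times a b q u \<phi> = z *s dist_times a b w u \<phi>" if "\<phi> \<in> test_functions a b"
    using assms that dist_times_scale[OF w_rep u(2,3) that] unfolding solution_def by simp
qed

lemma solution_I:
  assumes u: "u \<in> pre_L2 a b w" "locally_bv a b u" "balanced a b u"
    and eq: "\<And>\<phi>. \<phi> \<in> test_functions a b \<Longrightarrow> J *v dist_deriv a b u \<phi> + dist_times a b q u \<phi> = z *s dist_times a b w u \<phi>"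
  shows "solution z u"
proof -
  have "u \<in> borel_measurable (restrict_space borel E)" using u(1) by (simp add: pre_L2_def)
  then show ?thesis
    using u eq dist_times_scale[OF w_rep _ u(2)] by (simp add: solution_def balanced_bv_def)
qed

lemma solution_add:
  assumes u: "solution z u" and v: "solution z v"
  shows "solution z (\<lambda>x. u x + v x)"
proof (rule solution_I)
  fix \<phi> assume \<phi>: "\<phi> \<in> test_functions a b"
  note uv = solution_D(2,3)[OF u] solution_D(2,3)[OF v]
  show "J *v dist_deriv a b (\<lambda>x. u x + v x) \<phi> + dist_times a b q (\<lambda>x. u x + v x) \<phi> =
      z *s dist_times a b w (\<lambda>x. u x + v x) \<phi>"
    using solution_D(5)[OF u \<phi>] solution_D(5)[OF v \<phi>]
    by (simp add: dist_deriv_add[OF interval uv(2,4) \<phi>] dist_times_add[OF q_rep uv \<phi>] dist_times_add[OF w_rep uv \<phi>]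
        matrix_vector_right_distrib vector_add_ldistrib algebra_simps)
qed (intro pre_L2_add locally_bv_add balanced_add solution_D[OF u] solution_D[OF v])+

lemma solution_scale:
  assumes u: "solution z u"
  shows "solution z (\<lambda>x. c *s u x)"
proof (rule solution_I)
  fix \<phi> assume \<phi>: "\<phi> \<in> test_functions a b"
  note u' = solution_D(2,3)[OF u]
  have "J *v (c *s dist_deriv a b u \<phi>) + c *s dist_times a b q u \<phi> = c *s (z *s dist_times a b w u \<phi>)"
    using arg_cong[OF solution_D(5)[OF u \<phi>], of "\<lambda>v. c *s v"]
    by (simp add: vector_scalar_commute vector_add_ldistrib)
  then show "J *v dist_deriv a b (\<lambda>x. c *s u x) \<phi> + dist_times a b q (\<lambda>x. c *s u x) \<phi> =
      z *s dist_times a b w (\<lambda>x. c *s u x) \<phi>"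
    by (simp add: dist_deriv_linear[OF interval u'(2) \<phi> linear_scalar_mult] dist_times_scale[OF q_rep u' \<phi>]
        dist_times_scale[OF w_rep u' \<phi>] vector_smult_assoc mult.commute)
qed (intro pre_L2_scale locally_bv_linear[OF linear_scalar_mult] balanced_linear[OF linear_scalar_mult] solution_D[OF u])+

lemma solution_zero: "solution z (\<lambda>x. 0)"
  by (rule solution_I)
    (auto simp: pre_L2_def norm_sq_def quad_form_def locally_bv_def bounded_variation_on_def balanced_def
      dist_deriv_def dist_times_def set_lebesgue_integral_def intro!: exI[of _ 0] tendsto_const)

lemma solution_sum:
  assumes "finite I" "\<And>i. i \<in> I \<Longrightarrow> solution z (u i)"
  shows "solution z (\<lambda>x. \<Sum>i\<in>I. c i *s u i x)"
  using assms
  by (induction I rule: finite_induct) (auto simp: solution_zero intro!: solution_add solution_scale)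

end

context canonical_system
begin

text \<open>The type \<open>'n option\<close> has \<open>n + 1\<close> elements. Over the reals, the coefficient space has dimension
  \<open>2 n + 2\<close>, and the map from the coefficients to the difference of the limits at \<open>c\<close> and \<open>d\<close> has a
  range of dimension at most \<open>2 n\<close>.\<close>
lemma solutions_dependent_on_subinterval:
  fixes u :: "'n option \<Rightarrow> real \<Rightarrow> complex^'n"
  assumes u: "\<And>k. solution z (u k)" and z: "Im z \<noteq> 0" and cd: "{c..d} \<subseteq> E" "c < d"
  shows "\<exists>\<alpha> :: complex^('n option). norm \<alpha> = 1 \<and>
    (AE x in \<mu>w. x \<in> {c<..d} \<longrightarrow> W x *v (\<Sum>k\<in>UNIV. \<alpha> $ k *s u k x) = 0)"
proof -
  have "\<forall>k x. \<exists>r. x \<in> E \<longrightarrow> (u k \<longlongrightarrow> r) (at_right x)"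
    using solution_D(4)[OF u] unfolding balanced_def by blast
  then obtain r where r: "\<And>k x. x \<in> E \<Longrightarrow> (u k \<longlongrightarrow> r k x) (at_right x)" by metis
  define T where "T = (\<lambda>\<alpha> :: complex^('n option). \<Sum>k\<in>UNIV. \<alpha> $ k *s (r k d - r k c))"
  have T: "linear T"
    unfolding T_def by (rule linear_coordinate_sum)
  have "\<not> inj T"
  proof
    assume "inj T"
    then have "dim (range T) = dim (UNIV :: (complex^('n option)) set)"
      by (intro dim_image_eq[OF T]) (simp add: inj_on_subset)
    moreover have "dim (range T) \<le> DIM(complex^'n)" by (rule dim_subset_UNIV)
    ultimately show False by (simp add: dim_UNIV)
  qed
  then obtain \<beta> where \<beta>: "T \<beta> = 0" "\<beta> \<noteq> 0" unfolding linear_injective_0[OF T] by blast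
  define \<alpha> where "\<alpha> = (1 / norm \<beta>) *\<^sub>R \<beta>"
  have \<alpha>: "norm \<alpha> = 1" "T \<alpha> = 0" using \<beta> by (simp_all add: \<alpha>_def linear_scale[OF T])
  define v where "v = (\<lambda>x. \<Sum>k\<in>UNIV. \<alpha> $ k *s u k x)"
  have v_sol: "solution z v" unfolding v_def by (intro solution_sum u) simp
  have lim: "(v \<longlongrightarrow> (\<Sum>k\<in>UNIV. \<alpha> $ k *s r k x)) (at_right x)" if "x \<in> E" for x
    unfolding v_def by (intro tendsto_sum bounded_linear.tendsto[OF linear_bounded_linear[OF linear_scalar_mult]] r that)
  have "(\<Sum>k\<in>UNIV. \<alpha> $ k *s r k d) - (\<Sum>k\<in>UNIV. \<alpha> $ k *s r k c) = T \<alpha>"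
    by (simp add: T_def sum_subtractf[symmetric] vec_eq_iff algebra_simps)
  then have "(\<Sum>k\<in>UNIV. \<alpha> $ k *s r k d) = (\<Sum>k\<in>UNIV. \<alpha> $ k *s r k c)" using \<alpha>(2) by simp
  moreover have "c \<in> E" "d \<in> E" using cd by auto
  ultimately have "AE x in \<mu>w. x \<in> {c<..d} \<longrightarrow> W x *v v x = 0"
    using lim[of c] lim[of d] by (intro solution_null_if_equal_limits[OF v_sol z cd]) simp_all
  then show ?thesis unfolding v_def by (intro exI[of _ \<alpha>] conjI \<alpha>(1))
qed

text \<open>The coefficients obtained for a subinterval still depend on it. A limit point of normalized
  coefficients for an exhausting sequence works everywhere, since coefficients that are good
  for one interval of the sequence are good for all smaller ones.\<close>
lemma solutions_dependent:
  fixes u :: "'n option \<Rightarrow> real \<Rightarrow> complex^'n"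
  assumes u: "\<And>k. solution z (u k)" and z: "Im z \<noteq> 0"
  shows "\<exists>\<alpha> :: complex^('n option). \<alpha> \<noteq> 0 \<and> (AE x in \<mu>w. W x *v (\<Sum>k\<in>UNIV. \<alpha> $ k *s u k x) = 0)"
proof -
  obtain c d :: "nat \<Rightarrow> real" where cd: "\<And>i. c i < d i" "\<And>i. {c i..d i} \<subseteq> E"
    "decseq c" "incseq d" "(\<Union>i. {c i<..d i}) = E"
    by (rule einterval_exhaustion[OF interval], rule that) assumption+
  have "\<forall>i. \<exists>\<alpha> :: complex^('n option). norm \<alpha> = 1 \<and>
    (AE x in \<mu>w. x \<in> {c i<..d i} \<longrightarrow> W x *v (\<Sum>k\<in>UNIV. \<alpha> $ k *s u k x) = 0)"
    by (intro allI solutions_dependent_on_subinterval[OF u z cd(2,1)])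
  from choice[OF this] obtain \<alpha> :: "nat \<Rightarrow> complex^('n option)" where \<alpha>: "\<And>i. norm (\<alpha> i) = 1"
    "\<And>i. AE x in \<mu>w. x \<in> {c i<..d i} \<longrightarrow> W x *v (\<Sum>k\<in>UNIV. \<alpha> i $ k *s u k x) = 0"
    by blast
  have "\<forall>i. \<alpha> i \<in> sphere 0 1" using \<alpha>(1) by simp
  then obtain l r where lr: "l \<in> sphere 0 1" "strict_mono r" "(\<alpha> \<circ> r) \<longlonglongrightarrow> l"
    by (rule seq_compactE[OF compact_imp_seq_compact[OF compact_sphere]])
  have "AE x in \<mu>w. \<forall>i. x \<in> {c i<..d i} \<longrightarrow> W x *v (\<Sum>k\<in>UNIV. \<alpha> i $ k *s u k x) = 0"
    using \<alpha>(2) by (simp add: AE_all_countable)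
  then have "AE x in \<mu>w. W x *v (\<Sum>k\<in>UNIV. l $ k *s u k x) = 0"
    using AE_space
  proof eventually_elim
    case (elim x)
    then have "x \<in> E" using w_sets(2) by simp
    then obtain N where N: "x \<in> {c N<..d N}" using cd(5) by blast
    define T where "T = (\<lambda>\<beta> :: complex^('n option). W x *v (\<Sum>k\<in>UNIV. \<beta> $ k *s u k x))"
    have "linear (\<lambda>\<beta> :: complex^('n option). \<Sum>k\<in>UNIV. \<beta> $ k *s u k x)"
      by (rule linear_coordinate_sum)
    moreover have "linear (\<lambda>v. W x *v v)"
      using bilinear_matrix_vector_mult unfolding bilinear_def by blast
    ultimately have "linear T"
      unfolding T_def using linear_compose[unfolded o_def] by blast
    then have "(\<lambda>i. T ((\<alpha> \<circ> r) i)) \<longlonglongrightarrow> T l"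
      by (intro bounded_linear.tendsto[OF linear_bounded_linear lr(3)])
    moreover have "T ((\<alpha> \<circ> r) i) = 0" if "N \<le> i" for i
    proof -
      have "N \<le> r i" using that seq_suble[OF lr(2), of i] by simp
      then have "x \<in> {c (r i)<..d (r i)}"
        using N decseqD[OF cd(3), of N "r i"] incseqD[OF cd(4), of N "r i"] by auto
      then show ?thesis using elim(1) by (simp add: T_def)
    qed
    then have "(\<lambda>i. T ((\<alpha> \<circ> r) i)) \<longlonglongrightarrow> 0"
      by (intro tendsto_eventually eventually_sequentiallyI[of N]) auto
    ultimately have "T l = 0" by (rule LIMSEQ_unique)
    then show ?case by (simp add: T_def)
  qed
  moreover have "l \<noteq> 0" using lr(1) by auto
  ultimately show ?thesis by blast
qed

end

section \<open>The deficiency spaces\<close>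

lemma complex_field_field: "field complex_field"
proof -
  interpret cring complex_field
    by (rule cringI) (auto intro!: abelian_groupI comm_monoidI exI[of _ "- x" for x]
        simp: complex_field_def algebra_simps)
  show ?thesis
  proof (rule cring_fieldI2)
    fix a assume "a \<in> carrier complex_field" "a \<noteq> \<zero>\<^bsub>complex_field\<^esub>"
    then show "\<exists>b\<in>carrier complex_field. a \<otimes>\<^bsub>complex_field\<^esub> b = \<one>\<^bsub>complex_field\<^esub>"
      by (intro bexI[of _ "inverse a"]) (simp_all add: complex_field_def)
  qed (simp add: complex_field_def)
qed

text \<open>All vector space axioms hold because they hold for functions, provided that the operations
  of \<open>V\<close> come from those on functions. So the ambient Hilbert space can be bypassed.\<close>
lemma vectorspace_linear_image:
  fixes p :: "('x \<Rightarrow> complex^'n) \<Rightarrow> 'c" and V :: "(complex, 'c) module"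
  assumes carrier: "carrier V = p ` S" and zero: "\<zero>\<^bsub>V\<^esub> = p (\<lambda>x. 0)" "(\<lambda>x. 0) \<in> S"
    and add: "\<And>u v. u \<in> S \<Longrightarrow> v \<in> S \<Longrightarrow> p u \<oplus>\<^bsub>V\<^esub> p v = p (\<lambda>x. u x + v x)"
    "\<And>u v. u \<in> S \<Longrightarrow> v \<in> S \<Longrightarrow> (\<lambda>x. u x + v x) \<in> S"
    and smult: "\<And>c u. u \<in> S \<Longrightarrow> c \<odot>\<^bsub>V\<^esub> p u = p (\<lambda>x. c *s u x)" "\<And>c u. u \<in> S \<Longrightarrow> (\<lambda>x. c *s u x) \<in> S"
  shows "vectorspace complex_field V"
proof -
  interpret K: field complex_field by (rule complex_field_field)
  have ops: "(a \<oplus>\<^bsub>complex_field\<^esub> b) = a + b" "(a \<otimes>\<^bsub>complex_field\<^esub> b) = a * b" "\<one>\<^bsub>complex_field\<^esub> = 1" for a b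
    by (simp_all add: complex_field_def)
  have "abelian_group V"
  proof (rule abelian_groupI)
    fix X assume "X \<in> carrier V"
    then obtain u where u: "X = p u" "u \<in> S" unfolding carrier by blast
    have "(\<lambda>x. (- 1) *s u x + u x) = (\<lambda>x. 0)" by (rule ext) (simp add: vec_eq_iff)
    then have "p (\<lambda>x. (- 1) *s u x) \<oplus>\<^bsub>V\<^esub> X = \<zero>\<^bsub>V\<^esub>"
      unfolding u(1) zero add(1)[OF smult(2)[OF u(2)] u(2)] by (rule arg_cong)
    moreover have "p (\<lambda>x. (- 1) *s u x) \<in> carrier V"
      unfolding carrier by (rule imageI) (rule smult(2)[OF u(2)])
    ultimately show "\<exists>Y\<in>carrier V. Y \<oplus>\<^bsub>V\<^esub> X = \<zero>\<^bsub>V\<^esub>"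
      by (rule bexI)
  qed (auto simp: carrier zero add intro!: arg_cong[of _ _ p] simp: add_ac)
  then have "module complex_field V"
    by (intro moduleI K.is_cring)
      (auto simp: carrier smult add ops intro!: arg_cong[of _ _ p] simp: vector_add_ldistrib vector_sadd_rdistrib vector_smult_assoc)
  then show ?thesis
    by (simp add: vectorspace_def complex_field_field)
qed

text \<open>The cardinalities of linearly independent sets are at most \<open>n\<close>, so there is a maximal
  linearly independent set, which is a basis.\<close>
lemma dimension_leI:
  fixes V :: "(complex, 'c) module"
  assumes V: "vectorspace complex_field V"
    and dep: "\<And>B. finite B \<Longrightarrow> B \<subseteq> carrier V \<Longrightarrow> card B = Suc n \<Longrightarrow> module.lin_dep complex_field V B"
  shows "dimension V \<le> enat n"
proof -
  interpret vectorspace complex_field V by (rule V)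
  have bound: "finite A \<and> card A \<le> n" if A: "A \<subseteq> carrier V \<and> lin_indpt A" for A
  proof (rule ccontr)
    assume "\<not> (finite A \<and> card A \<le> n)"
    then obtain B where B: "B \<subseteq> A" "finite B" "card B = Suc n"
      by (metis infinite_arbitrarily_large not_less_eq_eq obtain_subset_with_card_n)
    then have "lin_dep B" using dep A by blast
    then have "lin_dep A" using B(1) unfolding lin_dep_def by (meson order_trans)
    then show False using A by blast
  qed
  have "{} \<subseteq> carrier V \<and> lin_indpt {}" unfolding lin_dep_def by auto
  from maximal_exists[of "\<lambda>S. S \<subseteq> carrier V \<and> lin_indpt S", OF bound this]
  obtain A where A: "finite A" "maximal A (\<lambda>S. S \<subseteq> carrier V \<and> lin_indpt S)" by blast
  have basis: "basis A" by (rule max_li_is_basis[OF A(2)])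
  then have "dim = card A" "fin_dim"
    using dim_basis[OF A(1)] A(1) unfolding fin_dim_def basis_def by auto
  moreover have "card A \<le> n" using bound A(2) unfolding maximal_def by blast
  ultimately show ?thesis by (simp add: dimension_def)
qed

context canonical_system
begin

lemma pre_L2_measurable: "u \<in> pre_L2 a b w \<Longrightarrow> u \<in> borel_measurable \<mu>w"
  using measurable_cong_sets[OF w_sets(1) refl] unfolding pre_L2_def by blast

lemma norm_sq_diff_zero_iff:
  assumes "u \<in> pre_L2 a b w" "v \<in> pre_L2 a b w"
  shows "norm_sq a b w (\<lambda>x. v x - u x) = 0 \<longleftrightarrow> (AE x in \<mu>w. W x *v v x = W x *v u x)"
proof -
  note [measurable] = pre_L2_measurable[OF assms(1)] pre_L2_measurable[OF assms(2)] w_sets(3)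
  have "norm_sq a b w (\<lambda>x. v x - u x) = 0 \<longleftrightarrow> (AE x in \<mu>w. ennreal (Re (quad_form (W x) (v x - u x))) = 0)"
    unfolding norm_sq_def by (rule nn_integral_0_iff_AE) measurable
  also have "\<dots> \<longleftrightarrow> (AE x in \<mu>w. W x *v v x = W x *v u x)"
  proof (rule eventually_cong[OF W_nonneg])
    fix x assume x: "nonneg_matrix (W x)"
    then have "0 \<le> Re (quad_form (W x) (v x - u x))" by (simp add: nonneg_matrix_def)
    then have "ennreal (Re (quad_form (W x) (v x - u x))) = 0 \<longleftrightarrow> Re (quad_form (W x) (v x - u x)) = 0"
      by (auto simp: ennreal_eq_0_iff)
    also have "\<dots> \<longleftrightarrow> W x *v v x = W x *v u x"
      unfolding nonneg_matrix_quad_form_zero_iff[OF x] by (simp add: matrix_vector_mult_diff_distrib)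
    finally show "ennreal (Re (quad_form (W x) (v x - u x))) = 0 \<longleftrightarrow> W x *v v x = W x *v u x" .
  qed
  finally show ?thesis .
qed

text \<open>For a non-negative matrix the kernel of the quadratic form is that of the matrix. So equality of
  classes is a linear condition, and compatibility with the operations is evident.\<close>
lemma cls_eq:
  assumes "u \<in> pre_L2 a b w"
  shows "cls a b w u = {v \<in> pre_L2 a b w. AE x in \<mu>w. W x *v v x = W x *v u x}"
  unfolding cls_def using norm_sq_diff_zero_iff[OF assms] by blast

lemma cls_eq_iff:
  assumes "u \<in> pre_L2 a b w" "v \<in> pre_L2 a b w"
  shows "cls a b w u = cls a b w v \<longleftrightarrow> (AE x in \<mu>w. W x *v u x = W x *v v x)"
proof
  assume "cls a b w u = cls a b w v"
  moreover have "u \<in> cls a b w u" using assms(1) by (simp add: cls_eq)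
  ultimately show "AE x in \<mu>w. W x *v u x = W x *v v x" using assms(2) by (simp add: cls_eq)
next
  assume uv: "AE x in \<mu>w. W x *v u x = W x *v v x"
  have "(AE x in \<mu>w. W x *v f x = W x *v u x) \<longleftrightarrow> (AE x in \<mu>w. W x *v f x = W x *v v x)" for f
    by (rule eventually_cong[OF uv]) simp
  then show "cls a b w u = cls a b w v" using assms by (simp add: cls_eq)
qed

lemma mem_cls: "u \<in> pre_L2 a b w \<Longrightarrow> u \<in> cls a b w u"
  by (simp add: cls_eq)

lemma L2_add:
  assumes u: "u \<in> pre_L2 a b w" and v: "v \<in> pre_L2 a b w"
  shows "cls a b w u \<oplus>\<^bsub>L2 a b w\<^esub> cls a b w v = cls a b w (\<lambda>x. u x + v x)"
proof -
  have "cls a b w (\<lambda>x. f x + g x) = cls a b w (\<lambda>x. u x + v x)"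
    if f: "f \<in> cls a b w u" and g: "g \<in> cls a b w v" for f g
  proof -
    have f': "f \<in> pre_L2 a b w" "AE x in \<mu>w. W x *v f x = W x *v u x"
      and g': "g \<in> pre_L2 a b w" "AE x in \<mu>w. W x *v g x = W x *v v x"
      using f g unfolding cls_eq[OF u] cls_eq[OF v] by auto
    show ?thesis
      unfolding cls_eq_iff[OF pre_L2_add[OF f'(1) g'(1)] pre_L2_add[OF u v]]
      using f'(2) g'(2) by eventually_elim (simp add: matrix_vector_right_distrib)
  qed
  then have "(\<Union>f\<in>cls a b w u. \<Union>g\<in>cls a b w v. cls a b w (\<lambda>x. f x + g x)) = cls a b w (\<lambda>x. u x + v x)"
    by (intro UN_constant_eq[OF mem_cls[OF u]] UN_constant_eq[OF mem_cls[OF v]] ballI)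
  then show ?thesis by (simp add: L2_def)
qed

lemma L2_smult:
  assumes u: "u \<in> pre_L2 a b w"
  shows "c \<odot>\<^bsub>L2 a b w\<^esub> cls a b w u = cls a b w (\<lambda>x. c *s u x)"
proof -
  have "cls a b w (\<lambda>x. c *s f x) = cls a b w (\<lambda>x. c *s u x)" if f: "f \<in> cls a b w u" for f
  proof -
    have f': "f \<in> pre_L2 a b w" "AE x in \<mu>w. W x *v f x = W x *v u x"
      using f unfolding cls_eq[OF u] by auto
    show ?thesis
      unfolding cls_eq_iff[OF pre_L2_scale[OF f'(1)] pre_L2_scale[OF u]]
      using f'(2) by eventually_elim (simp add: vector_scalar_commute)
  qed
  then have "(\<Union>f\<in>cls a b w u. cls a b w (\<lambda>x. c *s f x)) = cls a b w (\<lambda>x. c *s u x)"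
    by (intro UN_constant_eq[OF mem_cls[OF u]] ballI)
  then show ?thesis by (simp add: L2_def)
qed

definition graph_class :: "complex \<Rightarrow> (real \<Rightarrow> complex^'n) \<Rightarrow> (real \<Rightarrow> complex^'n) set \<times> (real \<Rightarrow> complex^'n) set"
  where "graph_class z u = (cls a b w u, cls a b w (\<lambda>x. z *s u x))"

lemma D_space_eq: "D_space a b J q w z = graph_class z ` Collect (solution z)"
proof (intro subset_antisym subsetI)
  fix p assume p: "p \<in> D_space a b J q w z"
  obtain X Y where p_eq: "p = (X, Y)" by (cases p)
  have pD: "(X, Y) \<in> T_max a b J q w \<and> Y = z \<odot>\<^bsub>L2 a b w\<^esub> X"
    using p unfolding D_space_def p_eq mem_Collect_eq prod.case .
  note XY = p_eq conjunct1[OF pD] conjunct2[OF pD]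
  from XY(2) obtain t where t: "(X, Y) = (case t of (u, f) \<Rightarrow> (cls a b w u, cls a b w f))" "t \<in> pre_T_max a b J q w"
    unfolding T_max_def by (rule imageE)
  obtain u f where tuf: "t = (u, f)" by (cases t)
  have cls: "X = cls a b w u \<and> Y = cls a b w f"
    using t(1) unfolding tuf by (simp only: prod.case prod.inject)
  have uf: "(u, f) \<in> pre_T_max a b J q w" "p = (cls a b w u, cls a b w f)"
    "cls a b w f = z \<odot>\<^bsub>L2 a b w\<^esub> cls a b w u"
    using t(2)[unfolded tuf] XY(1,3)[unfolded conjunct1[OF cls] conjunct2[OF cls]] by this+
  have u: "u \<in> pre_L2 a b w" and f: "f \<in> pre_L2 a b w" and bv: "u \<in> balanced_bv a b"
    and eq: "\<And>\<phi>. \<phi> \<in> test_functions a b \<Longrightarrow> J *v dist_deriv a b u \<phi> + dist_times a b q u \<phi> = dist_times a b w f \<phi>"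
    using uf(1) unfolding pre_T_max_def by simp_all
  have cls_f: "cls a b w f = cls a b w (\<lambda>x. z *s u x)" using uf(3) L2_smult[OF u] by simp
  then have AE_f: "AE x in \<mu>w. W x *v f x = W x *v (z *s u x)"
    using cls_eq_iff[OF f pre_L2_scale[OF u]] by simp
  have "dist_times a b w f \<phi> = dist_times a b w (\<lambda>x. z *s u x) \<phi>" if \<phi>: "\<phi> \<in> test_functions a b" for \<phi>
  proof -
    have [measurable]: "\<phi> \<in> borel_measurable \<mu>w"
      using test_function_continuous(1)[OF \<phi>, of UNIV]
      by (intro measurable_restrict_einterval[OF w_sets(1)] borel_measurable_continuous_onI)
    note [measurable] = pre_L2_measurable[OF f] pre_L2_measurable[OF pre_L2_scale[OF u, of z]] w_sets(3)
    show ?thesis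
      unfolding dist_times_def
    proof (rule integral_cong_AE)
      show "AE x in \<mu>w. \<phi> x *\<^sub>R (W x *v f x) = \<phi> x *\<^sub>R (W x *v (z *s u x))"
        using AE_f by eventually_elim simp
    qed measurable
  qed
  then have "solution z u" using u bv eq unfolding solution_def by simp
  then show "p \<in> graph_class z ` Collect (solution z)"
    using uf(2) cls_f by (auto simp: graph_class_def)
next
  fix p assume "p \<in> graph_class z ` Collect (solution z)"
  then obtain u where u: "solution z u" "p = graph_class z u" by blast
  then have "(u, \<lambda>x. z *s u x) \<in> pre_T_max a b J q w"
    using pre_L2_scale[of u z] unfolding pre_T_max_def solution_def by simp
  then have "p \<in> T_max a b J q w"
    unfolding T_max_def by (rule rev_image_eqI) (simp add: u(2) graph_class_def)
  then show "p \<in> D_space a b J q w z"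
    unfolding D_space_def using L2_smult[OF solution_D(1)[OF u(1)]] by (simp add: u(2) graph_class_def)
qed

abbreviation V where "V z \<equiv> (direct_sum (L2 a b w) (L2 a b w))\<lparr>carrier := D_space a b J q w z\<rparr>"

lemma V_ops:
  shows "\<zero>\<^bsub>V z\<^esub> = graph_class z (\<lambda>x. 0)"
    and "solution z u \<Longrightarrow> solution z v \<Longrightarrow> graph_class z u \<oplus>\<^bsub>V z\<^esub> graph_class z v = graph_class z (\<lambda>x. u x + v x)"
    and "solution z u \<Longrightarrow> c \<odot>\<^bsub>V z\<^esub> graph_class z u = graph_class z (\<lambda>x. c *s u x)"
proof -
  show "\<zero>\<^bsub>V z\<^esub> = graph_class z (\<lambda>x. 0)"
    by (simp add: direct_sum_def L2_def graph_class_def)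
  show "graph_class z u \<oplus>\<^bsub>V z\<^esub> graph_class z v = graph_class z (\<lambda>x. u x + v x)" if "solution z u" "solution z v"
    using that[THEN solution_D(1)] L2_add pre_L2_scale
    by (simp add: direct_sum_def graph_class_def vector_add_ldistrib)
  show "c \<odot>\<^bsub>V z\<^esub> graph_class z u = graph_class z (\<lambda>x. c *s u x)" if "solution z u"
    using solution_D(1)[OF that] L2_smult pre_L2_scale
    by (simp add: direct_sum_def graph_class_def vector_smult_assoc mult.commute)
qed

lemma V_vectorspace: "vectorspace complex_field (V z)"
proof (rule vectorspace_linear_image[where p = "graph_class z" and S = "Collect (solution z)"])
  show "carrier (V z) = graph_class z ` Collect (solution z)" using D_space_eq by simp
qed (use V_ops solution_zero solution_add solution_scale in auto)

lemma deficiency_index_le: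
  assumes z: "Im z \<noteq> 0"
  shows "deficiency_index a b J q w z \<le> enat CARD('n)"
  unfolding deficiency_index_def
proof (rule dimension_leI[OF V_vectorspace])
  interpret V: vectorspace complex_field "V z" by (rule V_vectorspace)
  fix B assume B: "finite B" "B \<subseteq> carrier (V z)" "card B = Suc CARD('n)"
  have "card (UNIV :: 'n option set) = card B" using B(3) by simp
  from finite_same_card_bij[OF finite B(1) this]
  obtain e :: "'n option \<Rightarrow> _" where e: "bij_betw e UNIV B" ..
  have "\<exists>u. solution z u \<and> e k = graph_class z u" for k
  proof -
    have "e k \<in> carrier (V z)" using e B(2) bij_betwE by blast
    then show ?thesis using D_space_eq[of z] by (auto simp del: split_paired_Ex)
  qed
  then have "\<forall>k. \<exists>u. solution z u \<and> e k = graph_class z u" by (rule allI)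
  from choice[OF this] obtain u where "\<forall>k. solution z (u k) \<and> e k = graph_class z (u k)" ..
  then have u: "\<And>k. solution z (u k)" "\<And>k. e k = graph_class z (u k)" by simp_all
  obtain \<alpha> :: "complex^('n option)" where \<alpha>: "\<alpha> \<noteq> 0" "AE x in \<mu>w. W x *v (\<Sum>k\<in>UNIV. \<alpha> $ k *s u k x) = 0"
    using solutions_dependent[of z u, OF u(1) z] by (elim exE conjE)
  \<comment> \<open>Linear combinations are indexed by the vectors themselves, hence the detour through the
     enumeration \<open>e\<close>.\<close>
  define c where "c = (\<lambda>X. \<alpha> $ inv_into UNIV e X)"
  have c_e: "c (e k) = \<alpha> $ k" for k
    using e by (simp add: c_def bij_betw_def)
  have finsum: "(\<Oplus>\<^bsub>V z\<^esub>k\<in>I. \<alpha> $ k \<odot>\<^bsub>V z\<^esub> e k) = graph_class z (\<lambda>x. \<Sum>k\<in>I. \<alpha> $ k *s u k x)" if "finite I" for I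
    using that
  proof (induction I rule: finite_induct)
    case empty
    then show ?case using V_ops(1) by simp
  next
    case (insert k I)
    have mem: "\<alpha> $ k \<odot>\<^bsub>V z\<^esub> e k \<in> carrier (V z)" for k
      unfolding u(2) V_ops(3)[OF u(1)] using D_space_eq[of z] solution_scale[OF u(1)] by simp
    have "(\<Oplus>\<^bsub>V z\<^esub>k\<in>insert k I. \<alpha> $ k \<odot>\<^bsub>V z\<^esub> e k) =
        \<alpha> $ k \<odot>\<^bsub>V z\<^esub> e k \<oplus>\<^bsub>V z\<^esub> (\<Oplus>\<^bsub>V z\<^esub>k\<in>I. \<alpha> $ k \<odot>\<^bsub>V z\<^esub> e k)"
      using insert(1,2) mem by (intro V.finsum_insert) auto
    also have "\<dots> = graph_class z (\<lambda>x. \<alpha> $ k *s u k x + (\<Sum>k\<in>I. \<alpha> $ k *s u k x))"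
      unfolding insert.IH unfolding u(2) V_ops(3)[OF u(1)]
      by (intro V_ops(2) solution_scale solution_sum u insert(1))
    also have "\<dots> = graph_class z (\<lambda>x. \<Sum>k\<in>insert k I. \<alpha> $ k *s u k x)"
      using insert(1,2) by simp
    finally show ?case .
  qed
  have "V.lincomb c B = (\<Oplus>\<^bsub>V z\<^esub>k\<in>UNIV. \<alpha> $ k \<odot>\<^bsub>V z\<^esub> e k)"
  proof -
    have B_eq: "B = e ` UNIV" using e by (simp add: bij_betw_def)
    have "(\<lambda>X. c X \<odot>\<^bsub>V z\<^esub> X) \<in> e ` UNIV \<rightarrow> carrier (V z)"
    proof
      fix X assume "X \<in> e ` UNIV"
      then obtain k where k: "X = e k" by blast
      show "c X \<odot>\<^bsub>V z\<^esub> X \<in> carrier (V z)"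
        unfolding k u(2) V_ops(3)[OF u(1)] using D_space_eq[of z] solution_scale[OF u(1)] by simp
    qed
    then show ?thesis
      unfolding V.lincomb_def B_eq using e
      by (subst V.finsum_reindex) (auto simp: c_e bij_betw_def)
  qed
  also have "\<dots> = graph_class z (\<lambda>x. \<Sum>k\<in>UNIV. \<alpha> $ k *s u k x)" by (rule finsum) simp
  also have "\<dots> = \<zero>\<^bsub>V z\<^esub>"
  proof -
    define v where "v = (\<lambda>x. \<Sum>k\<in>UNIV. \<alpha> $ k *s u k x)"
    have v: "v \<in> pre_L2 a b w" unfolding v_def by (intro solution_D(1)[OF solution_sum[where z = z]] u) simp
    have 0: "(\<lambda>x. 0) \<in> pre_L2 a b w" by (rule solution_D(1)[OF solution_zero])
    have Wv: "AE x in \<mu>w. W x *v v x = 0" using \<alpha>(2) by (simp add: v_def)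
    have "cls a b w v = cls a b w (\<lambda>x. 0)"
      unfolding cls_eq_iff[OF v 0] using Wv by simp
    moreover have "cls a b w (\<lambda>x. z *s v x) = cls a b w (\<lambda>x. z *s 0)"
      unfolding cls_eq_iff[OF pre_L2_scale[OF v] pre_L2_scale[OF 0]]
      using Wv by eventually_elim (simp add: vector_scalar_commute)
    ultimately show ?thesis unfolding V_ops(1) graph_class_def v_def[symmetric] by simp
  qed
  finally have "V.lincomb c B = \<zero>\<^bsub>V z\<^esub>" .
  moreover obtain k where "\<alpha> $ k \<noteq> 0" using \<alpha>(1) by (auto simp: vec_eq_iff)
  then have "c (e k) \<noteq> \<zero>\<^bsub>complex_field\<^esub>" by (simp add: c_e complex_field_def)
  moreover have "e k \<in> B" using e bij_betwE by blast
  moreover have "c \<in> B \<rightarrow> carrier complex_field" by (simp add: complex_field_def)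
  ultimately show "V.lin_dep B"
    unfolding V.lin_dep_def using B(1) by (intro exI[of _ B] exI[of _ c] exI[of _ "e k"] conjI order_refl)
qed

end

section \<open>The deficiency indices\<close>

theorem theorem4p1:
  fixes a b :: ereal
    and J :: "complex^'n^'n"
    and q w :: "(complex^'n^'n) dist"
  assumes "a < b"
    and "skew_hermitian J" and "invertible J"
    and "order_zero a b q" and "hermitian_dist a b q"
    and "order_zero a b w" and "nonneg_dist a b w"
  shows "deficiency_index a b J q w \<i> \<le> enat CARD('n) \<and>
         deficiency_index a b J q w (- \<i>) \<le> enat CARD('n)"
proof -
  interpret canonical_system a b J q w
    by standard fact+
  show ?thesis by (intro conjI deficiency_index_le) simp_all
qed

end
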